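(* There exist $\bar\alpha,\bar\epsilon>0$ such that for all $\alpha''\in(0,\bar\alpha]$ and all $\epsilon'\in(0,\bar\epsilon]$ there exist $0<\alpha'<\alpha<\alpha''$ and $K=K(\alpha,\epsilon')>0$ such that the following holds. Let $V\in C^2_{pw}((0,\infty))$ satisfy: (A) $\mathcal E_4[V]$ has a strict minimum at the unit square, and this is its unique minimum (up to isometries) amongst all $4$-point configurations with interpoint distances in $E_{\alpha''}$; (B) $-1=\min V\le V(r)\le -1+\epsilon'$ for $r\in E_{\alpha'}$; (C) $V(r)>-\frac12$ if $r\notin(1-\alpha,\sqrt2+\alpha)$; (D) $V(r)\ge K$ for $r\le 1-\alpha$; (E) $V(r)=0$ for $r\ge\sqrt2+\alpha''$. Then $$N\,\overline{\mathcal E}_{\mathrm{sq}}[V]\le \mathcal E[V](N)\le N\,\overline{\mathcal E}_{\mathrm{sq}}[V]+O(N^{1/2})\qquad\text{as }N\to+\infty,$$ where $\overline{\mathcal E}_{\mathrm{sq}}[V]=\min\mathcal E_4[V]$.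
   Context: For a set $X_N=\{x_1,\dots,x_N\}\subset\mathbb{R}^2$ of $N$ distinct points, $\mathcal E[V](X_N):=\frac12\sum_{i\ne j}V(|x_i-x_j|)$, and $\mathcal E[V](N):=\min\{\mathcal E[V](X_N):\sharp X_N=N\}$. Moreover $$\overline{\mathcal E}_{\mathrm{sq}}[V]:=\min_{t>0}\lim_{R\to\infty}\frac{\mathcal E[V](t\mathbb{Z}^2\cap B_R)}{\sharp(t\mathbb{Z}^2\cap B_R)},$$ with $B_R$ the open ball of radius $R$ centered at $0$. The $4$-point energy is $\mathcal E_4[V](x_1,x_2,x_3,x_4):=\frac12\sum_{j=1}^2\sum_{i=1}^4V(|x_i-x_{i+j}|)$ for $x_i\in\mathbb{R}^2$, indices modulo $4$; so the sides $\{x_i,x_{i+1}\}$ have weight $\frac12$ and the diagonals $\{x_1,x_3\},\{x_2,x_4\}$ have weight $1$. The unit square is the configuration of the vertices of a square of sidelength $1$, labelled cyclically; minimality is understood up to rotations and translations. $\min \mathcal E_4[V]$ is the minimum over all $4$-tuples of distinct points of $\mathbb{R}^2$. For $\beta>0$: $E_\beta^1:=(1-\beta,1+\beta)$, $E_\beta^2:=(\sqrt2-\beta,\sqrt2+\beta)$, $E_\beta:=E_\beta^1\cup E_\beta^2$. $C^2_{pw}((0,\infty))$ is the class of real-valued piecewise-$C^2$ functions on $(0,\infty)$, understood as $C^1$ functions which are $C^2$ away from a locally finite set of points, at which one-sided second derivatives exist. $O(N^{1/2})$ denotes a quantity bounded in absolute value by a constant times $N^{1/2}$ for large $N$. The first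 inequality is for every $N\in\mathbb{N}$. *)

theory Defs
  imports "HOL-Analysis.Analysis" "HOL-Library.Landau_Symbols"
begin

text \<open>
  Potentials are total functions \<open>V :: real \<Rightarrow> real\<close>; only their values on \<open>{0<..}\<close> matter.
  Minima are written with \<open>LEAST\<close>: this is the minimum when it is attained and is unspecified
  otherwise, so it must not be confused with an infimum. Likewise \<open>Lim\<close> is unspecified when
  the limit does not exist.
\<close>

definition C2_pw :: "(real \<Rightarrow> real) \<Rightarrow> bool" where
  "C2_pw V \<longleftrightarrow>
     (\<forall>r>0. V differentiable at r) \<and> continuous_on {0<..} (deriv V) \<and>
     (\<exists>S \<subseteq> {0<..}.
        (\<forall>r>0. \<exists>e>0. finite (S \<inter> ball r e)) \<and>
        (\<forall>r\<in>{0<..} - S. deriv V differentiable at r) \<and>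
        continuous_on ({0<..} - S) (deriv (deriv V)) \<and>
        (\<forall>s\<in>S. deriv V differentiable at_left s \<and> deriv V differentiable at_right s))"

definition energy :: "(real \<Rightarrow> real) \<Rightarrow> (real^2) set \<Rightarrow> real" where
  "energy V X = (\<Sum>x\<in>X. \<Sum>y\<in>X - {x}. V (dist x y)) / 2"

definition min_energy :: "(real \<Rightarrow> real) \<Rightarrow> nat \<Rightarrow> real" where
  "min_energy V N = (LEAST e. \<exists>X. finite X \<and> card X = N \<and> e = energy V X)"

definition square_lattice :: "(real^2) set" where
  "square_lattice = {z. \<forall>i. z $ i \<in> \<int>}"

definition lattice_energy :: "(real \<Rightarrow> real) \<Rightarrow> real \<Rightarrow> real" where
  "lattice_energy V t =
     Lim at_top (\<lambda>R. energy V ((*\<^sub>R) t ` square_lattice \<inter> ball 0 R)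
                      / real (card ((*\<^sub>R) t ` square_lattice \<inter> ball 0 R)))"

definition E_sq :: "(real \<Rightarrow> real) \<Rightarrow> real" where
  "E_sq V = (LEAST e. \<exists>t>0. e = lattice_energy V t)"

text \<open>
  A labelled four-point configuration is a vector \<open>x :: real^2^4\<close>. Arithmetic in the index
  type \<open>4\<close> is modulo 4, so the point labelled 4 is also the one labelled 0.
\<close>

definition E4 :: "(real \<Rightarrow> real) \<Rightarrow> real^2^4 \<Rightarrow> real" where
  "E4 V x = (\<Sum>j\<in>{1, 2}. \<Sum>i\<in>UNIV. V (dist (x $ i) (x $ (i + j)))) / 2"

definition min_E4 :: "(real \<Rightarrow> real) \<Rightarrow> real" where
  "min_E4 V = (LEAST e. \<exists>x. inj (($) x) \<and> e = E4 V x)"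

definition unit_square :: "real^2^4" where
  "unit_square = (\<chi> i. if i = 1 then vector [0, 0] else if i = 2 then vector [1, 0]
                       else if i = 3 then vector [1, 1] else vector [0, 1])"

text \<open>
  Labels are respected. Reflections are admitted, so both the clockwise and the counterclockwise
  cyclic labellings of a square count as the unit square; the non-cyclic labellings do not.
\<close>

definition isometric4 :: "real^2^4 \<Rightarrow> real^2^4 \<Rightarrow> bool" where
  "isometric4 x y \<longleftrightarrow>
     (\<exists>f a. orthogonal_transformation f \<and> (\<forall>i. y $ i = a + f (x $ i)))"

definition E_set :: "real \<Rightarrow> real set" where
  "E_set \<beta> = {1 - \<beta><..<1 + \<beta>} \<union> {sqrt 2 - \<beta><..<sqrt 2 + \<beta>}"

text \<open>Strict local minimality, modulo the isometry invariance of the energy.\<close>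

definition strict_min_at_square :: "(real \<Rightarrow> real) \<Rightarrow> bool" where
  "strict_min_at_square V \<longleftrightarrow>
     (\<exists>d>0. \<forall>x. inj (($) x) \<and> dist x unit_square < d \<and> \<not> isometric4 unit_square x
            \<longrightarrow> E4 V unit_square < E4 V x)"

definition unique_min_square :: "(real \<Rightarrow> real) \<Rightarrow> real \<Rightarrow> bool" where
  "unique_min_square V \<beta> \<longleftrightarrow>
     (\<forall>x. inj (($) x) \<and> (\<forall>i j. i \<noteq> j \<longrightarrow> dist (x $ i) (x $ j) \<in> E_set \<beta>) \<and>
          \<not> isometric4 unit_square x \<longrightarrow> E4 V unit_square < E4 V x)"

end

theory Submission
  imports Defs "HOL-Real_Asymp.Real_Asymp"
begin

text \<open>
  Let \<open>m = 2 V(1) + 2 V(\<surd>2)\<close>. This is the four-point energy of the unit square and also the energy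
  per point of the unit square lattice, where every point has four neighbours at distance \<open>1\<close> and four
  at distance \<open>\<surd>2\<close>. The heart of the matter is the inequality \<open>energy V X \<ge> N m\<close> for every set \<open>X\<close>
  of \<open>N\<close> points (\<open>energy_lower_bound\<close>, \<open>energy_ge\<close>).

  Suppose that the points keep a distance larger than \<open>1 - \<alpha>\<close>, and call a pair a bond if its
  distance is below \<open>\<surd>2 + \<alpha>''\<close>; other pairs contribute nothing. A quadrilateral with all sides at
  least \<open>1\<close> and both diagonals at most \<open>\<surd>2\<close> is a unit square. Quantitatively, two bonds that
  cross are the diagonals of an almost perfect unit square (\<open>crossing_square\<close>), with an error that is
  linear in the tolerance. So a bond crosses at most one other bond, and a pair of points is a side of at most two of
  these squares, and then not a diagonal. Let \<open>S\<close> be the number of crossings. Deleting one diagonal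
  of every crossing leaves a plane straight-line graph, which has at most \<open>3 N\<close> edges, and the \<open>2 S\<close>
  half squares are empty triangles of it, of which there are at most \<open>2 N\<close>
  (\<open>plane_graph_bounds\<close>). Hence there are at most \<open>3 N + S\<close> bonds, and \<open>S \<le> N\<close>.

  Now cover the bonds by squares: give each crossing square its four-point energy, in which the
  diagonals have weight \<open>1\<close> and the sides weight \<open>1/2\<close>. By hypothesis (A) each square has energy
  at least \<open>m\<close>, no pair receives a total weight above \<open>1\<close>, and the squares use up a weight \<open>4 S\<close>.
  The remaining weight is at most \<open>(3 N + S) - 4 S = 3 (N - S)\<close>, and each unit of it costs at least \<open>-1\<close>. So
  the energy is at least \<open>m S - 3 (N - S)\<close>, which is at least \<open>m N\<close> because \<open>m \<le> -3\<close> and \<open>S \<le> N\<close>. The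
  hypothesis (A) does not control squares with a diagonal in \<open>[\<surd>2 + \<alpha>, \<surd>2 + \<alpha>'')\<close>; there
  \<open>V > -1/2\<close>, and this worsens the constant \<open>3\<close> only to \<open>7/2\<close>.

  The rest is softer. Points closer than \<open>1 - \<alpha>\<close> are removed without raising the energy, by
  moving a point of a most crowded cluster far away (\<open>remove_collisions\<close>). Since \<open>V\<close> has finite range,
  configurations can be compressed into a bounded region, so that minimisers exist
  (\<open>minimizer_exists\<close>). The energy per point of a dilated lattice has a limit (\<open>lattice_energy_tendsto\<close>),
  which is at least \<open>m\<close>, with equality for the unit lattice. Finally a patch of the unit lattice
  between two consecutive square blocks has energy at most \<open>N m + O(\<surd>N)\<close> (\<open>lattice_competitor\<close>).
\<close>

section \<open>Plane straight-line graphs\<close>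

text \<open>
  Straight-line drawings, described in coordinates in which no two vertices have the same
  abscissa. An edge is stored once, directed to the right.
\<close>

locale plane_graph =
  fixes xc yc :: "'a::real_vector \<Rightarrow> real" and V :: "'a set" and F :: "('a \<times> 'a) set"
  assumes lin: "linear xc" "linear yc"
    and coord_eq: "\<And>p q. xc p = xc q \<Longrightarrow> yc p = yc q \<Longrightarrow> p = q"
    and fin: "finite V" and xinj: "inj_on xc V"
    and F_sub: "F \<subseteq> V \<times> V"
    and F_right: "\<And>p q. (p, q) \<in> F \<Longrightarrow> xc p < xc q"
    and nocross: "\<And>a b c d. (a, b) \<in> F \<Longrightarrow> (c, d) \<in> F \<Longrightarrow> (a, b) \<noteq> (c, d) \<Longrightarrow>
                    open_segment a b \<inter> open_segment c d = {}"
    and novert: "\<And>a b. (a, b) \<in> F \<Longrightarrow> open_segment a b \<inter> V = {}"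
begin

definition slope :: "'a \<Rightarrow> 'a \<Rightarrow> real" where
  "slope p q = (yc q - yc p) / (xc q - xc p)"

definition height :: "'a \<Rightarrow> 'a \<Rightarrow> real \<Rightarrow> real" where
  "height p q x = yc p + slope p q * (x - xc p)"

lemma height_left [simp]: "height p q (xc p) = yc p"
  by (simp add: height_def)

lemma height_right: "xc p \<noteq> xc q \<Longrightarrow> height p q (xc q) = yc q"
  by (simp add: height_def slope_def)

lemma on_segment:
  assumes "xc a < x" "x < xc b"
  obtains z where "z \<in> open_segment a b" "xc z = x" "yc z = height a b x"
proof -
  define u where "u = (x - xc a) / (xc b - xc a)"
  define z where "z = (1 - u) *\<^sub>R a + u *\<^sub>R b"
  have u: "0 < u" "u < 1" using assms by (auto simp: u_def field_simps)
  have "a \<noteq> b" using assms by auto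
  then have "z \<in> open_segment a b" unfolding in_segment z_def using u by auto
  moreover have "xc z = xc a + u * (xc b - xc a)" "yc z = yc a + u * (yc b - yc a)"
    unfolding z_def by (simp_all add: lin linear_add linear_scale) (simp_all add: algebra_simps)
  moreover have "u * (xc b - xc a) = x - xc a" using assms by (simp add: u_def)
  moreover have "u * (yc b - yc a) = slope a b * (x - xc a)" by (simp add: u_def slope_def)
  ultimately show thesis using that[of z] by (simp add: height_def)
qed

lemma vertex_off_edge:
  assumes "(a, b) \<in> F" "v \<in> V" "xc a < xc v" "xc v < xc b"
  shows "height a b (xc v) \<noteq> yc v"
proof
  assume h: "height a b (xc v) = yc v"
  obtain z where z: "z \<in> open_segment a b" "xc z = xc v" "yc z = height a b (xc v)"
    using on_segment assms by blast
  then have "z = v" using coord_eq h by auto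
  then show False using z novert assms by blast
qed

text \<open>
  Over a common range of abscissae one of two edges stays above the other: otherwise the
  intermediate value theorem would yield a crossing.
\<close>

lemma edges_keep_order:
  assumes F: "(a, b) \<in> F" "(c, d) \<in> F"
    and x: "xc a \<le> x0" "xc c \<le> x0" "x0 < x1" "x1 \<le> xc b" "x1 \<le> xc d"
    and h0: "height a b x0 < height c d x0" and h1: "height a b x1 > height c d x1"
  shows False
proof -
  define f where "f x = height a b x - height c d x" for x
  have "continuous_on {x0..x1} f" unfolding f_def height_def by (intro continuous_intros)
  then obtain x where x': "x0 \<le> x" "x \<le> x1" "f x = 0"
    using IVT'[of f x0 0 x1] h0 h1 x by (auto simp: f_def)
  have "x \<noteq> x0" "x \<noteq> x1" using x' h0 h1 by (auto simp: f_def)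
  then have xx: "x0 < x" "x < x1" using x' by auto
  obtain z where z: "z \<in> open_segment a b" "xc z = x" "yc z = height a b x"
    using on_segment[of a x b] xx x by auto
  obtain w where w: "w \<in> open_segment c d" "xc w = x" "yc w = height c d x"
    using on_segment[of c x d] xx x by auto
  have "z = w" using coord_eq z w x' by (simp add: f_def)
  moreover have "(a, b) \<noteq> (c, d)" using h0 by auto
  ultimately show False using nocross[OF F] z w by blast
qed

lemma slope_le_height:
  assumes "xc p < xc z"
  shows "slope p q \<le> slope p z \<longleftrightarrow> height p q (xc z) \<le> yc z"
    and "slope p z \<le> slope p q \<longleftrightarrow> yc z \<le> height p q (xc z)"
  using assms by (auto simp: height_def slope_def[of p z] field_simps)

lemma edge_V: "(p, q) \<in> F \<Longrightarrow> p \<in> V \<and> q \<in> V" using F_sub by auto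

lemma slope_inj:
  assumes F: "(p, q) \<in> F" and v: "v \<in> V" "xc p < xc v" "xc v \<le> xc q" and s: "slope p q = slope p v"
  shows "v = q"
proof (rule ccontr)
  assume ne: "v \<noteq> q"
  then have "xc v < xc q" using v xinj edge_V[OF F] unfolding inj_on_def by fastforce
  then have "height p q (xc v) \<noteq> yc v" using vertex_off_edge F v by blast
  moreover have "height p q (xc v) = yc v" using s v slope_le_height[of p v q] by auto
  ultimately show False by blast
qed

lemma slope_inj_edges:
  assumes "(p, q) \<in> F" "(p, q') \<in> F" "slope p q = slope p q'"
  shows "q = q'"
  using slope_inj[of p q q'] slope_inj[of p q' q] assms F_right edge_V
  by (metis linorder_le_cases)

text \<open>
  An edge is covered if its left end has a steeper edge to the right. All edges
  but the steepest one at each vertex are covered, so bounding the covered edges bounds all of them.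
\<close>

definition covered :: "('a \<times> 'a) set" where
  "covered = {(p, q) \<in> F. \<exists>q'. (p, q') \<in> F \<and> slope p q < slope p q'}"

text \<open>
  A covered edge \<open>p q1\<close> and the next steeper edge \<open>p q2\<close> bound a cone with apex \<open>p\<close>; \<open>r\<close> is
  the vertex that a sweep to the right meets first in this cone. The covered edge will be charged to
  \<open>r\<close>, on its upper side if \<open>r = q1\<close> and on its lower side otherwise.
\<close>

definition wedge :: "'a \<Rightarrow> 'a \<Rightarrow> 'a \<Rightarrow> 'a \<Rightarrow> bool" where
  "wedge p q1 q2 r \<longleftrightarrow> (p, q1) \<in> F \<and> (p, q2) \<in> F \<and> slope p q1 < slope p q2 \<and>
     (\<forall>q. (p, q) \<in> F \<and> slope p q1 < slope p q \<longrightarrow> slope p q2 \<le> slope p q) \<and>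
     r \<in> V \<and> xc p < xc r \<and> slope p q1 \<le> slope p r \<and> slope p r \<le> slope p q2 \<and>
     (\<forall>z\<in>V. xc p < xc z \<and> slope p q1 \<le> slope p z \<and> slope p z \<le> slope p q2 \<longrightarrow> xc r \<le> xc z)"

lemma finite_F: "finite F"
  using F_sub fin by (meson finite_SigmaI finite_subset)

lemma ex_wedge:
  assumes "(p, q1) \<in> covered"
  shows "\<exists>q2 r. wedge p q1 q2 r"
proof -
  define A where "A = {q. (p, q) \<in> F \<and> slope p q1 < slope p q}"
  have "A \<subseteq> V" using F_sub by (auto simp: A_def)
  then have A: "finite A" "A \<noteq> {}" using assms fin finite_subset by (auto simp: A_def covered_def)
  define q2 where "q2 = arg_min_on (slope p) A"
  have q2: "q2 \<in> A" "\<forall>q\<in>A. slope p q2 \<le> slope p q"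
    using arg_min_if_finite[OF A, of "slope p"] unfolding q2_def by (auto simp: not_less)
  define C where "C = {z\<in>V. xc p < xc z \<and> slope p q1 \<le> slope p z \<and> slope p z \<le> slope p q2}"
  have "q2 \<in> C" using q2(1) F_right edge_V by (auto simp: C_def A_def)
  then have C: "finite C" "C \<noteq> {}" using fin by (auto simp: C_def)
  define r where "r = arg_min_on xc C"
  have r: "r \<in> C" "\<forall>z\<in>C. xc r \<le> xc z"
    using arg_min_if_finite[OF C, of xc] unfolding r_def by (auto simp: not_less)
  have "(p, q1) \<in> F" using assms by (auto simp: covered_def)
  then have "wedge p q1 q2 r" using q2 r unfolding wedge_def A_def C_def by auto
  then show ?thesis by blast
qed

lemma wedge_ends:
  assumes w: "wedge p q1 q2 r"
  shows "xc r \<le> xc q1" "xc r \<le> xc q2" "slope p r = slope p q1 \<Longrightarrow> r = q1"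
    "slope p r = slope p q2 \<Longrightarrow> r = q2"
proof -
  show 1: "xc r \<le> xc q1" using w F_right edge_V unfolding wedge_def by (metis order_refl less_imp_le)
  show 2: "xc r \<le> xc q2" using w F_right edge_V unfolding wedge_def by (metis order_refl less_imp_le)
  show "slope p r = slope p q1 \<Longrightarrow> r = q1" using slope_inj[of p q1 r] w 1 unfolding wedge_def by auto
  show "slope p r = slope p q2 \<Longrightarrow> r = q2" using slope_inj[of p q2 r] w 2 unfolding wedge_def by auto
qed

text \<open>
  An edge that reaches \<open>r\<close> from the left and does not start at the apex starts outside the
  cone, because \<open>r\<close> is the first vertex in the cone. It cannot enter the cone without crossing one
  of the two bounding edges. So it must pass outside, and \<open>r\<close> is one of the ends \<open>q1\<close>, \<open>q2\<close>.
\<close>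

lemma wedge_other_edge:
  assumes w: "wedge p q1 q2 r" and e: "(p', r) \<in> F" and ne: "p' \<noteq> p"
  shows "(r = q1 \<and> slope p r < slope p' r) \<or> (r = q2 \<and> slope p' r < slope p r)"
proof -
  note W = w[unfolded wedge_def]
  note E = wedge_ends[OF w]
  have lt: "xc p' < xc r" "xc p < xc r" using F_right e W by auto
  have "p' \<in> V" "p \<in> V" "r \<in> V" using edge_V e W by blast+
  have ne': "xc p' \<noteq> xc p" using xinj ne \<open>p' \<in> V\<close> \<open>p \<in> V\<close> unfolding inj_on_def by blast
  \<comment> \<open>From \<open>x0\<close> up to \<open>r\<close> the edge \<open>p' r\<close> and both edges of the cone are present.\<close>
  define x0 where "x0 = max (xc p) (xc p')"
  have x0: "x0 < xc r" "xc p \<le> x0" "xc p' \<le> x0" using lt by (auto simp: x0_def)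
  have hr: "height p' r (xc r) = yc r" using height_right lt by simp
  have out: "height p' r x0 < height p q1 x0 \<or> height p' r x0 > height p q2 x0"
  proof (cases "xc p < xc p'")
    case True
    have "\<not> (slope p q1 \<le> slope p p' \<and> slope p p' \<le> slope p q2)"
      using W True \<open>p' \<in> V\<close> lt by (meson not_le)
    then show ?thesis using slope_le_height[OF True] True by (auto simp: x0_def)
  next
    case False
    then have lt': "xc p' < xc p" using ne' by auto
    have "height p' r (xc p) \<noteq> yc p" using vertex_off_edge[OF e \<open>p \<in> V\<close>] lt' lt by auto
    then show ?thesis using lt' by (auto simp: x0_def)
  qed
  have sl: "slope p r < slope p' r" if "height p' r x0 < height p r x0"
  proof -
    have "yc r = height p r x0 + slope p r * (xc r - x0)"
      using height_right[of p r] lt unfolding height_def by (simp add: algebra_simps)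
    moreover have "yc r = height p' r x0 + slope p' r * (xc r - x0)"
      using hr unfolding height_def by (simp add: algebra_simps)
    ultimately have "slope p r * (xc r - x0) < slope p' r * (xc r - x0)" using that by linarith
    then show ?thesis using x0 by simp
  qed
  have sl': "slope p' r < slope p r" if "height p r x0 < height p' r x0"
  proof -
    have "yc r = height p r x0 + slope p r * (xc r - x0)"
      using height_right[of p r] lt unfolding height_def by (simp add: algebra_simps)
    moreover have "yc r = height p' r x0 + slope p' r * (xc r - x0)"
      using hr unfolding height_def by (simp add: algebra_simps)
    ultimately have "slope p' r * (xc r - x0) < slope p r * (xc r - x0)" using that by linarith
    then show ?thesis using x0 by simp
  qed
  from out show ?thesis
  proof
    assume low: "height p' r x0 < height p q1 x0"
    have "r = q1"
    proof (rule ccontr)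
      assume "r \<noteq> q1"
      then have "slope p q1 < slope p r" using E W by fastforce
      then have "height p q1 (xc r) < height p' r (xc r)"
        using slope_le_height(2)[OF lt(2), of q1] hr by (simp add: not_le)
      then show False using edges_keep_order[of p' r p q1 x0 "xc r"] e W x0 low E by auto
    qed
    then show ?thesis using sl low by auto
  next
    assume high: "height p' r x0 > height p q2 x0"
    have "r = q2"
    proof (rule ccontr)
      assume "r \<noteq> q2"
      then have "slope p r < slope p q2" using E W by fastforce
      then have "height p' r (xc r) < height p q2 (xc r)"
        using slope_le_height(1)[OF lt(2), of q2] hr by (simp add: not_le)
      then show False using edges_keep_order[of p q2 p' r x0 "xc r"] e W x0 high E by auto
    qed
    then show ?thesis using sl' high by auto
  qed
qed

text \<open>
  If \<open>r\<close> lay strictly inside two cones, the apex further to the right would lie outside the other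
  cone, and one of its two edges would have to cross the boundary of that cone to pass
  \<open>r\<close> on the correct side.
\<close>

lemma wedge_inner_apex:
  assumes w: "wedge p q1 q2 r" and w': "wedge p' q1' q2' r"
    and i: "r \<noteq> q1" "r \<noteq> q2" "r \<noteq> q1'" "r \<noteq> q2'" and lt: "xc p < xc p'"
  shows False
proof -
  note W = w[unfolded wedge_def] and W' = w'[unfolded wedge_def]
  note E = wedge_ends[OF w] and E' = wedge_ends[OF w']
  have x: "xc p' < xc r" "xc p < xc r" using W W' by auto
  have "p' \<in> V" using edge_V W' by blast
  have s: "slope p q1 < slope p r" "slope p r < slope p q2"
    "slope p' q1' < slope p' r" "slope p' r < slope p' q2'"
    using E E' W W' i by fastforce+
  have h: "height p q1 (xc r) < yc r" "yc r < height p q2 (xc r)"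
     "height p' q1' (xc r) < yc r" "yc r < height p' q2' (xc r)"
    using s slope_le_height[OF x(1)] slope_le_height[OF x(2)] by (meson not_le)+
  have "\<not> (slope p q1 \<le> slope p p' \<and> slope p p' \<le> slope p q2)"
    using W lt \<open>p' \<in> V\<close> x by (meson not_le)
  then consider "yc p' < height p q1 (xc p')" | "yc p' > height p q2 (xc p')"
    using slope_le_height[OF lt] by (auto simp: not_le)
  then show False
  proof cases
    case 1
    then show False
      using edges_keep_order[of p' q2' p q1 "xc p'" "xc r"] W W' h x lt E E' by auto
  next
    case 2
    then show False
      using edges_keep_order[of p q2 p' q1' "xc p'" "xc r"] W W' h x lt E E' by auto
  qed
qed

lemma wedge_same_apex:
  assumes w: "wedge p q1 q2 r" and w': "wedge p q1' q2' r" and eq: "(r = q1) = (r = q1')"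
  shows "q1 = q1'"
proof -
  note W = w[unfolded wedge_def] and W' = w'[unfolded wedge_def]
  note E = wedge_ends[OF w] and E' = wedge_ends[OF w']
  have "slope p q1 = slope p q1'" if "r \<noteq> q1"
  proof -
    have s: "slope p q1 < slope p r" "slope p q1' < slope p r" using E E' W W' that eq by fastforce+
    show ?thesis
    proof (rule ccontr)
      assume "slope p q1 \<noteq> slope p q1'"
      then have "slope p q2 \<le> slope p q1' \<or> slope p q2' \<le> slope p q1"
        using W W' by (meson linorder_neqE_linordered_idom)
      then show False using s W W' by linarith
    qed
  qed
  then show ?thesis using slope_inj_edges[of p q1 q1'] W W' eq by blast
qed

text \<open>
  Each side of a vertex is charged at most once.
\<close>

lemma wedge_inj:
  assumes w: "wedge p q1 q2 r" and w': "wedge p' q1' q2' r" and eq: "(r = q1) = (r = q1')"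
  shows "(p, q1) = (p', q1')"
proof (cases "p = p'")
  case True
  then show ?thesis using wedge_same_apex w w' eq by blast
next
  case False
  note W = w[unfolded wedge_def] and W' = w'[unfolded wedge_def]
  have V: "p \<in> V" "p' \<in> V" using W W' edge_V by blast+
  show ?thesis
  proof (cases "(p, r) \<in> F")
    case True
    from wedge_other_edge[OF w' True False] have r': "r = q1' \<or> r = q2'" by auto
    then have "(p', r) \<in> F" using W' by auto
    from wedge_other_edge[OF w this] wedge_other_edge[OF w' True False] False eq W W' show ?thesis
      by auto
  next
    case np: False
    have np': "(p', r) \<notin> F" using wedge_other_edge[OF w] False np W by blast
    have i: "r \<noteq> q1" "r \<noteq> q2" "r \<noteq> q1'" "r \<noteq> q2'" using np np' W W' by auto
    have "xc p \<noteq> xc p'" using False V xinj unfolding inj_on_def by blast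
    then show ?thesis using wedge_inner_apex[OF w w'] wedge_inner_apex[OF w' w] i by fastforce
  qed
qed

lemma card_covered: "card covered \<le> 2 * card V"
proof -
  have "\<forall>e\<in>covered. \<exists>x. wedge (fst e) (snd e) (fst x) (snd x)"
    using ex_wedge by fastforce
  then obtain x where "\<forall>e\<in>covered. wedge (fst e) (snd e) (fst (x e)) (snd (x e))"
    by (rule bchoice[THEN exE])
  then obtain q2 r where w: "\<And>e. e \<in> covered \<Longrightarrow> wedge (fst e) (snd e) (q2 e) (r e)"
    using that[of "\<lambda>e. fst (x e)" "\<lambda>e. snd (x e)"] by blast
  define \<phi> where "\<phi> e = (r e, r e = snd e)" for e
  have "inj_on \<phi> covered"
  proof (rule inj_onI)
    fix e f assume ef: "e \<in> covered" "f \<in> covered" "\<phi> e = \<phi> f"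
    then have "r e = r f" "(r e = snd e) = (r f = snd f)" by (auto simp: \<phi>_def)
    then show "e = f" using wedge_inj[of "fst e" "snd e" "q2 e" "r e" "fst f" "snd f" "q2 f"]
      w[OF ef(1)] w[OF ef(2)] by (simp add: prod_eq_iff)
  qed
  moreover have "\<phi> ` covered \<subseteq> V \<times> (UNIV :: bool set)" using w by (auto simp: \<phi>_def wedge_def)
  ultimately have "card covered \<le> card (V \<times> (UNIV :: bool set))"
    using fin by (intro card_inj_on_le) auto
  then show ?thesis by (simp add: card_cartesian_product card_UNIV_bool)
qed

theorem card_edges: "card F \<le> 3 * card V"
proof -
  have "inj_on fst (F - covered)"
  proof (rule inj_onI)
    fix e f assume ef: "e \<in> F - covered" "f \<in> F - covered" "fst e = fst f"
    obtain p q q' where e: "e = (p, q)" "f = (p, q')" using ef(3) by (metis prod.collapse)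
    then have "slope p q = slope p q'" using ef unfolding covered_def by fastforce
    then show "e = f" using slope_inj_edges e ef by blast
  qed
  moreover have "fst ` (F - covered) \<subseteq> V" using F_sub by auto
  ultimately have "card (F - covered) \<le> card V" using fin by (rule card_inj_on_le)
  moreover have "card F \<le> card (F - covered) + card covered"
  proof -
    have "card ((F - covered) \<union> covered) \<le> card (F - covered) + card covered" by (rule card_Un_le)
    moreover have "(F - covered) \<union> covered = F" by (auto simp: covered_def)
    ultimately show ?thesis by simp
  qed
  ultimately show ?thesis using card_covered by linarith
qed

text \<open>
  In a triangle without further vertices, an edge from \<open>p\<close> into the triangle would have to end
  in it or leave it through the opposite side.
\<close>

lemma no_edge_into_triangle:
  assumes F: "(p, q) \<in> F" "(p, a) \<in> F" "(p, b) \<in> F" and qb: "(q, b) \<in> F \<or> (b, q) \<in> F"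
    and s: "slope p q < slope p a" "slope p a < slope p b"
    and empty: "V \<inter> convex hull {p, q, b} \<subseteq> {p, q, b}"
  shows False
proof -
  define X1 Y1 X2 Y2 X3 Y3 where
    d: "X1 = xc q - xc p" "Y1 = yc q - yc p" "X2 = xc a - xc p" "Y2 = yc a - yc p"
       "X3 = xc b - xc p" "Y3 = yc b - yc p"
  have pos: "X1 > 0" "X2 > 0" "X3 > 0" using F_right F by (auto simp: d)
  have s': "Y1 / X1 < Y2 / X2" "Y2 / X2 < Y3 / X3" "Y1 / X1 < Y3 / X3"
    using s by (auto simp: d slope_def)
  define D where "D = X1 * Y3 - Y1 * X3"
  have D: "D > 0" and n1: "X2 * Y3 - Y2 * X3 > 0" and n2: "X1 * Y2 - Y1 * X2 > 0"
    using s' pos by (auto simp: D_def field_simps)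
  \<comment> \<open>Cramer's rule for the coordinates of \<open>a - p\<close> with respect to \<open>q - p\<close> and \<open>b - p\<close>.\<close>
  define l m where "l = (X2 * Y3 - Y2 * X3) / D" and "m = (X1 * Y2 - Y1 * X2) / D"
  have lm: "l > 0" "m > 0" using D n1 n2 by (auto simp: l_def m_def)
  have "l * X1 + m * X3 = ((X2 * Y3 - Y2 * X3) * X1 + (X1 * Y2 - Y1 * X2) * X3) / D"
    by (simp add: l_def m_def add_divide_distrib)
  also have "\<dots> = X2 * D / D" by (simp add: D_def algebra_simps)
  finally have x: "l * X1 + m * X3 = X2" using D by simp
  have "l * Y1 + m * Y3 = ((X2 * Y3 - Y2 * X3) * Y1 + (X1 * Y2 - Y1 * X2) * Y3) / D"
    by (simp add: l_def m_def add_divide_distrib)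
  also have "\<dots> = Y2 * D / D" by (simp add: D_def algebra_simps)
  finally have y: "l * Y1 + m * Y3 = Y2" using D by simp
  have a: "a = p + l *\<^sub>R (q - p) + m *\<^sub>R (b - p)"
    using x y unfolding d
    by (intro coord_eq) (simp_all add: lin linear_add linear_scale linear_diff)
  have ne: "a \<noteq> p" "a \<noteq> q" "a \<noteq> b" "p \<noteq> q" "p \<noteq> b" "q \<noteq> b" using s F_right F by fastforce+
  show False
  proof (cases "l + m \<le> 1")
    case True
    have "a = (1 - l - m) *\<^sub>R p + l *\<^sub>R q + m *\<^sub>R b" using a by (simp add: algebra_simps)
    then have "a \<in> convex hull {p, q, b}"
      unfolding convex_hull_3 using lm True
      by (intro CollectI exI[of _ "1 - l - m"] exI[of _ l] exI[of _ m]) auto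
    then show False using empty ne edge_V F by blast
  next
    case False
    \<comment> \<open>The point where the edge \<open>p a\<close> meets the side \<open>q b\<close>.\<close>
    define z where "z = (1 - 1 / (l + m)) *\<^sub>R p + (1 / (l + m)) *\<^sub>R a"
    have "z \<in> open_segment p a" unfolding in_segment z_def using lm False ne
      by (auto intro!: exI[of _ "1 / (l + m)"])
    moreover have "z = (1 - m / (l + m)) *\<^sub>R q + (m / (l + m)) *\<^sub>R b"
    proof -
      define k where "k = 1 / (l + m)"
      have k: "k * l = 1 - k * m" "k * (l + m) = 1" using lm by (simp_all add: k_def field_simps)
      have "z = (1 - k) *\<^sub>R p + k *\<^sub>R (p + l *\<^sub>R (q - p) + m *\<^sub>R (b - p))"
        unfolding z_def k_def using a by simp
      also have "\<dots> = (1 - k * (l + m)) *\<^sub>R p + (k * l) *\<^sub>R q + (k * m) *\<^sub>R b"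
        by (simp add: algebra_simps)
      also have "\<dots> = (1 - k * m) *\<^sub>R q + (k * m) *\<^sub>R b" using k by simp
      finally show ?thesis by (simp add: k_def)
    qed
    then have "z \<in> open_segment q b" unfolding in_segment using lm ne
      by (auto intro!: exI[of _ "m / (l + m)"])
    ultimately show False
      using nocross[of p a q b] nocross[of p a b q] F qb ne by (auto simp: open_segment_commute)
  qed
qed

text \<open>
  The leftmost vertex of an empty triangle and its lower edge there determine the triangle, since the upper
  edge is then the next steeper one. That lower edge is covered.
\<close>

theorem card_empty_triangles:
  assumes T: "\<And>t. t \<in> T \<Longrightarrow> t \<subseteq> V \<and> card t = 3 \<and> V \<inter> convex hull t \<subseteq> t"
    and edges: "\<And>t x y. t \<in> T \<Longrightarrow> x \<in> t \<Longrightarrow> y \<in> t \<Longrightarrow> x \<noteq> y \<Longrightarrow> (x, y) \<in> F \<or> (y, x) \<in> F"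
  shows "card T \<le> 2 * card V"
proof -
  have "\<exists>p q b. t = {p, q, b} \<and> (p, q) \<in> F \<and> (p, b) \<in> F \<and> slope p q < slope p b
           \<and> ((q, b) \<in> F \<or> (b, q) \<in> F)" if t: "t \<in> T" for t
  proof -
    have "finite t" "t \<noteq> {}" using T[OF t] by (auto intro: card_ge_0_finite)
    define p where "p = arg_min_on xc t"
    have p: "p \<in> t" "\<forall>q\<in>t. xc p \<le> xc q"
      using arg_min_if_finite[of t xc] \<open>finite t\<close> \<open>t \<noteq> {}\<close> unfolding p_def by (auto simp: not_less)
    have "card (t - {p}) = 2" using p T[OF t] by simp
    then obtain q b where qb: "t - {p} = {q, b}" "q \<noteq> b" by (auto simp: card_2_iff)
    then have tt: "t = {p, q, b}" "p \<noteq> q" "p \<noteq> b" using p by auto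
    have F: "(p, q) \<in> F" "(p, b) \<in> F"
      using edges[OF t, of p q] edges[OF t, of p b] p F_right tt by fastforce+
    have F': "(q, b) \<in> F \<or> (b, q) \<in> F" using edges[OF t, of q b] tt qb by auto
    have "slope p q \<noteq> slope p b" using slope_inj_edges F qb by blast
    then consider "slope p q < slope p b" | "slope p b < slope p q" by linarith
    then show ?thesis
    proof cases
      case 1
      then show ?thesis using tt F F' by blast
    next
      case 2
      moreover have "t = {p, b, q}" using tt by auto
      ultimately show ?thesis using F F' by blast
    qed
  qed
  then have "\<forall>t\<in>T. \<exists>p q b. t = {p, q, b} \<and> (p, q) \<in> F \<and> (p, b) \<in> F \<and> slope p q < slope p b
           \<and> ((q, b) \<in> F \<or> (b, q) \<in> F)" by blast
  then obtain p q b where "\<forall>t\<in>T. t = {p t, q t, b t} \<and> (p t, q t) \<in> F \<and> (p t, b t) \<in> F \<and>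
     slope (p t) (q t) < slope (p t) (b t) \<and> ((q t, b t) \<in> F \<or> (b t, q t) \<in> F)"
    unfolding bchoice_iff by blast
  then have t: "\<And>t. t \<in> T \<Longrightarrow> t = {p t, q t, b t} \<and> (p t, q t) \<in> F \<and> (p t, b t) \<in> F \<and>
     slope (p t) (q t) < slope (p t) (b t) \<and> ((q t, b t) \<in> F \<or> (b t, q t) \<in> F)"
    by blast
  have "inj_on (\<lambda>t. (p t, q t)) T"
  proof (rule inj_onI)
    fix s t assume st: "s \<in> T" "t \<in> T" "(p s, q s) = (p t, q t)"
    have hs: "V \<inter> convex hull {p s, q s, b s} \<subseteq> {p s, q s, b s}"
      using T[OF st(1)] t[OF st(1), THEN conjunct1, symmetric] by simp
    have ht: "V \<inter> convex hull {p t, q t, b t} \<subseteq> {p t, q t, b t}"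
      using T[OF st(2)] t[OF st(2), THEN conjunct1, symmetric] by simp
    have ps: "p t = p s" "q t = q s" using st(3) by auto
    note es = t[OF st(1), THEN conjunct2] t[OF st(2), THEN conjunct2, unfolded ps]
    have "\<not> slope (p s) (b s) < slope (p s) (b t)" "\<not> slope (p s) (b t) < slope (p s) (b s)"
      using no_edge_into_triangle[of "p s" "q s" "b s" "b t"] no_edge_into_triangle[of "p s" "q s" "b t" "b s"]
        es hs ht[unfolded ps] by blast+
    then have "b s = b t" using slope_inj_edges[of "p s" "b s" "b t"] es by auto
    then show "s = t"
      using t[OF st(1), THEN conjunct1] t[OF st(2), THEN conjunct1] ps by simp
  qed
  moreover have "(\<lambda>t. (p t, q t)) ` T \<subseteq> covered" using t by (auto simp: covered_def)
  moreover have "finite covered" using finite_F by (auto simp: covered_def intro: finite_subset[OF _ finite_F])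
  ultimately have "card T \<le> card covered" by (intro card_inj_on_le)
  then show ?thesis using card_covered by simp
qed

end

text \<open>
  For a two-element set \<open>{a, b}\<close> this is the open segment from \<open>a\<close> to \<open>b\<close>.
\<close>

definition seg :: "'a::real_vector set \<Rightarrow> 'a set" where
  "seg e = (\<Union>a\<in>e. \<Union>b\<in>e. open_segment a b)"

lemma seg_pair [simp]: "seg {a, b} = open_segment a b"
  by (auto simp: seg_def open_segment_commute)

text \<open>
  Only finitely many slopes occur among the pairs of points, so some shear makes all abscissae distinct.
\<close>

lemma generic_shear:
  fixes X :: "(real^2) set"
  assumes "finite X"
  obtains \<epsilon> :: real where "inj_on (\<lambda>p. p $ 1 + \<epsilon> * p $ 2) X"
proof -
  \<comment> \<open>Contains every \<open>\<epsilon>\<close> that gives two distinct points the same abscissa.\<close>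
  define bad where "bad = (\<lambda>(p, q). - (p $ 1 - q $ 1) / (p $ 2 - q $ 2)) ` (X \<times> X)"
  have "finite bad" using assms by (simp add: bad_def)
  then obtain \<epsilon> where \<epsilon>: "\<epsilon> \<notin> bad" using ex_new_if_finite infinite_UNIV_char_0 by blast
  have "p = q" if pq: "p \<in> X" "q \<in> X" "p $ 1 + \<epsilon> * p $ 2 = q $ 1 + \<epsilon> * q $ 2" for p q
  proof (cases "p $ 2 = q $ 2")
    case True
    then show ?thesis using pq(3) by (simp add: vec_eq_iff forall_2)
  next
    case False
    have "\<epsilon> * (p $ 2 - q $ 2) = - (p $ 1 - q $ 1)" using pq(3) by (simp add: algebra_simps)
    then have "\<epsilon> = - (p $ 1 - q $ 1) / (p $ 2 - q $ 2)" using False by (simp add: field_simps)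
    then show ?thesis using \<epsilon> pq unfolding bad_def by (metis (mono_tags, lifting) SigmaI image_eqI case_prod_conv)
  qed
  then show thesis using that[of \<epsilon>] by (auto simp: inj_on_def)
qed

text \<open>
  These are the bounds that Euler's formula gives for plane graphs, for finite sets of unordered
  straight edges in the plane.
\<close>

lemma plane_graph_bounds:
  fixes X :: "(real^2) set" and E :: "(real^2) set set"
  assumes fin: "finite X"
    and E: "\<And>e. e \<in> E \<Longrightarrow> e \<subseteq> X \<and> card e = 2"
    and nocross: "\<And>e f. e \<in> E \<Longrightarrow> f \<in> E \<Longrightarrow> e \<noteq> f \<Longrightarrow> seg e \<inter> seg f = {}"
    and novert: "\<And>e. e \<in> E \<Longrightarrow> seg e \<inter> X = {}"
  shows plane_graph_edges: "card E \<le> 3 * card X"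
    and plane_graph_triangles: "\<And>T. (\<And>t. t \<in> T \<Longrightarrow> t \<subseteq> X \<and> card t = 3 \<and> X \<inter> convex hull t \<subseteq> t) \<Longrightarrow>
          (\<And>t x y. t \<in> T \<Longrightarrow> x \<in> t \<Longrightarrow> y \<in> t \<Longrightarrow> x \<noteq> y \<Longrightarrow> {x, y} \<in> E) \<Longrightarrow> card T \<le> 2 * card X"
proof -
  obtain \<epsilon> :: real where inj: "inj_on (\<lambda>p. p $ 1 + \<epsilon> * p $ 2) X" using generic_shear fin by blast
  define xc yc :: "real^2 \<Rightarrow> real" where "xc p = p $ 1 + \<epsilon> * p $ 2" and "yc p = p $ 2" for p
  define F where "F = {(p, q). {p, q} \<in> E \<and> xc p < xc q}"
  have lin: "linear xc" "linear yc"
    unfolding xc_def yc_def by (auto intro!: linearI simp: algebra_simps)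
  interpret plane_graph xc yc X F
  proof (rule plane_graph.intro)
    show "xc p = xc q \<Longrightarrow> yc p = yc q \<Longrightarrow> p = q" for p q
      by (auto simp: xc_def yc_def vec_eq_iff forall_2)
    show "inj_on xc X" using inj by (simp add: xc_def[abs_def])
    show "F \<subseteq> X \<times> X" using E by (auto simp: F_def)
    show "open_segment a b \<inter> open_segment c d = {}" if "(a, b) \<in> F" "(c, d) \<in> F" "(a, b) \<noteq> (c, d)" for a b c d
    proof -
      have "{a, b} \<noteq> {c, d}" using that by (auto simp: F_def doubleton_eq_iff)
      then show ?thesis using nocross[of "{a, b}" "{c, d}"] that by (auto simp: F_def)
    qed
    show "open_segment a b \<inter> X = {}" if "(a, b) \<in> F" for a b
      using novert[of "{a, b}"] that by (auto simp: F_def)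
    show "xc p < xc q" if "(p, q) \<in> F" for p q using that by (simp add: F_def)
  qed (fact lin fin)+
  have pick: "(x, y) \<in> F \<or> (y, x) \<in> F" if "{x, y} \<in> E" "x \<noteq> y" for x y
  proof -
    have "xc x \<noteq> xc y" using that E[OF that(1)] xinj by (auto simp: inj_on_def)
    then show ?thesis using that by (auto simp: F_def insert_commute)
  qed
  have "E \<subseteq> (\<lambda>(p, q). {p, q}) ` F"
  proof
    fix e assume e: "e \<in> E"
    then obtain x y where xy: "e = {x, y}" "x \<noteq> y" using E[OF e] by (auto simp: card_2_iff)
    then have "(x, y) \<in> F \<or> (y, x) \<in> F" using pick e by blast
    then show "e \<in> (\<lambda>(p, q). {p, q}) ` F"
      using image_eqI[of e "\<lambda>(p, q). {p, q}" "(x, y)" F] image_eqI[of e "\<lambda>(p, q). {p, q}" "(y, x)" F] xy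
      by (metis (mono_tags) case_prod_conv insert_commute)
  qed
  then have "card E \<le> card ((\<lambda>(p, q). {p, q}) ` F)" using finite_F by (intro card_mono) auto
  also have "\<dots> \<le> card F" using finite_F by (rule card_image_le)
  finally show "card E \<le> 3 * card X" using card_edges by simp
  fix T
  assume T: "\<And>t. t \<in> T \<Longrightarrow> t \<subseteq> X \<and> card t = 3 \<and> X \<inter> convex hull t \<subseteq> t"
    and sides: "\<And>t x y. t \<in> T \<Longrightarrow> x \<in> t \<Longrightarrow> y \<in> t \<Longrightarrow> x \<noteq> y \<Longrightarrow> {x, y} \<in> E"
  show "card T \<le> 2 * card X"
    by (rule card_empty_triangles, erule T, rule pick, rule sides)
qed

section \<open>Quadrilaterals with long sides and short diagonals\<close>

lemma sqrt2_bounds: "(14142/10000) < sqrt 2" "sqrt 2 < (14143/10000)" "sqrt 2 * sqrt 2 = (2::real)"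
proof -
  show "(14142/10000) < sqrt 2" by (rule real_less_rsqrt) (simp add: power2_eq_square)
  show "sqrt 2 < (14143/10000)" by (rule real_less_lsqrt) (simp_all add: power2_eq_square)
qed simp

text \<open>
  Stewart's theorem for the cevian from \<open>a\<close> to the point \<open>z\<close> of the side \<open>b d\<close>.
\<close>

lemma stewart:
  fixes a b d :: "'a::real_inner"
  assumes "z = (1 - u) *\<^sub>R b + u *\<^sub>R d"
  shows "(dist a z)\<^sup>2 = (1 - u) * (dist a b)\<^sup>2 + u * (dist a d)\<^sup>2 - u * (1 - u) * (dist b d)\<^sup>2"
proof -
  define B D where "B = a - b" and "D = a - d"
  have "a - z = (1 - u) *\<^sub>R B + u *\<^sub>R D" "b - d = D - B"
    unfolding assms B_def D_def by (simp_all add: algebra_simps)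
  then show ?thesis
    unfolding dist_norm B_def[symmetric] D_def[symmetric] power2_norm_eq_inner
    by (simp add: inner_add inner_diff inner_commute[of D B]) (simp add: algebra_simps)
qed

text \<open>
  The product of the two parts of the diagonal \<open>b d\<close> is at most a quarter of its square, roughly \<open>1/2\<close>.
  Stewart's theorem then makes the part from \<open>a\<close> to the crossing point of the other diagonal
  at least roughly \<open>\<surd>(1 - 1/2)\<close>.
\<close>

lemma half_diagonal:
  fixes a b c d :: "'a::real_inner"
  assumes z: "z = (1 - u) *\<^sub>R b + u *\<^sub>R d" "z = (1 - v) *\<^sub>R a + v *\<^sub>R c"
    and u: "0 < u" "u < 1" and v: "0 < v" "v < 1" and h: "0 < h" "h \<le> 1/1000"
    and s: "1 - h \<le> dist a b" "1 - h \<le> dist a d" and D: "dist b d \<le> sqrt 2 + h"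
  shows "v * dist a c \<ge> sqrt 2 / 2 - 2 * h" and "u * (1 - u) * (dist b d)\<^sup>2 \<le> 1/2 + (71/100) * h"
proof -
  note r = sqrt2_bounds
  have hh: "0 \<le> h * h" "h * h \<le> h / 1000" using h by (auto simp: mult_left_mono)
  have "u * (1 - u) = 1/4 - (u - 1/2)\<^sup>2" by (simp add: power2_eq_square algebra_simps)
  then have "u * (1 - u) \<le> 1/4" by simp
  then have "u * (1 - u) * (dist b d)\<^sup>2 \<le> 1/4 * (sqrt 2 + h)\<^sup>2"
    using u D by (intro mult_mono power_mono) auto
  also have "\<dots> = 1/2 + sqrt 2 * h / 2 + h * h / 4" using r(3) by (simp add: power2_eq_square algebra_simps)
  also have "\<dots> \<le> 1/2 + (71/100) * h" using mult_right_mono[of "sqrt 2" "(14143/10000)" h] r h hh by linarith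
  finally show q: "u * (1 - u) * (dist b d)\<^sup>2 \<le> 1/2 + (71/100) * h" .
  have "dist a z = v * dist a c"
  proof -
    have "a - z = v *\<^sub>R (a - c)" using z(2) by (simp add: algebra_simps)
    then show ?thesis using v by (simp add: dist_norm)
  qed
  then have "(v * dist a c)\<^sup>2 = (1 - u) * (dist a b)\<^sup>2 + u * (dist a d)\<^sup>2 - u * (1 - u) * (dist b d)\<^sup>2"
    using stewart[OF z(1), of a] by simp
  moreover have "(1 - h)\<^sup>2 \<le> (dist a b)\<^sup>2" "(1 - h)\<^sup>2 \<le> (dist a d)\<^sup>2" using s h by (auto intro!: power_mono)
  then have "(1 - u) * (1 - h)\<^sup>2 \<le> (1 - u) * (dist a b)\<^sup>2" "u * (1 - h)\<^sup>2 \<le> u * (dist a d)\<^sup>2"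
    using u by (auto intro!: mult_left_mono)
  ultimately have "(v * dist a c)\<^sup>2 \<ge> (1 - u) * (1 - h)\<^sup>2 + u * (1 - h)\<^sup>2 - (1/2 + (71/100) * h)" using q by linarith
  then have "(v * dist a c)\<^sup>2 \<ge> (1 - h)\<^sup>2 - (1/2 + (71/100) * h)" by (simp add: algebra_simps)
  moreover have "(1 - h)\<^sup>2 = 1 - 2 * h + h * h" by (simp add: power2_eq_square algebra_simps)
  ultimately have "(v * dist a c)\<^sup>2 \<ge> 1/2 - (271/100) * h" using hh by linarith
  moreover have "(sqrt 2 / 2 - 2 * h)\<^sup>2 \<le> 1/2 - (271/100) * h"
  proof -
    have "(sqrt 2 / 2 - 2 * h)\<^sup>2 = 1/2 - 2 * (sqrt 2 * h) + 4 * (h * h)"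
      using r(3) by (simp add: power2_eq_square algebra_simps)
    then show ?thesis using mult_right_mono[of "(14142/10000)" "sqrt 2" h] r h hh by linarith
  qed
  ultimately have "(sqrt 2 / 2 - 2 * h)\<^sup>2 \<le> (v * dist a c)\<^sup>2" by linarith
  then show "v * dist a c \<ge> sqrt 2 / 2 - 2 * h" by (rule power2_le_imp_le) (use v in simp)
qed

text \<open>
  By the preceding estimate all four half diagonals are close to \<open>\<surd>2/2\<close>: they are not much shorter, and their
  sums are not much larger than \<open>\<surd>2\<close>. Stewart's theorem, with the side \<open>a b\<close> bounded from below,
  now bounds the side \<open>a d\<close> from above.
\<close>

lemma crossing_side:
  fixes a b c d :: "'a::real_inner"
  assumes cross: "open_segment a c \<inter> open_segment b d \<noteq> {}" and h: "0 < h" "h \<le> 1/1000"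
    and s: "1 - h \<le> dist a b" "1 - h \<le> dist b c" "1 - h \<le> dist c d" "1 - h \<le> dist d a"
    and D: "dist a c \<le> sqrt 2 + h" "dist b d \<le> sqrt 2 + h"
  shows "dist d a \<le> 1 + 10 * h" and "sqrt 2 - 4 * h \<le> dist a c"
proof -
  note r = sqrt2_bounds
  have hh: "0 \<le> h * h" "h * h \<le> h / 1000" using h by (auto simp: mult_left_mono)
  obtain z where z: "z \<in> open_segment a c" "z \<in> open_segment b d" using cross by blast
  obtain v where v: "0 < v" "v < 1" "z = (1 - v) *\<^sub>R a + v *\<^sub>R c" using z(1) by (auto simp: in_segment)
  obtain u where u: "0 < u" "u < 1" "z = (1 - u) *\<^sub>R b + u *\<^sub>R d" using z(2) by (auto simp: in_segment)
  have z': "z = (1 - (1 - v)) *\<^sub>R c + (1 - v) *\<^sub>R a" "z = (1 - (1 - u)) *\<^sub>R d + (1 - u) *\<^sub>R b"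
    using u v by (auto simp: add.commute)
  have h1: "sqrt 2 / 2 - 2 * h \<le> v * dist a c" "u * (1 - u) * (dist b d)\<^sup>2 \<le> 1/2 + (71/100) * h"
    using half_diagonal[OF u(3) v(3) u(1,2) v(1,2) h] s D by (auto simp: dist_commute)
  have h2: "sqrt 2 / 2 - 2 * h \<le> (1 - v) * dist a c"
    using half_diagonal[OF u(3) z'(1) u(1,2) _ _ h] s D v by (auto simp: dist_commute)
  have h3: "sqrt 2 / 2 - 2 * h \<le> u * dist b d"
    using half_diagonal[OF v(3) u(3) v(1,2) u(1,2) h] s D by (auto simp: dist_commute)
  show "sqrt 2 - 4 * h \<le> dist a c" using h1 h2 by (simp add: algebra_simps)
  have "v * dist a c \<le> sqrt 2 / 2 + 3 * h" using h2 D by (simp add: algebra_simps)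
  then have "(v * dist a c)\<^sup>2 \<le> (sqrt 2 / 2 + 3 * h)\<^sup>2" using v by (intro power_mono) auto
  also have "\<dots> = 1/2 + 3 * (sqrt 2 * h) + 9 * (h * h)" using r(3) by (simp add: power2_eq_square algebra_simps)
  also have "\<dots> \<le> 1/2 + (426/100) * h" using mult_right_mono[of "sqrt 2" "(14143/10000)" h] r h hh by linarith
  finally have vP: "(v * dist a c)\<^sup>2 \<le> 1/2 + (426/100) * h" .
  have "dist a z = v * dist a c"
  proof -
    have "a - z = v *\<^sub>R (a - c)" using v(3) by (simp add: algebra_simps)
    then show ?thesis using v by (simp add: dist_norm)
  qed
  then have st: "(v * dist a c)\<^sup>2 = (1 - u) * (dist a b)\<^sup>2 + u * (dist a d)\<^sup>2 - u * (1 - u) * (dist b d)\<^sup>2"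
    using stewart[OF u(3), of a] by simp
  have "(1 - h)\<^sup>2 \<le> (dist a b)\<^sup>2" using s h by (auto intro!: power_mono)
  then have "(1 - u) * (1 - h)\<^sup>2 \<le> (1 - u) * (dist a b)\<^sup>2" using u by (auto intro!: mult_left_mono)
  then have "u * (dist a d)\<^sup>2 \<le> u * (1 - h)\<^sup>2 + (1 + (497/100) * h - (1 - h)\<^sup>2)"
    using st vP h1 by (simp add: left_diff_distrib)
  also have "\<dots> \<le> u * (1 - h)\<^sup>2 + (697/100) * h" using hh by (simp add: power2_eq_square algebra_simps)
  finally have 1: "u * (dist a d)\<^sup>2 \<le> u * (1 - h)\<^sup>2 + (697/100) * h" .
  have "u * dist b d \<le> u * (14153/10000)" using u D r h by (intro mult_left_mono) auto
  then have "u \<ge> (498/1000)" using h3 r h by simp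
  then have "(697/100) * h \<le> u * (14 * h)" using mult_right_mono[of "(498/1000)" u "14 * h"] h by simp
  then have "u * (dist a d)\<^sup>2 \<le> u * ((1 - h)\<^sup>2 + 14 * h)" using 1 by (simp add: distrib_left)
  then have "(dist a d)\<^sup>2 \<le> (1 - h)\<^sup>2 + 14 * h" using u by simp
  also have "\<dots> \<le> (1 + 10 * h)\<^sup>2" using h by (simp add: power2_eq_square algebra_simps)
  finally show "dist d a \<le> 1 + 10 * h" by (auto simp: dist_commute intro!: power2_le_imp_le[of "dist d a"] add_nonneg_nonneg) (use h in simp)
qed

lemma crossing_square:
  fixes a b c d :: "'a::real_inner"
  assumes cross: "open_segment a c \<inter> open_segment b d \<noteq> {}" and h: "0 < h" "h \<le> 1/1000"
    and s: "1 - h \<le> dist a b" "1 - h \<le> dist b c" "1 - h \<le> dist c d" "1 - h \<le> dist d a"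
    and D: "dist a c \<le> sqrt 2 + h" "dist b d \<le> sqrt 2 + h"
  shows "dist a b \<le> 1 + 10 * h" "dist b c \<le> 1 + 10 * h" "dist c d \<le> 1 + 10 * h" "dist d a \<le> 1 + 10 * h"
    "sqrt 2 - 4 * h \<le> dist a c" "sqrt 2 - 4 * h \<le> dist b d"
  using crossing_side[of a c b d h] crossing_side[of b d c a h] crossing_side[of c a d b h]
    crossing_side[of d b a c h] assms
  by (auto simp: open_segment_commute dist_commute Int_commute)

text \<open>
  With barycentric weights \<open>u, v, w\<close>, the weighted mean of the squared distances from \<open>d\<close> to the vertices is
  \<open>u v |a b|\<^sup>2 + v w |b c|\<^sup>2 + u w |a c|\<^sup>2 \<le> \<rho>\<^sup>2 / 3\<close>.
\<close>

lemma point_in_triangle: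
  fixes a b c d :: "'a::real_inner"
  assumes "d \<in> convex hull {a, b, c}" and D: "dist a b \<le> \<rho>" "dist b c \<le> \<rho>" "dist a c \<le> \<rho>"
  obtains v where "v \<in> {a, b, c}" "3 * (dist v d)\<^sup>2 \<le> \<rho>\<^sup>2"
proof -
  obtain u v w where uvw: "0 \<le> u" "0 \<le> v" "0 \<le> w" "u + v + w = 1" "d = u *\<^sub>R a + v *\<^sub>R b + w *\<^sub>R c"
    using assms(1) unfolding convex_hull_3 by auto
  define A B C where "A = a - d" "B = b - d" "C = c - d"
  have u: "u = 1 - v - w" using uvw by simp
  have ABC: "dist a d = norm A" "dist b d = norm B" "dist c d = norm C" "dist a b = norm (A - B)"
    "dist b c = norm (B - C)" "dist a c = norm (A - C)"
    by (simp_all add: A_B_C_def dist_norm)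
  have "u *\<^sub>R A + v *\<^sub>R B + w *\<^sub>R C = (u *\<^sub>R a + v *\<^sub>R b + w *\<^sub>R c) - (u + v + w) *\<^sub>R d"
    unfolding A_B_C_def by (simp add: algebra_simps)
  then have "u *\<^sub>R A + v *\<^sub>R B + w *\<^sub>R C = 0" using uvw(4) uvw(5)[symmetric] by simp
  then have "0 = (u *\<^sub>R A + v *\<^sub>R B + w *\<^sub>R C) \<bullet> (u *\<^sub>R A + v *\<^sub>R B + w *\<^sub>R C)" by simp
  also have "\<dots> = u * (norm A)\<^sup>2 + v * (norm B)\<^sup>2 + w * (norm C)\<^sup>2 -
      (u * v * (norm (A - B))\<^sup>2 + v * w * (norm (B - C))\<^sup>2 + u * w * (norm (A - C))\<^sup>2)"
    unfolding power2_norm_eq_inner u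
    by (simp add: inner_add inner_diff inner_commute[of B A] inner_commute[of C A] inner_commute[of C B])
       (simp add: algebra_simps)
  finally have eq: "u * (norm A)\<^sup>2 + v * (norm B)\<^sup>2 + w * (norm C)\<^sup>2 =
      u * v * (norm (A - B))\<^sup>2 + v * w * (norm (B - C))\<^sup>2 + u * w * (norm (A - C))\<^sup>2" by simp
  also have "\<dots> \<le> u * v * \<rho>\<^sup>2 + v * w * \<rho>\<^sup>2 + u * w * \<rho>\<^sup>2"
    using D uvw unfolding ABC by (intro add_mono mult_left_mono power_mono) auto
  also have "\<dots> = (u * v + v * w + u * w) * \<rho>\<^sup>2" by (simp add: algebra_simps)
  also have "\<dots> \<le> 1/3 * \<rho>\<^sup>2"
  proof (rule mult_right_mono)
    have "6 * (u * v + v * w + u * w) = 2 * (u + v + w)\<^sup>2 - ((u - v)\<^sup>2 + (v - w)\<^sup>2 + (u - w)\<^sup>2)"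
      by (simp add: power2_eq_square algebra_simps)
    also have "\<dots> \<le> 2 * (u + v + w)\<^sup>2"
      using zero_le_power2[of "u - v"] zero_le_power2[of "v - w"] zero_le_power2[of "u - w"] by linarith
    also have "\<dots> = 2" using uvw(4) by simp
    finally show "u * v + v * w + u * w \<le> 1/3" by simp
  qed simp
  finally have le: "u * (norm A)\<^sup>2 + v * (norm B)\<^sup>2 + w * (norm C)\<^sup>2 \<le> \<rho>\<^sup>2 / 3" by simp
  have "\<exists>v\<in>{a, b, c}. 3 * (dist v d)\<^sup>2 \<le> \<rho>\<^sup>2"
  proof (rule ccontr)
    assume "\<not> ?thesis"
    then have "\<rho>\<^sup>2 / 3 < (norm A)\<^sup>2" "\<rho>\<^sup>2 / 3 < (norm B)\<^sup>2" "\<rho>\<^sup>2 / 3 < (norm C)\<^sup>2" by (auto simp: ABC not_le)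
    then have "u * (\<rho>\<^sup>2 / 3) + v * (\<rho>\<^sup>2 / 3) + w * (\<rho>\<^sup>2 / 3) < u * (norm A)\<^sup>2 + v * (norm B)\<^sup>2 + w * (norm C)\<^sup>2"
      using uvw by (smt (verit) mult_left_mono mult_strict_left_mono)
    moreover have "u * (\<rho>\<^sup>2 / 3) + v * (\<rho>\<^sup>2 / 3) + w * (\<rho>\<^sup>2 / 3) = \<rho>\<^sup>2 / 3"
      using uvw(4) by (metis distrib_right mult_1)
    ultimately show False using le by linarith
  qed
  then show thesis using that by blast
qed

lemma no_point_in_triangle:
  fixes a b c d :: "'a::real_inner"
  assumes h: "d \<in> convex hull {a, b, c}" and D: "dist a b \<le> (142/100)" "dist b c \<le> (142/100)" "dist a c \<le> (142/100)"
    and s: "dist a d \<ge> (9/10)" "dist b d \<ge> (9/10)" "dist c d \<ge> (9/10)"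
  shows False
proof -
  obtain v where v: "v \<in> {a, b, c}" "3 * (dist v d)\<^sup>2 \<le> (142/100)\<^sup>2" using point_in_triangle[OF h D] .
  have "dist v d \<ge> (9/10)" using v s by auto
  then have "(9/10)\<^sup>2 \<le> (dist v d)\<^sup>2" by (intro power_mono) auto
  then show False using v(2) by (simp add: power2_eq_square)
qed

text \<open>
  Radon's theorem leaves two cases. A point cannot lie in the triangle of the other three,
  hence two segments cross, and they are the diagonals of an almost perfect square.
\<close>

lemma four_points_square:
  fixes Q :: "(real^2) set"
  assumes Q: "card Q = 4" and h: "0 < h" "h \<le> 1/1000"
    and d: "\<And>x y. x \<in> Q \<Longrightarrow> y \<in> Q \<Longrightarrow> x \<noteq> y \<Longrightarrow> 1 - h \<le> dist x y \<and> dist x y \<le> sqrt 2 + h"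
    and xy: "x \<in> Q" "y \<in> Q" "x \<noteq> y"
  shows "dist x y \<le> 1 + 10 * h \<or> sqrt 2 - 4 * h \<le> dist x y"
proof -
  have fin: "finite Q" using Q by (intro card_ge_0_finite) simp
  have nohull: False if a: "a \<in> Q" "a \<in> convex hull (Q - {a})" for a
  proof -
    have "card (Q - {a}) = 3" using Q a by simp
    then obtain b c e where bce: "Q - {a} = {b, c, e}" "b \<noteq> c" "c \<noteq> e" "b \<noteq> e" unfolding card_3_iff by auto
    then have m: "b \<in> Q" "c \<in> Q" "e \<in> Q" "b \<noteq> a" "c \<noteq> a" "e \<noteq> a" by auto
    show False
    proof (rule no_point_in_triangle)
      show "a \<in> convex hull {b, c, e}" using a bce by simp
      show "dist b c \<le> (142/100)" "dist c e \<le> (142/100)" "dist b e \<le> (142/100)"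
        using d[OF m(1,2)] d[OF m(2,3)] d[OF m(1,3)] bce(2-4) h sqrt2_bounds by auto
      show "dist b a \<ge> (9/10)" "dist c a \<ge> (9/10)" "dist e a \<ge> (9/10)" using d[OF m(1) a(1)] d[OF m(2) a(1)] d[OF m(3) a(1)] m(4-6) h by auto
    qed
  qed
  have "affine_dependent Q"
    by (rule affine_dependent_biggerset) (use Q fin in auto)
  then obtain m p where mp: "m \<subseteq> Q" "p \<subseteq> Q" "m \<inter> p = {}" "convex hull m \<inter> convex hull p \<noteq> {}"
    using Radon by blast
  have fin': "finite m" "finite p" using mp fin finite_subset by blast+
  have cards: "card m + card p \<le> 4"
    using mp fin Q card_mono[of Q "m \<union> p"] card_Un_disjoint[OF fin' mp(3)] by auto
  have ne: "card m > 0" "card p > 0" using mp fin' by (auto simp: card_gt_0_iff)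
  have not1: "card m \<noteq> 1" if "m \<subseteq> Q" "p \<subseteq> Q" "m \<inter> p = {}" "convex hull m \<inter> convex hull p \<noteq> {}" for m p
  proof
    assume "card m = 1"
    then obtain a where a: "m = {a}" by (auto simp: card_1_singleton_iff)
    then have "a \<in> convex hull p" "p \<subseteq> Q - {a}" using that by auto
    then show False using nohull[of a] hull_mono[of p "Q - {a}" convex] that a by auto
  qed
  have "card m \<noteq> 1" "card p \<noteq> 1" using not1[of m p] not1[of p m] mp by (auto simp: Int_commute)
  then have c2: "card m = 2" "card p = 2" using ne cards by auto
  then obtain a c b e where ac: "m = {a, c}" "a \<noteq> c" and be: "p = {b, e}" "b \<noteq> e"
    by (auto simp: card_2_iff)
  have disj: "a \<noteq> b" "a \<noteq> e" "c \<noteq> b" "c \<noteq> e" using mp ac be by auto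
  have inQ: "a \<in> Q" "b \<in> Q" "c \<in> Q" "e \<in> Q" using mp ac be by auto
  have Qeq: "Q = {a, b, c, e}"
    using ac be disj Q fin inQ by (intro card_seteq[symmetric]) auto
  obtain z where z: "z \<in> convex hull {a, c}" "z \<in> convex hull {b, e}" using mp ac be by auto
  have "z \<noteq> a" "z \<noteq> c"
    using z(2) nohull[of a] nohull[of c] hull_mono[of "{b, e}" "Q - {a}" convex]
       hull_mono[of "{b, e}" "Q - {c}" convex] disj inQ by auto
  moreover have "z \<noteq> b" "z \<noteq> e"
    using z(1) nohull[of b] nohull[of e] hull_mono[of "{a, c}" "Q - {b}" convex]
       hull_mono[of "{a, c}" "Q - {e}" convex] disj inQ by auto
  ultimately have "open_segment a c \<inter> open_segment b e \<noteq> {}"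
    using z by (auto simp: open_segment_def segment_convex_hull)
  from crossing_square[OF this h] d inQ disj ac be xy show ?thesis
    unfolding Qeq by (auto simp: dist_commute)
qed

text \<open>
  The signed area of the parallelogram spanned by \<open>u\<close> and \<open>v\<close>; its sign tells to which side of \<open>u\<close>
  the vector \<open>v\<close> points.
\<close>

definition cross2 :: "real^2 \<Rightarrow> real^2 \<Rightarrow> real" where
  "cross2 u v = u $ 1 * v $ 2 - u $ 2 * v $ 1"

lemma inner_cross2: "(u \<bullet> v)\<^sup>2 + (cross2 u v)\<^sup>2 = (u \<bullet> u) * (v \<bullet> v)"
  by (simp add: cross2_def inner_vec_def sum_2 power2_eq_square algebra_simps)

text \<open>
  The law of cosines.
\<close>

lemma inner_dists:
  "(y - x) \<bullet> (z - x) = ((dist x z)\<^sup>2 + (dist x y)\<^sup>2 - (dist y z)\<^sup>2) / 2" for x y z :: "'a::real_inner"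
  by (simp add: dist_norm power2_norm_eq_inner inner_diff inner_commute algebra_simps)

lemma abs_bounds:
  fixes b :: real
  assumes "7/10 \<le> b\<^sup>2" "b\<^sup>2 \<le> 13/10"
  shows "83/100 \<le> \<bar>b\<bar>" "\<bar>b\<bar> \<le> 115/100"
proof -
  have "(83/100)\<^sup>2 \<le> \<bar>b\<bar>\<^sup>2" using assms by (simp add: power2_eq_square)
  then show "83/100 \<le> \<bar>b\<bar>" by (rule power2_le_imp_le) simp
  have "\<bar>b\<bar>\<^sup>2 \<le> (115/100)\<^sup>2" using assms by (simp add: power2_eq_square)
  then show "\<bar>b\<bar> \<le> 115/100" by (rule power2_le_imp_le) simp
qed

text \<open>
  The inner product and the signed area locate \<open>z\<close> relative to the segment \<open>x y\<close>. If they nearly agree for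
  \<open>z\<close> and \<open>z'\<close>, the two points are close.
\<close>

lemma same_side_close:
  fixes x y z z' :: "real^2"
  assumes side: "cross2 (y - x) (z - x) * cross2 (y - x) (z' - x) > 0"
    and L: "(9/10) \<le> (dist x y)\<^sup>2"
    and A: "\<bar>(y - x) \<bullet> (z - x) - (y - x) \<bullet> (z' - x)\<bar> \<le> (1/10)"
    and B: "(7/10) \<le> (cross2 (y - x) (z - x))\<^sup>2" "(cross2 (y - x) (z - x))\<^sup>2 \<le> (13/10)"
    and B': "(7/10) \<le> (cross2 (y - x) (z' - x))\<^sup>2" "(cross2 (y - x) (z' - x))\<^sup>2 \<le> (13/10)"
  shows "dist z z' < 1/2"
proof -
  define u p p' b b' where d: "u = y - x" "p = z - x" "p' = z' - x" "b = cross2 u p" "b' = cross2 u p'"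
  have rng: "(83/100) \<le> \<bar>b\<bar>" "\<bar>b\<bar> \<le> (115/100)" "(83/100) \<le> \<bar>b'\<bar>" "\<bar>b'\<bar> \<le> (115/100)"
    using abs_bounds[of b] abs_bounds[of b'] B B' unfolding d by auto
  have "\<bar>b - b'\<bar> \<le> (32/100)" using rng side unfolding d(4,5)[symmetric] d(1,2,3)[symmetric]
    by (auto simp: zero_less_mult_iff abs_if split: if_splits)
  then have b2: "(b - b')\<^sup>2 \<le> (32/100)\<^sup>2" by (simp add: abs_le_square_iff[symmetric])
  have a2: "(u \<bullet> p - u \<bullet> p')\<^sup>2 \<le> (1/10)\<^sup>2" using A unfolding d(1,2,3)[symmetric] by (simp add: abs_le_square_iff[symmetric])
  have "(u \<bullet> (p - p'))\<^sup>2 + (cross2 u (p - p'))\<^sup>2 = (u \<bullet> u) * ((p - p') \<bullet> (p - p'))" by (rule inner_cross2)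
  moreover have "cross2 u (p - p') = b - b'" by (simp add: d cross2_def algebra_simps)
  moreover have "u \<bullet> u = (dist x y)\<^sup>2" by (simp add: d dist_norm power2_norm_eq_inner norm_minus_commute[of x y])
  moreover have "(p - p') \<bullet> (p - p') = (dist z z')\<^sup>2" by (simp add: d dist_norm power2_norm_eq_inner)
  ultimately have "(dist x y)\<^sup>2 * (dist z z')\<^sup>2 \<le> (32/100)\<^sup>2 + (1/10)\<^sup>2" using a2 b2 by (simp add: inner_diff_right)
  moreover have "(9/10) * (dist z z')\<^sup>2 \<le> (dist x y)\<^sup>2 * (dist z z')\<^sup>2" using L by (intro mult_right_mono) auto
  ultimately have "(dist z z')\<^sup>2 < (1/2)\<^sup>2" by (simp add: power2_eq_square)
  then show ?thesis by (rule power2_less_imp_less) simp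
qed

text \<open>
  In an exact right isosceles triangle with legs \<open>1\<close>, seen from an end \<open>x\<close> of the hypotenuse, the inner product
  is \<open>1\<close> and the signed area \<open>\<plusminus>1\<close>. The two cases are
  those of the hypotenuse \<open>x z\<close> and the hypotenuse \<open>x y\<close>.
\<close>

lemma right_isosceles:
  fixes x y z :: "real^2"
  assumes s: "999/1000 \<le> dist y z" "dist y z \<le> 101/100"
    and d: "(999/1000 \<le> dist x y \<and> dist x y \<le> 101/100 \<and> 141/100 \<le> dist x z \<and> dist x z \<le> 14153/10000) \<or>
      (999/1000 \<le> dist x z \<and> dist x z \<le> 101/100 \<and> 141/100 \<le> dist x y \<and> dist x y \<le> 14153/10000)"
  shows "\<bar>(y - x) \<bullet> (z - x) - 1\<bar> \<le> 1/20" "7/10 \<le> (cross2 (y - x) (z - x))\<^sup>2"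
    "(cross2 (y - x) (z - x))\<^sup>2 \<le> 13/10" "9/10 \<le> (dist x y)\<^sup>2"
proof -
  define P Q R where PQR: "P = (dist x y)\<^sup>2" "Q = (dist x z)\<^sup>2" "R = (dist y z)\<^sup>2"
  define A where "A = (y - x) \<bullet> (z - x)"
  have side: "998/1000 \<le> t\<^sup>2 \<and> t\<^sup>2 \<le> 10201/10000" if "999/1000 \<le> t" "t \<le> 101/100" for t :: real
    using power_mono[OF that(1), of 2] power_mono[OF that(2), of 2] that by (simp add: power2_eq_square)
  have diag: "1988/1000 \<le> t\<^sup>2 \<and> t\<^sup>2 \<le> 20031/10000" if "141/100 \<le> t" "t \<le> 14153/10000" for t :: real
    using power_mono[OF that(1), of 2] power_mono[OF that(2), of 2] that by (simp add: power2_eq_square)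
  have R: "998/1000 \<le> R \<and> R \<le> 10201/10000" using side s PQR by simp
  have PQ: "(998/1000 \<le> P \<and> P \<le> 10201/10000 \<and> 1988/1000 \<le> Q \<and> Q \<le> 20031/10000) \<or>
      (998/1000 \<le> Q \<and> Q \<le> 10201/10000 \<and> 1988/1000 \<le> P \<and> P \<le> 20031/10000)"
    using d side diag unfolding PQR by blast
  have A: "A = (Q + P - R) / 2" unfolding A_def PQR by (rule inner_dists)
  then have Ab: "98/100 \<le> A" "A \<le> 102/100" using PQ R by auto
  then show "\<bar>(y - x) \<bullet> (z - x) - 1\<bar> \<le> 1/20" unfolding A_def[symmetric] abs_le_iff by linarith
  have "(98/100)\<^sup>2 \<le> A\<^sup>2" "A\<^sup>2 \<le> (102/100)\<^sup>2" using Ab by (auto intro!: power_mono)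
  then have A2: "96/100 \<le> A\<^sup>2" "A\<^sup>2 \<le> 1041/1000" by (auto simp: power2_eq_square)
  have "A\<^sup>2 + (cross2 (y - x) (z - x))\<^sup>2 = P * Q"
    using inner_cross2[of "y - x" "z - x"] unfolding A_def PQR
    by (simp add: dist_norm power2_norm_eq_inner norm_minus_commute[of x])
  moreover have "998/1000 * (1988/1000) \<le> P * Q" "P * Q \<le> 10201/10000 * (20031/10000)"
    using PQ mult_mono[of "998/1000" P "1988/1000" Q] mult_mono[of "998/1000" Q "1988/1000" P]
      mult_mono[of P "10201/10000" Q "20031/10000"] mult_mono[of Q "10201/10000" P "20031/10000"]
    by (auto simp: mult.commute)
  ultimately show "7/10 \<le> (cross2 (y - x) (z - x))\<^sup>2" "(cross2 (y - x) (z - x))\<^sup>2 \<le> 13/10"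
    using A2 by linarith+
  show "9/10 \<le> (dist x y)\<^sup>2" unfolding PQR(1)[symmetric] using PQ by linarith
qed

section \<open>The energy as a sum over pairs\<close>

definition pairs :: "'a set \<Rightarrow> 'a set set" where
  "pairs X = {e. e \<subseteq> X \<and> card e = 2}"

definition len :: "'a::metric_space set \<Rightarrow> real" where
  "len e = (\<Sum>x\<in>e. \<Sum>y\<in>e. dist x y) / 2"

lemma len_pair [simp]: "len {x, y} = dist x y"
  by (cases "x = y") (auto simp: len_def dist_commute)

lemma pair_in_pairs [simp]: "{x, y} \<in> pairs X \<longleftrightarrow> x \<in> X \<and> y \<in> X \<and> x \<noteq> y"
  by (auto simp: pairs_def card_2_iff doubleton_eq_iff)

lemma pairsE:
  assumes "e \<in> pairs X"
  obtains x y where "e = {x, y}" "x \<in> X" "y \<in> X" "x \<noteq> y"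
proof -
  obtain x y where "e = {x, y}" "x \<noteq> y" using assms by (auto simp: pairs_def card_2_iff)
  then show thesis using that assms by auto
qed

lemma finite_pairs: "finite X \<Longrightarrow> finite (pairs X)"
  unfolding pairs_def by (rule finite_subset[of _ "Pow X"]) auto

lemma energy_insert:
  assumes "finite X" "x \<notin> X"
  shows "energy V (insert x X) = energy V X + (\<Sum>y\<in>X. V (dist x y))"
proof -
  have "(\<Sum>y\<in>insert x X - {z}. V (dist z y)) = V (dist x z) + (\<Sum>y\<in>X - {z}. V (dist z y))" if "z \<in> X" for z
  proof -
    have "insert x X - {z} = insert x (X - {z})" using that assms by auto
    then show ?thesis using assms by (simp add: dist_commute)
  qed
  then have "(\<Sum>z\<in>X. \<Sum>y\<in>insert x X - {z}. V (dist z y)) =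
      (\<Sum>z\<in>X. V (dist x z)) + (\<Sum>z\<in>X. \<Sum>y\<in>X - {z}. V (dist z y))"
    by (simp add: sum.distrib)
  moreover have "insert x X - {x} = X" using assms by auto
  ultimately show ?thesis unfolding energy_def using assms by (simp add: add_divide_distrib)
qed

lemma energy_pairs:
  assumes "finite X"
  shows "energy V X = (\<Sum>e\<in>pairs X. V (len e))"
  using assms
proof (induction X)
  case empty
  have "pairs ({} :: (real^2) set) = {}" by (auto simp: pairs_def)
  then show ?case by (simp add: energy_def)
next
  case (insert x X)
  have eq: "pairs (insert x X) = pairs X \<union> (\<lambda>y. {x, y}) ` X"
  proof
    show "pairs (insert x X) \<subseteq> pairs X \<union> (\<lambda>y. {x, y}) ` X"
      by (auto elim!: pairsE simp: insert_commute)
    show "pairs X \<union> (\<lambda>y. {x, y}) ` X \<subseteq> pairs (insert x X)"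
      using insert.hyps by (auto elim!: pairsE)
  qed
  have "(\<Sum>e\<in>pairs (insert x X). V (len e)) = (\<Sum>e\<in>pairs X. V (len e)) + (\<Sum>e\<in>(\<lambda>y. {x, y}) ` X. V (len e))"
    unfolding eq using insert.hyps finite_pairs[of X]
    by (intro sum.union_disjoint) (auto simp: pairs_def)
  also have "(\<Sum>e\<in>(\<lambda>y. {x, y}) ` X. V (len e)) = (\<Sum>y\<in>X. V (dist x y))"
    by (subst sum.reindex) (auto simp: inj_on_def doubleton_eq_iff)
  finally show ?case using insert by (simp add: energy_insert)
qed

section \<open>Crossing bonds in a separated configuration\<close>

text \<open>
  Here \<open>\<beta>\<close> plays the role of \<open>\<alpha>''\<close>. The factor \<open>20\<close> guarantees that crossings of tolerance \<open>\<alpha>\<close> have all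
  distances in \<open>E_set \<beta>\<close>.
\<close>

locale separated_points =
  fixes X :: "(real^2) set" and \<alpha> \<beta> :: real
  assumes fin: "finite X" and tol: "0 < \<alpha>" "20 * \<alpha> \<le> \<beta>" "\<beta> \<le> 1/1000"
    and sep: "\<And>x y. x \<in> X \<Longrightarrow> y \<in> X \<Longrightarrow> x \<noteq> y \<Longrightarrow> 1 - \<alpha> < dist x y"
begin

definition bonds :: "real \<Rightarrow> (real^2) set set" where
  "bonds \<gamma> = {e \<in> pairs X. len e < sqrt 2 + \<gamma>}"

definition crossings :: "real \<Rightarrow> (real^2) set set set" where
  "crossings \<gamma> = {{e, f} |e f. e \<in> bonds \<gamma> \<and> f \<in> bonds \<gamma> \<and> e \<noteq> f \<and> seg e \<inter> seg f \<noteq> {}}"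

text \<open>
  The points are listed in cyclic order, so that \<open>a c\<close> and \<open>b d\<close> are the diagonals.
\<close>

definition diagonals_cross :: "real^2 \<Rightarrow> real^2 \<Rightarrow> real^2 \<Rightarrow> real^2 \<Rightarrow> bool" where
  "diagonals_cross a b c d \<longleftrightarrow> {a, c} \<in> bonds \<beta> \<and> {b, d} \<in> bonds \<beta> \<and> {a, c} \<noteq> {b, d} \<and>
     open_segment a c \<inter> open_segment b d \<noteq> {}"

lemma bond_iff: "{a, c} \<in> bonds \<gamma> \<longleftrightarrow> a \<in> X \<and> c \<in> X \<and> a \<noteq> c \<and> dist a c < sqrt 2 + \<gamma>"
  by (auto simp: bonds_def)

lemma finite_bonds: "finite (bonds \<gamma>)"
  unfolding bonds_def using finite_pairs[OF fin] by simp

lemma bonds_mono: "\<gamma> \<le> \<delta> \<Longrightarrow> bonds \<gamma> \<subseteq> bonds \<delta>"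
  by (auto simp: bonds_def)

lemma crossings_mono: "\<gamma> \<le> \<delta> \<Longrightarrow> crossings \<gamma> \<subseteq> crossings \<delta>"
  using bonds_mono[of \<gamma> \<delta>] unfolding crossings_def by blast

lemma finite_crossings: "finite (crossings \<gamma>)"
proof (rule finite_subset)
  show "crossings \<gamma> \<subseteq> Pow (bonds \<gamma>)" by (auto simp: crossings_def)
qed (simp add: finite_bonds)

lemma no_point_on_bond:
  assumes "e \<in> bonds \<beta>"
  shows "seg e \<inter> X = {}"
proof -
  obtain a c where e: "e = {a, c}" "a \<in> X" "c \<in> X" "a \<noteq> c"
    using assms unfolding bonds_def by (blast elim: pairsE)
  have ac: "dist a c < sqrt 2 + \<beta>" using assms e by (simp add: bond_iff)
  have False if z: "z \<in> open_segment a c" "z \<in> X" for z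
  proof -
    have "z \<noteq> a" "z \<noteq> c" using z by (auto simp: open_segment_def)
    then have "1 - \<alpha> < dist a z" "1 - \<alpha> < dist z c" using sep z e by auto
    moreover have "dist a c = dist a z + dist z c"
      using z(1) unfolding open_segment_def by (simp add: between_mem_segment[symmetric] between)
    ultimately show False using ac tol sqrt2_bounds by linarith
  qed
  then show ?thesis using e by auto
qed

text \<open>
  Otherwise the bonds overlap, and \<open>dist c d\<close> is the difference of two lengths between \<open>1 - \<alpha>\<close> and
  \<open>\<surd>2 + \<beta>\<close>, which is too small for distinct points.
\<close>

lemma bonds_from_point_disjoint:
  assumes "{a, c} \<in> bonds \<beta>" "{a, d} \<in> bonds \<beta>" "open_segment a c \<inter> open_segment a d \<noteq> {}"
  shows "c = d"
proof (rule ccontr)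
  assume ne: "c \<noteq> d"
  obtain z where z: "z \<in> open_segment a c" "z \<in> open_segment a d" using assms by blast
  obtain s where s: "0 < s" "s < 1" "z = (1 - s) *\<^sub>R a + s *\<^sub>R c" using z by (auto simp: in_segment)
  obtain t where t: "0 < t" "t < 1" "z = (1 - t) *\<^sub>R a + t *\<^sub>R d" using z by (auto simp: in_segment)
  have "s *\<^sub>R (c - a) = t *\<^sub>R (d - a)" using s(3) t(3) by (simp add: algebra_simps)
  then have "(1 / t) *\<^sub>R (s *\<^sub>R (c - a)) = (1 / t) *\<^sub>R (t *\<^sub>R (d - a))" by simp
  then have da: "d - a = (s / t) *\<^sub>R (c - a)" using t by simp
  have "d - c = (d - a) - (c - a)" by simp
  also have "\<dots> = (s / t - 1) *\<^sub>R (c - a)" unfolding da by (simp add: algebra_simps)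
  finally have "norm (d - c) = \<bar>(s / t - 1) * norm (c - a)\<bar>" by (simp add: abs_mult)
  moreover have "norm (d - a) = s / t * norm (c - a)" using da s t by simp
  ultimately have "norm (d - c) = \<bar>norm (d - a) - norm (c - a)\<bar>"
    by (simp add: left_diff_distrib)
  then have eq: "dist c d = \<bar>dist a d - dist a c\<bar>" by (simp add: dist_norm norm_minus_commute)
  have "1 - \<alpha> < dist c d" "1 - \<alpha> < dist a d" "1 - \<alpha> < dist a c" using sep ne assms by (auto simp: bond_iff)
  moreover have "dist a d < sqrt 2 + \<beta>" "dist a c < sqrt 2 + \<beta>" using assms by (auto simp: bond_iff)
  ultimately show False using eq tol sqrt2_bounds by linarith
qed

lemma cross_sym: "diagonals_cross a b c d \<Longrightarrow> diagonals_cross b a d c" "diagonals_cross a b c d \<Longrightarrow> diagonals_cross c b a d" "diagonals_cross a b c d \<Longrightarrow> diagonals_cross a d c b"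
  by (auto simp: diagonals_cross_def Int_commute open_segment_commute insert_commute)

lemma cross_distinct:
  assumes "diagonals_cross a b c d"
  shows "a \<in> X" "b \<in> X" "c \<in> X" "d \<in> X" "a \<noteq> b" "b \<noteq> c" "c \<noteq> d" "d \<noteq> a" "a \<noteq> c" "b \<noteq> d"
proof -
  have *: "a \<noteq> b" if "diagonals_cross a b c d" for a b c d
    using that bonds_from_point_disjoint[of a c d] by (auto simp: diagonals_cross_def)
  show "a \<noteq> b" "b \<noteq> c" "c \<noteq> d" "d \<noteq> a" using *[of a b c d] *[of c b a d] *[of a d c b] *[of c d a b] assms cross_sym by blast+
  show "a \<in> X" "b \<in> X" "c \<in> X" "d \<in> X" "a \<noteq> c" "b \<noteq> d" using assms by (auto simp: diagonals_cross_def bond_iff)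
qed

lemma cross_dists:
  assumes "diagonals_cross a b c d" and h: "\<alpha> \<le> h" "h \<le> \<beta>" and D: "dist a c < sqrt 2 + h" "dist b d < sqrt 2 + h"
  shows "dist a b \<le> 1 + 10 * h" "dist b c \<le> 1 + 10 * h" "dist c d \<le> 1 + 10 * h" "dist d a \<le> 1 + 10 * h"
    "sqrt 2 - 4 * h \<le> dist a c" "sqrt 2 - 4 * h \<le> dist b d"
proof -
  have x: "open_segment a c \<inter> open_segment b d \<noteq> {}" using assms by (auto simp: diagonals_cross_def)
  have hh: "0 < h" "h \<le> 1/1000" using h tol by auto
  have s: "1 - h \<le> dist a b" "1 - h \<le> dist b c" "1 - h \<le> dist c d" "1 - h \<le> dist d a"
    using sep[of a b] sep[of b c] sep[of c d] sep[of d a] cross_distinct[OF assms(1)] h(1) by auto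
  have D': "dist a c \<le> sqrt 2 + h" "dist b d \<le> sqrt 2 + h" using D by auto
  note r = crossing_square[OF x hh s D']
  show "dist a b \<le> 1 + 10 * h" "dist b c \<le> 1 + 10 * h" "dist c d \<le> 1 + 10 * h" "dist d a \<le> 1 + 10 * h"
    "sqrt 2 - 4 * h \<le> dist a c" "sqrt 2 - 4 * h \<le> dist b d" by (fact r)+
qed

lemma cross_sides:
  assumes "diagonals_cross a b c d"
  shows "999/1000 \<le> dist a b \<and> dist a b \<le> 101/100" "999/1000 \<le> dist b c \<and> dist b c \<le> 101/100"
    "999/1000 \<le> dist c d \<and> dist c d \<le> 101/100" "999/1000 \<le> dist d a \<and> dist d a \<le> 101/100"
    "141/100 \<le> dist a c \<and> dist a c \<le> 14153/10000" "141/100 \<le> dist b d \<and> dist b d \<le> 14153/10000"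
proof -
  have D: "dist a c < sqrt 2 + \<beta>" "dist b d < sqrt 2 + \<beta>" using assms by (auto simp: diagonals_cross_def bond_iff)
  have "1 - \<alpha> < dist a b" "1 - \<alpha> < dist b c" "1 - \<alpha> < dist c d" "1 - \<alpha> < dist d a"
    using sep cross_distinct[OF assms] by auto
  moreover note cross_dists[OF assms _ order_refl D] sqrt2_bounds tol D
  ultimately show "999/1000 \<le> dist a b \<and> dist a b \<le> 101/100" "999/1000 \<le> dist b c \<and> dist b c \<le> 101/100"
    "999/1000 \<le> dist c d \<and> dist c d \<le> 101/100" "999/1000 \<le> dist d a \<and> dist d a \<le> 101/100"
    "141/100 \<le> dist a c \<and> dist a c \<le> 14153/10000" "141/100 \<le> dist b d \<and> dist b d \<le> 14153/10000"
    by simp_all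
qed

lemma same_side_eq:
  assumes "z \<in> X" "z' \<in> X"
    and "cross2 (y - x) (z - x) * cross2 (y - x) (z' - x) > 0"
    and z: "999/1000 \<le> dist y z \<and> dist y z \<le> 101/100"
       "(999/1000 \<le> dist x y \<and> dist x y \<le> 101/100 \<and> 141/100 \<le> dist x z \<and> dist x z \<le> 14153/10000) \<or>
        (999/1000 \<le> dist x z \<and> dist x z \<le> 101/100 \<and> 141/100 \<le> dist x y \<and> dist x y \<le> 14153/10000)"
    and z': "999/1000 \<le> dist y z' \<and> dist y z' \<le> 101/100"
       "(999/1000 \<le> dist x y \<and> dist x y \<le> 101/100 \<and> 141/100 \<le> dist x z' \<and> dist x z' \<le> 14153/10000) \<or>
        (999/1000 \<le> dist x z' \<and> dist x z' \<le> 101/100 \<and> 141/100 \<le> dist x y \<and> dist x y \<le> 14153/10000)"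
  shows "z = z'"
proof (rule ccontr)
  assume ne: "z \<noteq> z'"
  note r = right_isosceles[of y z x, OF z(1)[THEN conjunct1] z(1)[THEN conjunct2] z(2)]
    and r' = right_isosceles[of y z' x, OF z'(1)[THEN conjunct1] z'(1)[THEN conjunct2] z'(2)]
  have "\<bar>(y - x) \<bullet> (z - x) - (y - x) \<bullet> (z' - x)\<bar> \<le> 1/10"
    using r(1) r'(1) unfolding abs_le_iff by linarith
  from same_side_close[OF assms(3) r(4) this r(2,3) r'(2,3)] have "dist z z' < 1/2" .
  then show False using sep[OF assms(1,2) ne] tol by linarith
qed

lemma cross_opposite:
  assumes "diagonals_cross a b c d"
  shows "cross2 (c - a) (b - a) * cross2 (c - a) (d - a) < 0"
proof -
  obtain z where z: "z \<in> open_segment a c" "z \<in> open_segment b d" using assms by (auto simp: diagonals_cross_def)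
  obtain s where s: "z = (1 - s) *\<^sub>R a + s *\<^sub>R c" using z by (auto simp: in_segment)
  obtain t where t: "0 < t" "t < 1" "z = (1 - t) *\<^sub>R b + t *\<^sub>R d" using z by (auto simp: in_segment)
  define p q where "p = cross2 (c - a) (b - a)" and "q = cross2 (c - a) (d - a)"
  have "cross2 (c - a) (z - a) = 0" unfolding s by (simp add: cross2_def algebra_simps)
  moreover have "cross2 (c - a) (z - a) = (1 - t) * p + t * q"
    unfolding t(3) p_def q_def by (simp add: cross2_def algebra_simps)
  ultimately have eq: "t * q = - ((1 - t) * p)" by simp
  have "7/10 \<le> p\<^sup>2" unfolding p_def
    using right_isosceles(2)[of c b a] cross_sides[OF assms] by (auto simp: dist_commute)
  then have "p * p > 0" by (simp add: power2_eq_square)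
  then have "(1 - t) * (p * p) > 0" using t by simp
  moreover have "t * (p * q) = - ((1 - t) * (p * p))" using eq by (metis minus_mult_right mult.left_commute)
  ultimately have "t * (p * q) < 0" by simp
  then show ?thesis using t unfolding p_def q_def by (simp add: mult_less_0_iff)
qed

text \<open>
  A given diagonal determines the other two corners up to an error smaller than the separation of the points.
\<close>

lemma cross_unique_partner:
  assumes 1: "diagonals_cross a b c d" and 2: "diagonals_cross a b' c d'"
  shows "{b, d} = {b', d'}"
proof -
  have *: "b = b'" if 1: "diagonals_cross a b c d" and 2: "diagonals_cross a b' c d'"
      and s: "cross2 (c - a) (b - a) * cross2 (c - a) (b' - a) > 0" for b d b' d'
    using same_side_eq[of b b' c a] cross_sides[OF 1] cross_sides[OF 2] cross_distinct[OF 1] cross_distinct[OF 2] s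
    by (auto simp: dist_commute)
  note o = cross_opposite[OF 1] cross_opposite[OF 2]
  have "cross2 (c - a) (b - a) * cross2 (c - a) (b' - a) > 0 \<and> cross2 (c - a) (d - a) * cross2 (c - a) (d' - a) > 0
     \<or> cross2 (c - a) (b - a) * cross2 (c - a) (d' - a) > 0 \<and> cross2 (c - a) (d - a) * cross2 (c - a) (b' - a) > 0"
    using o by (auto simp: mult_less_0_iff zero_less_mult_iff)
  then show ?thesis
    using *[OF 1 2] *[OF cross_sym(3)[OF 1] cross_sym(3)[OF 2]] *[OF 1 cross_sym(3)[OF 2]] *[OF cross_sym(3)[OF 1] 2] by auto
qed

lemma crossing_bonds:
  assumes "e \<in> bonds \<beta>" "f \<in> bonds \<beta>" "e \<noteq> f" "seg e \<inter> seg f \<noteq> {}"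
  obtains a b c d where "e = {a, c}" "f = {b, d}" "diagonals_cross a b c d"
proof -
  obtain a c where e: "e = {a, c}" using assms(1) unfolding bonds_def by (blast elim: pairsE)
  obtain b d where f: "f = {b, d}" using assms(2) unfolding bonds_def by (blast elim: pairsE)
  show thesis using that[OF e f] assms unfolding e f diagonals_cross_def by simp
qed

lemma crossingsE:
  assumes "Q \<in> crossings \<beta>"
  obtains a b c d where "Q = {{a, c}, {b, d}}" "diagonals_cross a b c d"
proof -
  obtain e f where Q: "Q = {e, f}" and ef: "e \<in> bonds \<beta>" "f \<in> bonds \<beta>" "e \<noteq> f" "seg e \<inter> seg f \<noteq> {}"
    using assms unfolding crossings_def by blast
  from crossing_bonds[OF ef] show thesis using that Q by metis
qed

lemma crossing_card: "Q \<in> crossings \<beta> \<Longrightarrow> card Q = 2"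
  unfolding crossings_def card_2_iff by blast

lemma crossing_other:
  assumes "Q \<in> crossings \<beta>" "{a, c} \<in> Q"
  obtains b d where "Q = {{a, c}, {b, d}}" "diagonals_cross a b c d"
proof -
  obtain a' b' c' d' where Q: "Q = {{a', c'}, {b', d'}}" "diagonals_cross a' b' c' d'" using crossingsE[OF assms(1)] .
  then consider "{a, c} = {a', c'}" | "{a, c} = {b', d'}" using assms(2) by auto
  then show thesis
  proof cases
    case 1
    then have "diagonals_cross a b' c d'" using Q(2) cross_sym(2) by (auto simp: doubleton_eq_iff)
    then show thesis using that 1 Q by simp
  next
    case 2
    then have "diagonals_cross a a' c c'" using cross_sym(1)[OF Q(2)] cross_sym(2) by (auto simp: doubleton_eq_iff)
    moreover have "Q = {{a, c}, {a', c'}}" using 2 Q(1) by auto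
    ultimately show thesis using that by blast
  qed
qed

text \<open>
  A bond belongs to at most one crossing. Distinct crossings are therefore disjoint as two-element sets of bonds.
\<close>

lemma crossings_disjoint:
  assumes "Q \<in> crossings \<beta>" "Q' \<in> crossings \<beta>" "e \<in> Q" "e \<in> Q'"
  shows "Q = Q'"
proof -
  have "e \<in> bonds \<beta>" using assms by (auto simp: crossings_def)
  then obtain a c where e: "e = {a, c}" unfolding bonds_def by (blast elim: pairsE)
  obtain b d where 1: "Q = {{a, c}, {b, d}}" "diagonals_cross a b c d" using crossing_other assms e by metis
  obtain b' d' where 2: "Q' = {{a, c}, {b', d'}}" "diagonals_cross a b' c d'" using crossing_other assms e by metis
  show ?thesis using cross_unique_partner[OF 1(2) 2(2)] 1 2 by simp
qed

definition sides :: "(real^2) set set \<Rightarrow> (real^2) set set" where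
  "sides Q = {{x, y} |x y. \<exists>e f. Q = {e, f} \<and> e \<noteq> f \<and> x \<in> e \<and> y \<in> f}"

lemma sides_cross:
  assumes "diagonals_cross a b c d"
  shows "sides {{a, c}, {b, d}} = {{a, b}, {b, c}, {c, d}, {d, a}}"
proof -
  have "{a, c} \<noteq> {b, d}" using assms by (auto simp: diagonals_cross_def)
  then have "sides {{a, c}, {b, d}} = {{x, y} |x y. x \<in> {a, c} \<and> y \<in> {b, d} \<or> x \<in> {b, d} \<and> y \<in> {a, c}}"
    unfolding sides_def doubleton_eq_iff[of "{a, c}"] by blast
  also have "\<dots> = {{a, b}, {b, c}, {c, d}, {d, a}}" by (auto simp: insert_commute)
  finally show ?thesis .
qed

lemma sides_of_crossing:
  assumes "Q \<in> crossings \<beta>"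
  shows "card (sides Q) = 4" "\<And>s. s \<in> sides Q \<Longrightarrow> s \<in> pairs X \<and> len s \<le> 101/100"
    "\<And>e. e \<in> Q \<Longrightarrow> 141/100 \<le> len e"
proof -
  obtain a b c d where Q: "Q = {{a, c}, {b, d}}" "diagonals_cross a b c d" using crossingsE[OF assms(1)] .
  note D = cross_distinct[OF Q(2)]
  show "card (sides Q) = 4" unfolding Q sides_cross[OF Q(2)] using D by (auto simp: doubleton_eq_iff card_insert_if)
  show "s \<in> pairs X \<and> len s \<le> 101/100" if "s \<in> sides Q" for s
    using that D cross_sides[OF Q(2)] unfolding Q sides_cross[OF Q(2)] by (auto simp: dist_commute)
  show "141/100 \<le> len e" if "e \<in> Q" for e using that cross_sides[OF Q(2)] Q by auto
qed

lemma side_of_crossing: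
  assumes "Q \<in> crossings \<beta>" "{x, y} \<in> sides Q"
  obtains z w where "Q = {{x, z}, {y, w}}" "diagonals_cross x y z w"
proof -
  obtain a b c d where Q: "Q = {{a, c}, {b, d}}" "diagonals_cross a b c d" using crossingsE[OF assms(1)] .
  consider "{x, y} = {a, b}" | "{x, y} = {b, c}" | "{x, y} = {c, d}" | "{x, y} = {d, a}"
    using assms(2) unfolding Q sides_cross[OF Q(2)] by auto
  then have "\<exists>z w. Q = {{x, z}, {y, w}} \<and> diagonals_cross x y z w"
  proof cases
    case 1
    have "Q = {{b, d}, {a, c}}" using Q by auto
    then show ?thesis using 1 Q cross_sym(1)[OF Q(2)] unfolding doubleton_eq_iff by metis
  next
    case 2
    have "Q = {{c, a}, {b, d}}" "Q = {{b, d}, {c, a}}" using Q by auto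
    then show ?thesis using 2 cross_sym(2)[OF Q(2)] cross_sym(1)[OF cross_sym(2)[OF Q(2)]] unfolding doubleton_eq_iff by metis
  next
    case 3
    have "Q = {{c, a}, {d, b}}" "Q = {{d, b}, {c, a}}" using Q by auto
    then show ?thesis using 3 cross_sym(3)[OF cross_sym(2)[OF Q(2)]] cross_sym(1)[OF cross_sym(3)[OF cross_sym(2)[OF Q(2)]]]
      unfolding doubleton_eq_iff by metis
  next
    case 4
    have "Q = {{a, c}, {d, b}}" "Q = {{d, b}, {a, c}}" using Q by auto
    then show ?thesis using 4 cross_sym(3)[OF Q(2)] cross_sym(1)[OF cross_sym(3)[OF Q(2)]] unfolding doubleton_eq_iff by metis
  qed
  then show thesis using that by blast
qed

text \<open>
  There is at most one square on each side of the line through \<open>s\<close>.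
\<close>

lemma card_squares_on_side: "card {Q \<in> crossings \<beta>. s \<in> sides Q} \<le> 2"
proof (cases "{Q \<in> crossings \<beta>. s \<in> sides Q} = {}")
  case False
  then obtain x y where s: "s = {x, y}" unfolding sides_def by blast
  define S where "S = {Q \<in> crossings \<beta>. s \<in> sides Q}"
  have "\<forall>Q\<in>S. \<exists>z. {x, z} \<in> Q \<and> (\<exists>w. diagonals_cross x y z w)"
  proof
    fix Q assume "Q \<in> S"
    then have Q: "Q \<in> crossings \<beta>" "{x, y} \<in> sides Q" unfolding S_def s by auto
    obtain z w where "Q = {{x, z}, {y, w}}" "diagonals_cross x y z w" using side_of_crossing[OF Q] .
    then show "\<exists>z. {x, z} \<in> Q \<and> (\<exists>w. diagonals_cross x y z w)" by blast
  qed
  then obtain z where z: "\<And>Q. Q \<in> S \<Longrightarrow> {x, z Q} \<in> Q \<and> (\<exists>w. diagonals_cross x y (z Q) w)" by metis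
  have "inj_on (\<lambda>Q. cross2 (y - x) (z Q - x) > 0) S"
  proof (rule inj_onI)
    fix Q Q' assume QQ: "Q \<in> S" "Q' \<in> S" "(cross2 (y - x) (z Q - x) > 0) = (cross2 (y - x) (z Q' - x) > 0)"
    obtain w w' where w: "diagonals_cross x y (z Q) w" "diagonals_cross x y (z Q') w'" using z QQ by blast
    note w1 = cross_sides[OF w(1)] and w2 = cross_sides[OF w(2)]
    have "7/10 \<le> (cross2 (y - x) (z Q - x))\<^sup>2" "7/10 \<le> (cross2 (y - x) (z Q' - x))\<^sup>2"
      using right_isosceles(2)[of y "z Q" x] right_isosceles(2)[of y "z Q'" x] w1 w2 by auto
    then have "cross2 (y - x) (z Q - x) \<noteq> 0" "cross2 (y - x) (z Q' - x) \<noteq> 0" by auto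
    then have "cross2 (y - x) (z Q - x) * cross2 (y - x) (z Q' - x) > 0"
      using QQ(3) by (auto simp: zero_less_mult_iff)
    then have "z Q = z Q'"
      using same_side_eq[of "z Q" "z Q'" y x] cross_distinct[OF w(1)] cross_distinct[OF w(2)] w1 w2 by auto
    then show "Q = Q'" using crossings_disjoint[of Q Q' "{x, z Q}"] z[OF QQ(1)] z[OF QQ(2)] QQ unfolding S_def by auto
  qed
  then have "card S \<le> card (UNIV :: bool set)" by (rule card_inj_on_le) auto
  then show ?thesis by (simp add: S_def)
next
  case True
  show ?thesis unfolding True by simp
qed

end

section \<open>The lower bound for separated configurations\<close>

context separated_points begin

text \<open>
  Deleting one diagonal \<open>{B Q, D Q}\<close> of every crossing \<open>Q\<close> leaves a plane graph \<open>F\<close>; as the crossings are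
  disjoint, no bond is deleted twice. The other diagonal cuts each square into two triangles, and a triangle remembers its square
  through its longest side.
\<close>

lemma bonds_bounds:
  shows card_bonds: "card (bonds \<beta>) \<le> 3 * card X + card (crossings \<beta>)"
    and card_crossings: "card (crossings \<beta>) \<le> card X"
proof -
  let ?C = "crossings \<beta>"
  have "\<forall>Q\<in>?C. \<exists>a b c d. Q = {{a, c}, {b, d}} \<and> diagonals_cross a b c d"
    by (metis crossingsE)
  then obtain A B C D where ABCD: "\<forall>Q\<in>?C. Q = {{A Q, C Q}, {B Q, D Q}} \<and> diagonals_cross (A Q) (B Q) (C Q) (D Q)"
    unfolding bchoice_iff by blast
  then have Q: "Q = {{A Q, C Q}, {B Q, D Q}}" and S: "diagonals_cross (A Q) (B Q) (C Q) (D Q)" if "Q \<in> ?C" for Q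
    using that by blast+
  define del where "del Q = {B Q, D Q}" for Q
  define F where "F = bonds \<beta> - del ` ?C"
  have del_in: "del Q \<in> Q" "{A Q, C Q} \<in> Q" if "Q \<in> ?C" for Q
    using Q[OF that] unfolding del_def by blast+
  have del_inj: "inj_on del ?C"
    using crossings_disjoint del_in unfolding inj_on_def by metis
  have del_bond: "del ` ?C \<subseteq> bonds \<beta>" using S by (auto simp: del_def diagonals_cross_def)
  have F: "e \<subseteq> X \<and> card e = 2" if "e \<in> F" for e
    using that by (auto simp: F_def bonds_def pairs_def)
  have nocross: "seg e \<inter> seg f = {}" if "e \<in> F" "f \<in> F" "e \<noteq> f" for e f
  proof (rule ccontr)
    assume "seg e \<inter> seg f \<noteq> {}"
    then have "{e, f} \<in> ?C" using that unfolding crossings_def F_def by blast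
    then have "del {e, f} = e \<or> del {e, f} = f" using del_in by blast
    then show False using that \<open>{e, f} \<in> ?C\<close> unfolding F_def by force
  qed
  have novert: "seg e \<inter> X = {}" if "e \<in> F" for e using no_point_on_bond that by (auto simp: F_def)
  have "card F = card (bonds \<beta>) - card ?C"
    unfolding F_def using del_bond finite_crossings by (simp add: card_Diff_subset card_image[OF del_inj])
  moreover have "card F \<le> 3 * card X"
    by (rule plane_graph_edges[OF fin]) (fact F nocross novert)+
  ultimately show "card (bonds \<beta>) \<le> 3 * card X + card ?C" by linarith
  define tri where "tri = (\<lambda>(Q, i). {A Q, C Q, if i then B Q else D Q})"
  have corner: "(if i then B Q else D Q) \<in> X \<and> (if i then B Q else D Q) \<noteq> A Q \<and> (if i then B Q else D Q) \<noteq> C Q \<and>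
      999/1000 \<le> dist (A Q) (if i then B Q else D Q) \<and> dist (A Q) (if i then B Q else D Q) \<le> 101/100 \<and>
      999/1000 \<le> dist (C Q) (if i then B Q else D Q) \<and> dist (C Q) (if i then B Q else D Q) \<le> 101/100"
    if "Q \<in> ?C" for Q i
    using cross_distinct[OF S[OF that]] cross_sides[OF S[OF that]] by (auto simp: dist_commute)
  have kept: "A Q \<in> X \<and> C Q \<in> X \<and> A Q \<noteq> C Q \<and> 141/100 \<le> dist (A Q) (C Q) \<and> dist (A Q) (C Q) \<le> 14153/10000"
    if "Q \<in> ?C" for Q
    using cross_distinct[OF S[OF that]] cross_sides[OF S[OF that]] by auto
  have "inj_on tri (?C \<times> UNIV)"
  proof (rule inj_onI, clarify)
    fix Q Q' i i'
    assume QQ: "Q \<in> ?C" "Q' \<in> ?C" and eq: "tri (Q, i) = tri (Q', i')"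
    define v v' where "v = (if i then B Q else D Q)" and "v' = (if i' then B Q' else D Q')"
    have eq': "{A Q, C Q, v} = {A Q', C Q', v'}" using eq by (simp add: tri_def v_def v'_def)
    have v: "dist (A Q) v \<le> 101/100" "dist (C Q) v \<le> 101/100" "v \<noteq> A Q" "v \<noteq> C Q"
      using corner[OF QQ(1), of i] by (simp_all add: v_def)
    have v': "v' \<noteq> A Q'" "v' \<noteq> C Q'" using corner[OF QQ(2), of i'] by (simp_all add: v'_def)
    have k: "A Q' \<noteq> C Q'" "141/100 \<le> dist (A Q') (C Q')" using kept QQ by auto
    have "A Q' \<in> {A Q, C Q, v}" "C Q' \<in> {A Q, C Q, v}" using eq' by auto
    then have "{A Q', C Q'} = {A Q, C Q}" using k v by (auto simp: dist_commute)
    then have "Q = Q'" using crossings_disjoint[OF QQ] del_in(2)[OF QQ(1)] del_in(2)[OF QQ(2)] by metis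
    moreover have "v = v'" using eq' v v' \<open>Q = Q'\<close> by auto
    moreover have "B Q \<noteq> D Q" using cross_distinct(10)[OF S[OF QQ(1)]] .
    ultimately show "Q = Q' \<and> i = i'" unfolding v_def v'_def by (auto split: if_splits)
  qed
  then have "card (tri ` (?C \<times> UNIV)) = 2 * card ?C"
    by (simp add: card_image card_cartesian_product card_UNIV_bool)
  moreover have "card (tri ` (?C \<times> UNIV)) \<le> 2 * card X"
  proof (rule plane_graph_triangles[OF fin, of F])
    show "e \<subseteq> X \<and> card e = 2" if "e \<in> F" for e using F that .
    show "seg e \<inter> seg f = {}" if "e \<in> F" "f \<in> F" "e \<noteq> f" for e f using nocross that .
    show "seg e \<inter> X = {}" if "e \<in> F" for e using novert that .
  next
    fix t assume "t \<in> tri ` (?C \<times> UNIV)"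
    then obtain Q i where Qi: "Q \<in> ?C" "t = tri (Q, i)" by auto
    define v where "v = (if i then B Q else D Q)"
    have t: "t = {A Q, C Q, v}" by (simp add: Qi tri_def v_def)
    note c = corner[OF Qi(1), of i, folded v_def] and k = kept[OF Qi(1)]
    have "z \<in> t" if z: "z \<in> X" "z \<in> convex hull t" for z
    proof (rule ccontr)
      assume n: "z \<notin> t"
      show False
      proof (rule no_point_in_triangle)
        show "z \<in> convex hull {A Q, C Q, v}" using z t by simp
        show "dist (A Q) (C Q) \<le> 142/100" "dist (C Q) v \<le> 142/100" "dist (A Q) v \<le> 142/100" using c k by auto
        have "1 - \<alpha> < dist (A Q) z" "1 - \<alpha> < dist (C Q) z" "1 - \<alpha> < dist v z"
          using sep c k z n t by auto
        then show "dist (A Q) z \<ge> 9/10" "dist (C Q) z \<ge> 9/10" "dist v z \<ge> 9/10" using tol by auto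
      qed
    qed
    moreover have "t \<subseteq> X" using c k t by auto
    moreover have "card t = 3" using c k unfolding t by (auto simp: card_insert_if)
    ultimately show "t \<subseteq> X \<and> card t = 3 \<and> X \<inter> convex hull t \<subseteq> t" by blast
    have long: "141/100 \<le> len e" if "e \<in> del ` ?C" for e
      using that sides_of_crossing(3) del_in(1) by auto
    have "{A Q, C Q} \<notin> del ` ?C"
    proof
      assume "{A Q, C Q} \<in> del ` ?C"
      then obtain Q' where Q': "Q' \<in> ?C" "{A Q, C Q} = del Q'" by auto
      then have "Q' = Q" using crossings_disjoint[OF Q'(1) Qi(1)] del_in(1)[OF Q'(1)] del_in(2)[OF Qi(1)] by metis
      then show False using Q'(2) S[OF Qi(1)] by (auto simp: del_def diagonals_cross_def)
    qed
    then have "{A Q, C Q} \<in> F" using S[OF Qi(1)] by (simp add: F_def diagonals_cross_def)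
    moreover have "{A Q, v} \<in> F" "{C Q, v} \<in> F"
      using c k long[of "{A Q, v}"] long[of "{C Q, v}"] tol sqrt2_bounds by (auto simp: F_def bond_iff)
    ultimately show "{x, y} \<in> F" if "x \<in> t" "y \<in> t" "x \<noteq> y" for x y
      using that unfolding t by (auto simp: insert_commute)
  qed
  ultimately show "card ?C \<le> card X" by simp
qed

text \<open>
  A crossing that is not one of bonds shorter than \<open>\<surd>2 + \<alpha>\<close> contains a longer bond, and bonds are not shared
  between crossings.
\<close>

lemma long_crossings: "card (crossings \<beta> - crossings \<alpha>) \<le> card (bonds \<beta> - bonds \<alpha>)"
proof -
  have "\<forall>Q\<in>crossings \<beta> - crossings \<alpha>. \<exists>e. e \<in> Q \<and> e \<in> bonds \<beta> - bonds \<alpha>"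
    unfolding crossings_def by blast
  then obtain f where f: "\<And>Q. Q \<in> crossings \<beta> - crossings \<alpha> \<Longrightarrow> f Q \<in> Q \<and> f Q \<in> bonds \<beta> - bonds \<alpha>"
    unfolding bchoice_iff by blast
  show ?thesis
  proof (rule card_inj_on_le)
    show "inj_on f (crossings \<beta> - crossings \<alpha>)"
      using f crossings_disjoint unfolding inj_on_def by (metis DiffD1)
  qed (use f finite_bonds in auto)
qed

lemma card_Union_crossings: "card (\<Union>(crossings \<alpha>)) = 2 * card (crossings \<alpha>)"
proof -
  have sub: "crossings \<alpha> \<subseteq> crossings \<beta>" using crossings_mono tol by auto
  have "card (\<Union>(crossings \<alpha>)) = (\<Sum>Q\<in>crossings \<alpha>. card Q)"
  proof (rule card_Union_disjoint)
    show "pairwise disjnt (crossings \<alpha>)"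
      using crossings_disjoint sub unfolding pairwise_def disjnt_iff by blast
    show "finite Q" if "Q \<in> crossings \<alpha>" for Q
      using crossing_card[of Q] sub that by (intro card_ge_0_finite) auto
  qed
  also have "\<dots> = (\<Sum>Q\<in>crossings \<alpha>. 2)" using crossing_card sub by (intro sum.cong) auto
  finally show ?thesis by simp
qed

text \<open>
  The weight \<open>w s\<close> is the total weight of the bond \<open>s\<close> in the four-point energies of all squares with
  diagonals shorter than \<open>\<surd>2 + \<alpha>\<close>. It is at most \<open>1\<close>, because a diagonal is not a side and a side is shared by at
  most two squares. The parts of the energy that are not covered by squares are bounded by the counting
  inequalities for bonds and crossings.
\<close>

theorem energy_lower_bound:
  fixes V :: "real \<Rightarrow> real" and m :: real
  assumes V: "\<And>r. 0 < r \<Longrightarrow> - 1 \<le> V r"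
    and far: "\<And>r. sqrt 2 + \<alpha> \<le> r \<Longrightarrow> - 1/2 \<le> V r"
    and zero: "\<And>r. sqrt 2 + \<beta> \<le> r \<Longrightarrow> V r = 0"
    and squares: "\<And>a b c d. diagonals_cross a b c d \<Longrightarrow> {a, c} \<in> bonds \<alpha> \<Longrightarrow> {b, d} \<in> bonds \<alpha> \<Longrightarrow>
        m \<le> (V (dist a b) + V (dist b c) + V (dist c d) + V (dist d a)) / 2 + V (dist a c) + V (dist b d)"
    and m: "m \<le> - 7/2"
  shows "real (card X) * m \<le> energy V X"
proof -
  define v where "v e = V (len e)" for e :: "(real^2) set"
  let ?C = "crossings \<alpha>" and ?B = "bonds \<alpha>"
  have subC: "?C \<subseteq> crossings \<beta>" and subB: "?B \<subseteq> bonds \<beta>" using crossings_mono bonds_mono tol by auto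
  note finC = finite_crossings[of \<alpha>] and finB = finite_bonds[of \<alpha>]
  define n where "n s = card {Q \<in> ?C. s \<in> sides Q}" for s
  define w where "w s = (if s \<in> \<Union>?C then 1 else 0) + real (n s) / 2" for s
  have UB: "\<Union>?C \<subseteq> ?B" by (auto simp: crossings_def)
  have sidesB: "sides Q \<subseteq> ?B" if "Q \<in> ?C" for Q
  proof
    fix s assume "s \<in> sides Q"
    then have "s \<in> pairs X \<and> len s \<le> 101/100" using sides_of_crossing subC that by blast
    then show "s \<in> ?B" using tol sqrt2_bounds by (auto simp: bonds_def)
  qed
  \<comment> \<open>Double counting of the pairs of a square and one of its sides.\<close>
  have double: "(\<Sum>Q\<in>?C. \<Sum>s\<in>sides Q. f s) = (\<Sum>s\<in>?B. real (n s) * f s)" for f :: "_ \<Rightarrow> real"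
  proof -
    have "(\<Sum>Q\<in>?C. \<Sum>s\<in>sides Q. f s) = (\<Sum>Q\<in>?C. \<Sum>s | s \<in> ?B \<and> s \<in> sides Q. f s)"
      using sidesB by (intro sum.cong) auto
    also have "\<dots> = (\<Sum>s\<in>?B. \<Sum>Q | Q \<in> ?C \<and> s \<in> sides Q. f s)"
      by (rule sum.swap_restrict[OF finC finB])
    finally show ?thesis by (simp add: n_def)
  qed
  have pos: "0 < len e" if "e \<in> pairs X" for e using that by (auto elim!: pairsE)
  have w1: "w s \<le> 1" if "s \<in> ?B" for s
  proof -
    have n2: "n s \<le> 2"
    proof -
      have "n s \<le> card {Q \<in> crossings \<beta>. s \<in> sides Q}"
        unfolding n_def using subC finite_crossings by (intro card_mono) auto
      then show ?thesis using card_squares_on_side[of s] by linarith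
    qed
    moreover have "n s = 0" if "s \<in> \<Union>?C"
    proof -
      have "141/100 \<le> len s" using that sides_of_crossing(3) subC by blast
      then have "{Q \<in> ?C. s \<in> sides Q} = {}" using sides_of_crossing(2) subC by fastforce
      then show ?thesis by (simp only: n_def card.empty)
    qed
    ultimately show ?thesis by (auto simp: w_def)
  qed
  have sum_w: "(\<Sum>s\<in>?B. w s) = 4 * card ?C"
  proof -
    have "(\<Sum>s\<in>?B. w s) = (\<Sum>s\<in>?B. if s \<in> \<Union>?C then 1 else 0) + (\<Sum>s\<in>?B. real (n s) * 1) / 2"
      by (simp add: w_def sum.distrib sum_divide_distrib)
    also have "(\<Sum>s\<in>?B. if s \<in> \<Union>?C then 1 else 0 :: real) = real (card (\<Union>?C))"
      using finB UB by (simp add: sum.If_cases Int_absorb1 Collect_mem_eq del: Union_iff)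
    also have "(\<Sum>s\<in>?B. real (n s) * 1) = (\<Sum>Q\<in>?C. \<Sum>s\<in>sides Q. 1)" using double[of "\<lambda>_. 1"] by simp
    also have "\<dots> = (\<Sum>Q\<in>?C. 4)" using sides_of_crossing(1) subC by (intro sum.cong) auto
    finally show ?thesis by (simp add: card_Union_crossings)
  qed
  have sum_wv: "m * card ?C \<le> (\<Sum>s\<in>?B. w s * v s)"
  proof -
    have "(\<Sum>s\<in>?B. w s * v s) = (\<Sum>s\<in>?B. if s \<in> \<Union>?C then v s else 0) + (\<Sum>s\<in>?B. real (n s) * v s) / 2"
      unfolding w_def sum_divide_distrib sum.distrib[symmetric] by (intro sum.cong) (auto simp: algebra_simps)
    also have "(\<Sum>s\<in>?B. if s \<in> \<Union>?C then v s else 0) = (\<Sum>s\<in>\<Union>?C. v s)"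
      using finB UB by (simp add: sum.If_cases Int_absorb1 Collect_mem_eq del: Union_iff)
    also have "\<dots> = (\<Sum>Q\<in>?C. \<Sum>s\<in>Q. v s)"
    proof -
      have "\<forall>Q\<in>?C. finite Q" by (auto simp: crossings_def)
      moreover have "\<forall>Q\<in>?C. \<forall>Q'\<in>?C. Q \<noteq> Q' \<longrightarrow> Q \<inter> Q' = {}" using crossings_disjoint subC by blast
      ultimately show ?thesis by (simp add: sum.Union_disjoint)
    qed
    also have "(\<Sum>s\<in>?B. real (n s) * v s) = (\<Sum>Q\<in>?C. \<Sum>s\<in>sides Q. v s)" by (rule double[symmetric])
    finally have "(\<Sum>s\<in>?B. w s * v s) = (\<Sum>Q\<in>?C. (\<Sum>s\<in>Q. v s) + (\<Sum>s\<in>sides Q. v s) / 2)"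
      by (simp add: sum.distrib sum_divide_distrib)
    moreover have "(\<Sum>Q\<in>?C. m) \<le> (\<Sum>Q\<in>?C. (\<Sum>s\<in>Q. v s) + (\<Sum>s\<in>sides Q. v s) / 2)"
    proof (rule sum_mono)
      fix Q assume Q: "Q \<in> ?C"
      have "Q \<in> crossings \<beta>" using Q subC by blast
      then obtain a b c d where abcd: "Q = {{a, c}, {b, d}}" "diagonals_cross a b c d" by (rule crossingsE)
      have ne: "{a, c} \<noteq> {b, d}" using abcd(2) by (simp add: diagonals_cross_def)
      have bd: "{a, c} \<in> ?B" "{b, d} \<in> ?B" using Q UB abcd(1) by blast+
      have "(\<Sum>s\<in>Q. v s) = V (dist a c) + V (dist b d)" using ne by (simp add: abcd(1) v_def)
      moreover have "(\<Sum>s\<in>sides Q. v s) = V (dist a b) + V (dist b c) + V (dist c d) + V (dist d a)"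
        unfolding abcd(1) sides_cross[OF abcd(2)] using cross_distinct[OF abcd(2)]
        by (simp add: doubleton_eq_iff v_def)
      ultimately show "m \<le> (\<Sum>s\<in>Q. v s) + (\<Sum>s\<in>sides Q. v s) / 2" using squares[OF abcd(2) bd] by simp
    qed
    ultimately show ?thesis by (simp add: mult.commute)
  qed
  have "(\<Sum>s\<in>?B. v s) \<ge> (\<Sum>s\<in>?B. w s * v s - (1 - w s))"
  proof (rule sum_mono)
    fix s assume s: "s \<in> ?B"
    then have "- 1 \<le> v s" using V pos by (auto simp: v_def bonds_def)
    then have "(1 - w s) * (- 1) \<le> (1 - w s) * v s" using w1[OF s] by (intro mult_left_mono) auto
    then show "w s * v s - (1 - w s) \<le> v s" by (simp add: algebra_simps)
  qed
  then have B1: "(\<Sum>s\<in>?B. v s) \<ge> m * card ?C - card ?B + 4 * card ?C"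
    using sum_wv sum_w by (simp add: sum_subtractf)
  have "(\<Sum>s\<in>bonds \<beta> - ?B. v s) \<ge> (\<Sum>s\<in>bonds \<beta> - ?B. - 1/2)"
    by (rule sum_mono) (use far in \<open>auto simp: v_def bonds_def\<close>)
  then have B2: "(\<Sum>s\<in>bonds \<beta> - ?B. v s) \<ge> - real (card (bonds \<beta> - ?B)) / 2" by simp
  have "energy V X = (\<Sum>s\<in>pairs X. v s)" by (simp add: energy_pairs[OF fin] v_def)
  also have "\<dots> = (\<Sum>s\<in>bonds \<beta>. v s)"
  proof (rule sum.mono_neutral_right)
    show "\<forall>s\<in>pairs X - bonds \<beta>. v s = 0" using zero by (auto simp: bonds_def v_def not_less)
  qed (use finite_pairs[OF fin] in \<open>auto simp: bonds_def\<close>)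
  also have "\<dots> = (\<Sum>s\<in>bonds \<beta> - ?B. v s) + (\<Sum>s\<in>?B. v s)"
    by (rule sum.subset_diff[OF subB finite_bonds])
  finally have E: "energy V X \<ge> m * card ?C - card ?B + 4 * card ?C - real (card (bonds \<beta> - ?B)) / 2"
    using B1 B2 by linarith
  have c1: "real (card (bonds \<beta>)) = card ?B + card (bonds \<beta> - ?B)"
    using card_mono[OF finite_bonds subB] by (simp add: card_Diff_subset[OF finB subB])
  have c2: "real (card (crossings \<beta>)) = card ?C + card (crossings \<beta> - ?C)"
    using card_mono[OF finite_crossings subC] by (simp add: card_Diff_subset[OF finC subC])
  have c3: "real (card (bonds \<beta>)) \<le> 3 * real (card X) + real (card (crossings \<beta>))"
    "real (card (crossings \<beta>)) \<le> real (card X)"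
    "real (card (crossings \<beta> - ?C)) \<le> real (card (bonds \<beta> - ?B))"
    using card_bonds card_crossings long_crossings by linarith+
  have "(m + 7/2) * (real (card X) - card ?C) \<le> 0"
    using m c2 c3 by (intro mult_nonpos_nonneg) auto
  then have "real (card X) * m \<le> m * card ?C - 7/2 * (real (card X) - card ?C)" by (simp add: algebra_simps)
  moreover define N k l b s where "N = real (card X)" and "k = real (card ?C)" and "l = real (card (bonds \<beta> - ?B))"
    and "b = real (card ?B)" and "s = real (card (crossings \<beta> - ?C))"
  ultimately have "N * m \<le> m * k - 7/2 * (N - k)" by simp
  moreover have "energy V X \<ge> m * k - b + 4 * k - l / 2" using E by (simp add: N_def k_def b_def l_def)
  moreover have "b + l \<le> 3 * N + (k + s)" "k + s \<le> N" "s \<le> l"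
    using c1 c2 c3 by (simp_all add: N_def k_def b_def l_def s_def)
  ultimately have "N * m \<le> energy V X" by argo
  then show ?thesis by (simp add: N_def)
qed

end

section \<open>The four-point energy\<close>

lemma E4_eq: "E4 V x = (V (dist (x $ 1) (x $ 2)) + V (dist (x $ 2) (x $ 3)) + V (dist (x $ 3) (x $ 4)) + V (dist (x $ 4) (x $ 1))) / 2
      + V (dist (x $ 1) (x $ 3)) + V (dist (x $ 2) (x $ 4))"
proof -
  have 4: "(4::4) = 0" by simp
  have "(1::4) \<noteq> 2" by simp
  moreover have "(3::4) + 1 = 4" "(4::4) + 1 = 1" "(3::4) + 2 = 1" "(4::4) + 2 = 2" "(2::4) + 2 = 4" "(2::4) + 1 = 3" "(1::4) + 2 = 3"
    "(1::4) + 1 = 2" by simp_all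
  ultimately show ?thesis unfolding E4_def by (simp only: sum_4 sum.insert sum.empty finite.intros insert_iff empty_iff
    simp_thms if_False) (simp add: dist_commute add_divide_distrib)
qed

definition quad :: "real^2 \<Rightarrow> real^2 \<Rightarrow> real^2 \<Rightarrow> real^2 \<Rightarrow> real^2^4" where
  "quad a b c d = (\<chi> i. if i = 1 then a else if i = 2 then b else if i = 3 then c else d)"

lemma quad_nth [simp]: "quad a b c d $ 1 = a" "quad a b c d $ 2 = b" "quad a b c d $ 3 = c" "quad a b c d $ 4 = d"
  by (simp_all add: quad_def)

lemma norm_sq_2: "(norm v)\<^sup>2 = (v $ 1)\<^sup>2 + (v $ 2)\<^sup>2" for v :: "real^2"
  unfolding power2_norm_eq_inner by (simp add: inner_vec_def sum_2 power2_eq_square)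

lemma dist_sq_2: "(dist p q)\<^sup>2 = (p $ 1 - q $ 1)\<^sup>2 + (p $ 2 - q $ 2)\<^sup>2" for p q :: "real^2"
  by (simp add: dist_norm norm_sq_2)

lemma dist_2: "dist p q = sqrt ((p $ 1 - q $ 1)\<^sup>2 + (p $ 2 - q $ 2)\<^sup>2)" for p q :: "real^2"
  by (metis dist_sq_2 real_sqrt_unique zero_le_dist)

lemma inj_4: "inj (($) (x :: 'a^4)) \<longleftrightarrow> x $ 1 \<noteq> x $ 2 \<and> x $ 1 \<noteq> x $ 3 \<and> x $ 1 \<noteq> x $ 4 \<and> x $ 2 \<noteq> x $ 3 \<and> x $ 2 \<noteq> x $ 4 \<and> x $ 3 \<noteq> x $ 4"
proof -
  have "(1::4) \<noteq> 2" "(1::4) \<noteq> 3" "(1::4) \<noteq> 4" "(2::4) \<noteq> 3" "(2::4) \<noteq> 4" "(3::4) \<noteq> 4" by simp_all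
  then show ?thesis unfolding inj_def forall_4 by metis
qed

lemma unit_square_quad: "unit_square = quad (vector [0, 0]) (vector [1, 0]) (vector [1, 1]) (vector [0, 1])"
  by (simp add: unit_square_def quad_def)

lemma E4_unit_square: "E4 V unit_square = 2 * V 1 + 2 * V (sqrt 2)"
  unfolding unit_square_quad E4_eq by (simp add: dist_2 power2_eq_square)

lemma inj_unit_square: "inj (($) unit_square)"
  unfolding unit_square_quad inj_4 by (simp add: vec_eq_iff forall_2)

lemma isometric4_E4:
  assumes "isometric4 x y"
  shows "E4 V y = E4 V x"
proof -
  obtain f a where f: "orthogonal_transformation f" "\<And>i. y $ i = a + f (x $ i)"
    using assms unfolding isometric4_def by blast
  have "dist (y $ i) (y $ j) = dist (x $ i) (x $ j)" for i j
    unfolding f(2) using f(1) by (simp add: orthogonal_transformation_isometry)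
  then show ?thesis unfolding E4_def by simp
qed

text \<open>
  The hypotheses on the potential, with \<open>\<beta>\<close> for \<open>\<alpha>''\<close> and with explicit constants. The value \<open>- 15/16\<close> makes
  the energy of the square at most \<open>- 15/4\<close>, which any four points with a distance outside
  \<open>(1 - \<alpha>, \<surd>2 + \<alpha>)\<close> exceed. The repulsion \<open>100 (k - 1)\<close> inside a cluster of \<open>k \<ge> 2\<close> points outweighs the
  attraction of the at most \<open>36 k\<close> points around it.
\<close>

locale square_potential =
  fixes V :: "real \<Rightarrow> real" and \<alpha> \<beta> :: real
  assumes tol: "0 < \<alpha>" "20 * \<alpha> \<le> \<beta>" "\<beta> \<le> 1/1000"
    and cont: "continuous_on {0<..} V"
    and lb: "\<And>r. 0 < r \<Longrightarrow> - 1 \<le> V r"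
    and well: "V 1 \<le> - 15/16" "V (sqrt 2) \<le> - 15/16"
    and far: "\<And>r. 0 < r \<Longrightarrow> r \<notin> {1 - \<alpha><..<sqrt 2 + \<alpha>} \<Longrightarrow> - 1/2 < V r"
    and core: "\<And>r. 0 < r \<Longrightarrow> r \<le> 1 - \<alpha> \<Longrightarrow> 100 \<le> V r"
    and zero: "\<And>r. sqrt 2 + \<beta> \<le> r \<Longrightarrow> V r = 0"
    and uniq: "unique_min_square V \<beta>"
begin

definition square_energy :: real where "square_energy = 2 * V 1 + 2 * V (sqrt 2)"

lemma square_energy_le: "square_energy \<le> - 15/4"
  using well by (simp add: square_energy_def)

text \<open>
  The hypothesis of unique minimality excludes isometric copies of the square, which have the same energy.
\<close>

lemma E4_near_square:
  assumes "inj (($) x)" "\<And>i j. i \<noteq> j \<Longrightarrow> dist (x $ i) (x $ j) \<in> E_set \<beta>"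
  shows "square_energy \<le> E4 V x"
proof (cases "isometric4 unit_square x")
  case True
  then show ?thesis using isometric4_E4 E4_unit_square by (simp add: square_energy_def)
next
  case False
  then show ?thesis using uniq assms unfolding unique_min_square_def square_energy_def E4_unit_square[symmetric] by fastforce
qed

lemma in_E_set:
  assumes "1 - \<alpha> < r" "r \<le> 1 + 10 * \<alpha> \<or> sqrt 2 - 4 * \<alpha> \<le> r" "r \<le> sqrt 2 + \<alpha>"
  shows "r \<in> E_set \<beta>"
  using assms tol unfolding E_set_def by auto

text \<open>
  If some distance lies outside \<open>(1 - \<alpha>, \<surd>2 + \<alpha>)\<close>, a single term worth more than \<open>- 1/2\<close>, of weight at least
  \<open>1/2\<close>, already lifts the energy above \<open>- 15/4\<close>. If not, the four points are nearly a square.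
\<close>

lemma E4_ge:
  assumes x: "inj (($) x)"
  shows "square_energy \<le> E4 V x"
proof (cases "\<forall>i j. i \<noteq> j \<longrightarrow> dist (x $ i) (x $ j) \<in> {1 - \<alpha><..<sqrt 2 + \<alpha>}")
  case True
  have "dist (x $ i) (x $ j) \<in> E_set \<beta>" if ij: "i \<noteq> j" for i j
  proof (rule in_E_set)
    show "1 - \<alpha> < dist (x $ i) (x $ j)" "dist (x $ i) (x $ j) \<le> sqrt 2 + \<alpha>" using True ij by (auto intro: less_imp_le)
    show "dist (x $ i) (x $ j) \<le> 1 + 10 * \<alpha> \<or> sqrt 2 - 4 * \<alpha> \<le> dist (x $ i) (x $ j)"
    proof (rule four_points_square[of "range (($) x)"])
      show "card (range (($) x)) = 4" using x by (simp add: card_image)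
      fix p q assume "p \<in> range (($) x)" "q \<in> range (($) x)" "p \<noteq> q"
      then obtain k l where kl: "p = x $ k" "q = x $ l" "k \<noteq> l" by auto
      then have "dist p q \<in> {1 - \<alpha><..<sqrt 2 + \<alpha>}" using True by blast
      then show "1 - \<alpha> \<le> dist p q \<and> dist p q \<le> sqrt 2 + \<alpha>" by auto
    qed (use tol ij x in \<open>auto simp: inj_def\<close>)
  qed
  then show ?thesis using E4_near_square x by blast
next
  case False
  define v where "v i j = V (dist (x $ i) (x $ j))" for i j
  obtain i j where ij: "i \<noteq> j" "dist (x $ i) (x $ j) \<notin> {1 - \<alpha><..<sqrt 2 + \<alpha>}" using False by blast
  have pos: "0 < dist (x $ k) (x $ l)" if "k \<noteq> l" for k l using x that by (auto simp: inj_def)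
  then have l: "- 1 \<le> v k l" if "k \<noteq> l" for k l using that lb unfolding v_def by blast
  have sym: "v k l = v l k" for k l by (simp add: v_def dist_commute)
  have "- 1/2 < v i j" using far[OF pos[OF ij(1)] ij(2)] by (simp add: v_def)
  moreover have ne: "(1::4) \<noteq> 2" "(1::4) \<noteq> 3" "(1::4) \<noteq> 4" "(2::4) \<noteq> 3" "(2::4) \<noteq> 4" "(3::4) \<noteq> 4" by simp_all
  ultimately have "- 1/2 < v 1 2 \<or> - 1/2 < v 2 3 \<or> - 1/2 < v 3 4 \<or> - 1/2 < v 4 1 \<or> - 1/2 < v 1 3 \<or> - 1/2 < v 2 4"
    using exhaust_4[of i] exhaust_4[of j] ij(1) sym by metis
  moreover have "E4 V x = (v 1 2 + v 2 3 + v 3 4 + v 4 1) / 2 + v 1 3 + v 2 4" unfolding v_def by (rule E4_eq)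
  moreover have "- 1 \<le> v 1 2" "- 1 \<le> v 2 3" "- 1 \<le> v 3 4" "- 1 \<le> v 4 1" "- 1 \<le> v 1 3" "- 1 \<le> v 2 4"
    using l ne by metis+
  ultimately have "- 15/4 \<le> E4 V x" by argo
  then show ?thesis using square_energy_le by linarith
qed

lemma min_E4_eq: "min_E4 V = square_energy"
  unfolding min_E4_def
proof (rule Least_equality)
  show "\<exists>x. inj (($) x) \<and> square_energy = E4 V x" using inj_unit_square E4_unit_square square_energy_def by metis
qed (use E4_ge in auto)

lemma energy_ge_separated:
  assumes X: "finite X" "\<And>x y. x \<in> X \<Longrightarrow> y \<in> X \<Longrightarrow> x \<noteq> y \<Longrightarrow> 1 - \<alpha> < dist x y"
  shows "real (card X) * square_energy \<le> energy V X"
proof -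
  interpret separated_points X \<alpha> \<beta> by standard (use X tol in auto)
  show ?thesis
  proof (rule energy_lower_bound)
    show "- 1/2 \<le> V r" if "sqrt 2 + \<alpha> \<le> r" for r
      using far[of r] that tol sqrt2_bounds by (intro less_imp_le far) auto
    show "square_energy \<le> (V (dist a b) + V (dist b c) + V (dist c d) + V (dist d a)) / 2 + V (dist a c) + V (dist b d)"
      if s: "diagonals_cross a b c d" and D: "{a, c} \<in> bonds \<alpha>" "{b, d} \<in> bonds \<alpha>" for a b c d
    proof -
      define x where "x = quad a b c d"
      note dn = cross_distinct[OF s]
      have D': "dist a c < sqrt 2 + \<alpha>" "dist b d < sqrt 2 + \<alpha>" using D by (auto simp: bond_iff)
      have ab: "\<alpha> \<le> \<beta>" using tol by linarith
      note sd = cross_dists[OF s order_refl ab D']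
      have sp: "1 - \<alpha> < dist a b" "1 - \<alpha> < dist b c" "1 - \<alpha> < dist c d" "1 - \<alpha> < dist d a"
        "1 - \<alpha> < dist a c" "1 - \<alpha> < dist b d" using X(2) dn by auto
      have "1 + 10 * \<alpha> \<le> sqrt 2 + \<alpha>" using tol sqrt2_bounds by linarith
      then have E: "dist a b \<in> E_set \<beta>" "dist b c \<in> E_set \<beta>" "dist c d \<in> E_set \<beta>" "dist d a \<in> E_set \<beta>"
        "dist a c \<in> E_set \<beta>" "dist b d \<in> E_set \<beta>"
        using sp sd D' by (auto intro!: in_E_set)
      have "dist (x $ i) (x $ j) \<in> E_set \<beta>" if "i \<noteq> j" for i j
        using exhaust_4[of i] exhaust_4[of j] that E by (auto simp: x_def dist_commute)
      moreover have "inj (($) x)" unfolding inj_4 x_def using dn by auto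
      ultimately have "square_energy \<le> E4 V x" using E4_near_square by blast
      then show ?thesis by (simp add: E4_eq x_def)
    qed
  qed (use lb zero square_energy_le in auto)
qed

section \<open>Removing collisions\<close>

definition close :: "(real^2) set \<Rightarrow> ((real^2) \<times> (real^2)) set" where
  "close X = {(x, y) \<in> X \<times> X. x \<noteq> y \<and> dist x y \<le> 1 - \<alpha>}"

lemma floor_double_bounds:
  fixes d :: real
  assumes "\<bar>d\<bar> < 3/2"
  shows "- 3 \<le> \<lfloor>2 * d\<rfloor> \<and> \<lfloor>2 * d\<rfloor> \<le> 2"
proof -
  have "- 3 \<le> 2 * d" "2 * d < 3" using assms unfolding abs_less_iff by simp_all
  then show ?thesis by (simp add: le_floor_iff floor_le_iff)
qed

lemma same_half_cell:
  fixes a b c :: real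
  assumes "\<lfloor>2 * (a - c)\<rfloor> = \<lfloor>2 * (b - c)\<rfloor>"
  shows "\<bar>a - b\<bar> \<le> 1/2"
proof -
  define n where "n = \<lfloor>2 * (a - c)\<rfloor>"
  have "real_of_int n \<le> 2 * (a - c)" "2 * (a - c) < real_of_int n + 1" by (simp_all add: n_def)
  moreover have "real_of_int n \<le> 2 * (b - c)" "2 * (b - c) < real_of_int n + 1"
    unfolding n_def assms by simp_all
  ultimately show ?thesis unfolding abs_le_iff by argo
qed

text \<open>
  The ball is covered by \<open>36\<close> squares of side \<open>1/2\<close>. The diameter of such a square is below \<open>1 - \<alpha>\<close>, so it contains at most
  \<open>k\<close> points.
\<close>

lemma crowded_ball:
  fixes x :: "real^2"
  assumes X: "finite X" and k: "\<And>y. y \<in> X \<Longrightarrow> card {z \<in> X. dist y z \<le> 1 - \<alpha>} \<le> k"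
  shows "card {y \<in> X. dist x y < 3/2} \<le> 36 * k"
proof -
  define S where "S = {y \<in> X. dist x y < 3/2}"
  \<comment> \<open>The index of the cell of side \<open>1/2\<close>, relative to \<open>x\<close>, that contains \<open>y\<close>.\<close>
  define g where "g y = (\<lfloor>2 * (y $ 1 - x $ 1)\<rfloor>, \<lfloor>2 * (y $ 2 - x $ 2)\<rfloor>)" for y :: "real^2"
  define I where "I = {-3..2::int} \<times> {-3..2::int}"
  have gI: "g y \<in> I" if "y \<in> S" for y
  proof -
    have "dist x y < 3/2" using that by (simp add: S_def)
    then have "(dist x y)\<^sup>2 < (3/2)\<^sup>2" by (intro power_strict_mono) auto
    then have "(y $ 1 - x $ 1)\<^sup>2 < (3/2)\<^sup>2" "(y $ 2 - x $ 2)\<^sup>2 < (3/2)\<^sup>2"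
      unfolding dist_sq_2 power2_commute[of "x $ 1"] power2_commute[of "x $ 2"]
      using zero_le_power2[of "y $ 1 - x $ 1"] zero_le_power2[of "y $ 2 - x $ 2"] by linarith+
    then have "\<bar>y $ 1 - x $ 1\<bar> < 3/2" "\<bar>y $ 2 - x $ 2\<bar> < 3/2"
      using power2_less_imp_less[of "\<bar>y $ 1 - x $ 1\<bar>" "3/2"] power2_less_imp_less[of "\<bar>y $ 2 - x $ 2\<bar>" "3/2"]
      by simp_all
    then have "- 3 \<le> \<lfloor>2 * (y $ 1 - x $ 1)\<rfloor> \<and> \<lfloor>2 * (y $ 1 - x $ 1)\<rfloor> \<le> 2"
      "- 3 \<le> \<lfloor>2 * (y $ 2 - x $ 2)\<rfloor> \<and> \<lfloor>2 * (y $ 2 - x $ 2)\<rfloor> \<le> 2"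
      by (simp_all only: floor_double_bounds)
    then show ?thesis unfolding g_def I_def by simp
  qed
  have "S \<subseteq> (\<Union>c\<in>I. {y \<in> S. g y = c})" using gI by blast
  then have "card S \<le> card (\<Union>c\<in>I. {y \<in> S. g y = c})"
    using X by (intro card_mono) (auto simp: S_def I_def)
  also have "\<dots> \<le> (\<Sum>c\<in>I. card {y \<in> S. g y = c})" by (rule card_UN_le) (simp add: I_def)
  also have "\<dots> \<le> (\<Sum>c\<in>I. k)"
  proof (rule sum_mono)
    fix c
    show "card {y \<in> S. g y = c} \<le> k"
    proof (cases "{y \<in> S. g y = c} = {}")
      case True
      then show ?thesis by (simp only: card.empty)
    next
      case False
      then obtain y where y: "y \<in> S" "g y = c" by blast
      have "{z \<in> S. g z = c} \<subseteq> {z \<in> X. dist y z \<le> 1 - \<alpha>}"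
      proof clarify
        fix z assume z: "z \<in> S" "c = g z"
        then have fl: "\<lfloor>2 * (y $ 1 - x $ 1)\<rfloor> = \<lfloor>2 * (z $ 1 - x $ 1)\<rfloor>" "\<lfloor>2 * (y $ 2 - x $ 2)\<rfloor> = \<lfloor>2 * (z $ 2 - x $ 2)\<rfloor>"
          using y by (simp_all add: g_def)
        have "\<bar>y $ 1 - z $ 1\<bar> \<le> 1/2" "\<bar>y $ 2 - z $ 2\<bar> \<le> 1/2"
          by (fact same_half_cell[OF fl(1)] same_half_cell[OF fl(2)])+
        then have "(y $ 1 - z $ 1)\<^sup>2 \<le> (1/2)\<^sup>2" "(y $ 2 - z $ 2)\<^sup>2 \<le> (1/2)\<^sup>2"
          by (simp_all only: abs_le_square_iff[symmetric])
        then have "(dist y z)\<^sup>2 \<le> 1/2" unfolding dist_sq_2 by (simp add: power2_eq_square)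
        also have "\<dots> \<le> (9/10)\<^sup>2" by (simp add: power2_eq_square)
        finally have "dist y z \<le> 9/10" by (rule power2_le_imp_le) simp
        then show "z \<in> X \<and> dist y z \<le> 1 - \<alpha>" using z tol by (auto simp: S_def)
      qed
      then have "card {z \<in> S. g z = c} \<le> card {z \<in> X. dist y z \<le> 1 - \<alpha>}"
        using X by (intro card_mono) auto
      also have "\<dots> \<le> k" using k y by (simp add: S_def)
      finally show ?thesis .
    qed
  qed
  also have "\<dots> = 36 * k" by (simp add: I_def card_cartesian_product)
  finally show ?thesis by (simp add: S_def)
qed

lemma far_point:
  fixes X :: "(real^2) set"
  assumes "finite X"
  obtains z where "z \<notin> X" "\<And>y. y \<in> X \<Longrightarrow> 2 \<le> dist z y"
proof -
  obtain B where B: "\<And>x. x \<in> X \<Longrightarrow> norm x \<le> B" "B > 0"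
    using finite_imp_bounded[OF assms] bounded_pos by metis
  define z :: "real^2" where "z = (B + 2) *\<^sub>R axis 1 1"
  have "norm z = B + 2" using B by (simp add: z_def norm_axis_1)
  then have "2 \<le> dist z y" if "y \<in> X" for y
    using norm_triangle_ineq2[of z y] B(1)[OF that] by (simp add: dist_norm)
  then show thesis using that[of z] by fastforce
qed

text \<open>
  Let \<open>x\<close> be a point with the largest number \<open>k \<ge> 2\<close> of points within distance \<open>1 - \<alpha>\<close>, itself included. Its repulsion is at
  least \<open>100 (k - 1)\<close>, and its attraction at most \<open>36 k\<close>. So moving \<open>x\<close> far away does not raise the energy,
  and it decreases the number of close pairs.
\<close>

lemma remove_collisions:
  assumes "finite X"
  shows "\<exists>Y. finite Y \<and> card Y = card X \<and> energy V Y \<le> energy V X \<and>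
    (\<forall>x\<in>Y. \<forall>y\<in>Y. x \<noteq> y \<longrightarrow> 1 - \<alpha> < dist x y)"
  using assms
proof (induction "card (close X)" arbitrary: X rule: less_induct)
  case less
  note fin = less.prems
  show ?case
  proof (cases "close X = {}")
    case True
    then show ?thesis using fin by (intro exI[of _ X]) (auto simp: close_def not_le[symmetric])
  next
    case False
    define near where "near x = {z \<in> X. dist x z \<le> 1 - \<alpha>}" for x
    obtain p q where pq: "p \<in> X" "q \<in> X" "p \<noteq> q" "dist p q \<le> 1 - \<alpha>" using False by (auto simp: close_def)
    have "Max ((\<lambda>x. card (near x)) ` X) \<in> (\<lambda>x. card (near x)) ` X" using fin pq by (intro Max_in) auto
    then obtain x where x: "x \<in> X" "card (near x) = Max ((\<lambda>x. card (near x)) ` X)" by force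
    have xmax: "card (near y) \<le> card (near x)" if "y \<in> X" for y
      unfolding x(2) using fin that by (intro Max_ge) auto
    have "card {p, q} \<le> card (near p)" using fin pq tol by (intro card_mono) (auto simp: near_def)
    then have k2: "2 \<le> card (near x)" using xmax[OF pq(1)] pq(3) by simp
    have xnear: "x \<in> near x" using x tol by (simp add: near_def)
    define X0 where "X0 = X - {x}"
    have X0: "finite X0" "x \<notin> X0" "X = insert x X0" using fin x by (auto simp: X0_def)
    obtain z where z: "z \<notin> X" "\<And>y. y \<in> X \<Longrightarrow> 2 \<le> dist z y" using far_point[OF fin] by metis
    \<comment> \<open>Beyond distance \<open>3/2\<close> the potential vanishes, so \<open>M\<close> contains all points that can attract \<open>x\<close>.\<close>
    define M where "M = {y \<in> X0. 1 - \<alpha> < dist x y \<and> dist x y < 3/2}"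
    have "(\<Sum>y\<in>X0. V (dist x y)) \<ge> (\<Sum>y\<in>X0. (if y \<in> near x then 100 else 0) - (if y \<in> M then 1 else 0))"
    proof (rule sum_mono)
      fix y assume y: "y \<in> X0"
      then have "0 < dist x y" "y \<in> X" using X0 by auto
      then show "(if y \<in> near x then 100 else 0) - (if y \<in> M then 1 else 0) \<le> V (dist x y)"
        using core[of "dist x y"] lb[of "dist x y"] zero[of "dist x y"] y tol sqrt2_bounds
        by (auto simp: near_def M_def)
    qed
    also have "(\<Sum>y\<in>X0. (if y \<in> near x then 100 else 0) - (if y \<in> M then 1 else 0 :: real))
        = 100 * real (card (X0 \<inter> near x)) - real (card (X0 \<inter> M))"
      using X0(1) by (simp add: sum_subtractf sum.If_cases)
    also have "X0 \<inter> near x = near x - {x}" using x by (auto simp: X0_def near_def)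
    also have "real (card (near x - {x})) = real (card (near x)) - 1"
      using k2 xnear by (simp add: card_Diff_singleton of_nat_diff)
    finally have s: "(\<Sum>y\<in>X0. V (dist x y)) \<ge> 100 * (real (card (near x)) - 1) - real (card (X0 \<inter> M))" .
    have "card (X0 \<inter> M) \<le> card {y \<in> X. dist x y < 3/2}"
      using fin X0 by (intro card_mono) (auto simp: M_def)
    also have "\<dots> \<le> 36 * card (near x)" using crowded_ball[OF fin] xmax unfolding near_def by blast
    finally have "real (card (X0 \<inter> M)) \<le> 36 * real (card (near x))" by linarith
    moreover have "2 \<le> real (card (near x))" using k2 by simp
    ultimately have s0: "(\<Sum>y\<in>X0. V (dist x y)) \<ge> 0" using s by argo
    define Y where "Y = insert z X0"
    have zX0: "z \<notin> X0" using z X0 by auto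
    have "energy V Y = energy V X0 + (\<Sum>y\<in>X0. V (dist z y))"
      unfolding Y_def using energy_insert X0 zX0 by blast
    also have "(\<Sum>y\<in>X0. V (dist z y)) = 0"
      using z(2) X0 zero tol sqrt2_bounds by (intro sum.neutral ballI zero) fastforce
    also have "energy V X0 + 0 \<le> energy V X"
      using energy_insert[OF X0(1,2), of V] X0(3) s0 by simp
    finally have EY: "energy V Y \<le> energy V X" .
    have cY: "finite Y" "card Y = card X" using X0 zX0 by (auto simp: Y_def)
    have "near x \<noteq> {x}" using k2 by auto
    then obtain y where y: "y \<in> X" "y \<noteq> x" "dist x y \<le> 1 - \<alpha>" using xnear by (auto simp: near_def)
    have "close Y \<subset> close X"
    proof
      show "close Y \<subseteq> close X"
      proof
        fix pr assume "pr \<in> close Y"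
        then obtain a b where ab: "pr = (a, b)" "a \<in> Y" "b \<in> Y" "a \<noteq> b" "dist a b \<le> 1 - \<alpha>" by (auto simp: close_def)
        have "a \<noteq> z" "b \<noteq> z" using ab z(2)[of a] z(2)[of b] tol X0 by (auto simp: Y_def dist_commute)
        then show "pr \<in> close X" using ab X0 by (auto simp: close_def Y_def)
      qed
      have "(x, y) \<in> close X" "(x, y) \<notin> close Y" using x y z(1) X0 by (auto simp: close_def Y_def)
      then show "close Y \<noteq> close X" by blast
    qed
    moreover have "finite (close X)" unfolding close_def using fin by (auto intro: finite_subset[of _ "X \<times> X"])
    ultimately have "card (close Y) < card (close X)" by (rule psubset_card_mono[rotated])
    from less.hyps[OF this cY(1)] obtain Y' where Y': "finite Y'" "card Y' = card Y" "energy V Y' \<le> energy V Y"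
      "\<forall>x\<in>Y'. \<forall>y\<in>Y'. x \<noteq> y \<longrightarrow> 1 - \<alpha> < dist x y" by blast
    have "energy V Y' \<le> energy V X" using Y'(3) EY by linarith
    then show ?thesis using Y' cY(2) by auto
  qed
qed

theorem energy_ge:
  assumes "finite X"
  shows "real (card X) * square_energy \<le> energy V X"
proof -
  obtain Y where "finite Y" "card Y = card X" "energy V Y \<le> energy V X"
    "\<forall>x\<in>Y. \<forall>y\<in>Y. x \<noteq> y \<longrightarrow> 1 - \<alpha> < dist x y" using remove_collisions[OF assms] by blast
  then show ?thesis using energy_ge_separated[of Y] by fastforce
qed

end

section \<open>Existence of minimisers\<close>

text \<open>
  Gaps longer than \<open>c\<close> between consecutive points of \<open>S\<close> are shortened to \<open>c\<close>.
\<close>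

lemma compress_reals:
  fixes S :: "real set" and c :: real
  assumes "finite S" "0 < c"
  shows "\<exists>f :: real \<Rightarrow> real. (\<forall>s\<in>S. 0 \<le> f s \<and> f s \<le> c * card S) \<and>
    (\<forall>s\<in>S. \<forall>t\<in>S. s \<le> t \<longrightarrow> f t - f s = t - s \<or> c \<le> t - s \<and> c \<le> f t - f s)"
  using assms(1)
proof (induction S rule: finite_linorder_max_induct)
  case empty
  show ?case by simp
next
  case (insert b A)
  then obtain f where f: "\<forall>s\<in>A. 0 \<le> f s \<and> f s \<le> c * card A"
    "\<forall>s\<in>A. \<forall>t\<in>A. s \<le> t \<longrightarrow> f t - f s = t - s \<or> c \<le> t - s \<and> c \<le> f t - f s" by blast
  show ?case
  proof (cases "A = {}")
    case True
    then show ?thesis using assms(2) by (intro exI[of _ "\<lambda>_. 0"]) auto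
  next
    case False
    define m where "m = Max A"
    have m: "m \<in> A" "\<And>a. a \<in> A \<Longrightarrow> a \<le> m" using False insert.hyps by (auto simp: m_def)
    have b: "b \<notin> A" "\<And>a. a \<in> A \<Longrightarrow> a < b" using insert.hyps by auto
    \<comment> \<open>The new rightmost point is placed after the image of the previous one.\<close>
    define g where "g = f(b := f m + min (b - m) c)"
    have gA: "g a = f a" if "a \<in> A" for a using that b by (auto simp: g_def)
    have gb: "g b = f m + min (b - m) c" by (simp add: g_def)
    have cardb: "c * card (insert b A) = c * card A + c" using insert.hyps b by (simp add: algebra_simps)
    have "0 \<le> g s \<and> g s \<le> c * card (insert b A)" if "s \<in> insert b A" for s
      using that f(1) m(1) b(2)[OF m(1)] gA gb assms(2) unfolding cardb by fastforce
    moreover have "g t - g s = t - s \<or> c \<le> t - s \<and> c \<le> g t - g s"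
      if st: "s \<in> insert b A" "t \<in> insert b A" "s \<le> t" for s t
    proof (cases "t = b")
      case True
      show ?thesis
      proof (cases "s = b")
        case False
        then have s: "s \<in> A" using st by auto
        then have "f m - f s = m - s \<or> c \<le> m - s \<and> c \<le> f m - f s" "s \<le> m" using f(2) m by auto
        then show ?thesis using gA[OF s] gb True b(2)[OF m(1)] assms(2) by (auto simp: min_def)
      qed (use True in auto)
    next
      case False
      then have "t \<in> A" "s \<in> A" using st b by fastforce+
      then show ?thesis using f(2) st gA by auto
    qed
    ultimately show ?thesis by blast
  qed
qed

text \<open>
  Compressing both coordinates leaves a distance unchanged unless one coordinate difference is at least \<open>2\<close>
  before and after; pairs of the latter kind do not interact.
\<close>

lemma compress_points:
  fixes X :: "(real^2) set"
  assumes X: "finite X"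
  obtains h :: "real^2 \<Rightarrow> real^2" where "\<And>p. p \<in> X \<Longrightarrow> h p \<in> cbox 0 (vector [2 * card X, 2 * card X])"
    and "\<And>p q. p \<in> X \<Longrightarrow> q \<in> X \<Longrightarrow> dist (h p) (h q) = dist p q \<or> 2 \<le> dist p q \<and> 2 \<le> dist (h p) (h q)"
proof -
  have *: "\<exists>f :: real \<Rightarrow> real. (\<forall>p\<in>X. 0 \<le> f (p $ i) \<and> f (p $ i) \<le> 2 * card X) \<and>
    (\<forall>p\<in>X. \<forall>q\<in>X. \<bar>f (p $ i) - f (q $ i)\<bar> = \<bar>p $ i - q $ i\<bar> \<or> 2 \<le> \<bar>p $ i - q $ i\<bar> \<and> 2 \<le> \<bar>f (p $ i) - f (q $ i)\<bar>)" for i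
  proof -
    define S where "S = (\<lambda>p. p $ i) ` X"
    obtain f :: "real \<Rightarrow> real" where f: "\<forall>s\<in>S. 0 \<le> f s \<and> f s \<le> 2 * card S"
      "\<forall>s\<in>S. \<forall>t\<in>S. s \<le> t \<longrightarrow> f t - f s = t - s \<or> 2 \<le> t - s \<and> 2 \<le> f t - f s"
      using compress_reals[of S 2] X by (auto simp: S_def)
    have "card S \<le> card X" unfolding S_def using X by (rule card_image_le)
    then have "0 \<le> f (p $ i) \<and> f (p $ i) \<le> 2 * card X" if "p \<in> X" for p
      using f(1) that unfolding S_def by fastforce
    moreover have "\<bar>f (p $ i) - f (q $ i)\<bar> = \<bar>p $ i - q $ i\<bar> \<or> 2 \<le> \<bar>p $ i - q $ i\<bar> \<and> 2 \<le> \<bar>f (p $ i) - f (q $ i)\<bar>"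
      if "p \<in> X" "q \<in> X" for p q
    proof -
      have "p $ i \<in> S" "q $ i \<in> S" using that by (auto simp: S_def)
      then show ?thesis using f(2)[rule_format, of "p $ i" "q $ i"] f(2)[rule_format, of "q $ i" "p $ i"] by linarith
    qed
    ultimately show ?thesis by blast
  qed
  obtain f :: "real \<Rightarrow> real" where f: "\<forall>p\<in>X. 0 \<le> f (p $ 1) \<and> f (p $ 1) \<le> 2 * card X"
    "\<forall>p\<in>X. \<forall>q\<in>X. \<bar>f (p $ 1) - f (q $ 1)\<bar> = \<bar>p $ 1 - q $ 1\<bar> \<or> 2 \<le> \<bar>p $ 1 - q $ 1\<bar> \<and> 2 \<le> \<bar>f (p $ 1) - f (q $ 1)\<bar>"
    using *[of 1] by blast
  obtain g :: "real \<Rightarrow> real" where g: "\<forall>p\<in>X. 0 \<le> g (p $ 2) \<and> g (p $ 2) \<le> 2 * card X"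
    "\<forall>p\<in>X. \<forall>q\<in>X. \<bar>g (p $ 2) - g (q $ 2)\<bar> = \<bar>p $ 2 - q $ 2\<bar> \<or> 2 \<le> \<bar>p $ 2 - q $ 2\<bar> \<and> 2 \<le> \<bar>g (p $ 2) - g (q $ 2)\<bar>"
    using *[of 2] by blast
  define h :: "real^2 \<Rightarrow> real^2" where "h p = vector [f (p $ 1), g (p $ 2)]" for p
  have h: "h p $ 1 = f (p $ 1)" "h p $ 2 = g (p $ 2)" for p by (simp_all add: h_def)
  have coord: "\<bar>p $ i - q $ i\<bar> \<le> dist p q" for p q :: "real^2" and i
    using dist_vec_nth_le[of p i q] by (simp add: dist_real_def)
  show thesis
  proof
    show "h p \<in> cbox 0 (vector [2 * card X, 2 * card X])" if "p \<in> X" for p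
      using f(1) g(1) that by (simp add: mem_box_cart forall_2 h)
    show "dist (h p) (h q) = dist p q \<or> 2 \<le> dist p q \<and> 2 \<le> dist (h p) (h q)" if pq: "p \<in> X" "q \<in> X" for p q
    proof (cases "\<bar>f (p $ 1) - f (q $ 1)\<bar> = \<bar>p $ 1 - q $ 1\<bar> \<and> \<bar>g (p $ 2) - g (q $ 2)\<bar> = \<bar>p $ 2 - q $ 2\<bar>")
      case True
      then have "(f (p $ 1) - f (q $ 1))\<^sup>2 = (p $ 1 - q $ 1)\<^sup>2" "(g (p $ 2) - g (q $ 2))\<^sup>2 = (p $ 2 - q $ 2)\<^sup>2"
        by (metis power2_abs)+
      then show ?thesis by (simp add: dist_2 h)
    next
      case False
      then have "2 \<le> \<bar>p $ 1 - q $ 1\<bar> \<and> 2 \<le> \<bar>h p $ 1 - h q $ 1\<bar> \<or> 2 \<le> \<bar>p $ 2 - q $ 2\<bar> \<and> 2 \<le> \<bar>h p $ 2 - h q $ 2\<bar>"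
        using f(2) g(2) pq unfolding h by blast
      then show ?thesis using coord[of p 1 q] coord[of p 2 q] coord[of "h p" 1 "h q"] coord[of "h p" 2 "h q"] by linarith
    qed
  qed
qed

lemma energy_image:
  assumes "inj_on h X"
  shows "energy V (h ` X) = (\<Sum>i\<in>X. \<Sum>j\<in>X - {i}. V (dist (h i) (h j))) / 2"
proof -
  have "(\<Sum>y\<in>h ` X - {h i}. V (dist (h i) y)) = (\<Sum>j\<in>X - {i}. V (dist (h i) (h j)))" if "i \<in> X" for i
  proof -
    have "h ` X - {h i} = h ` (X - {i})" using assms that by (auto simp: inj_on_def)
    moreover have "inj_on h (X - {i})" using assms by (rule inj_on_subset) auto
    ultimately show ?thesis by (simp add: sum.reindex)
  qed
  then show ?thesis unfolding energy_def by (simp add: sum.reindex[OF assms])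
qed

context square_potential begin

lemma bounded_separated_competitor:
  assumes "finite X"
  obtains Y where "finite Y" "card Y = card X" "energy V Y \<le> energy V X"
    "Y \<subseteq> cbox 0 (vector [2 * card X, 2 * card X])"
    "\<And>x y. x \<in> Y \<Longrightarrow> y \<in> Y \<Longrightarrow> x \<noteq> y \<Longrightarrow> 1 - \<alpha> \<le> dist x y"
proof -
  obtain Z where Z: "finite Z" "card Z = card X" "energy V Z \<le> energy V X"
    "\<forall>x\<in>Z. \<forall>y\<in>Z. x \<noteq> y \<longrightarrow> 1 - \<alpha> < dist x y" using remove_collisions[OF assms] by blast
  obtain h :: "real^2 \<Rightarrow> real^2" where h: "\<And>p. p \<in> Z \<Longrightarrow> h p \<in> cbox 0 (vector [2 * card Z, 2 * card Z])"
    "\<And>p q. p \<in> Z \<Longrightarrow> q \<in> Z \<Longrightarrow> dist (h p) (h q) = dist p q \<or> 2 \<le> dist p q \<and> 2 \<le> dist (h p) (h q)"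
    using compress_points[OF Z(1)] by blast
  have sep: "1 - \<alpha> \<le> dist (h p) (h q)" if "p \<in> Z" "q \<in> Z" "p \<noteq> q" for p q
    using h(2)[OF that(1,2)] Z(4) that tol by fastforce
  then have inj: "inj_on h Z" using tol by (intro inj_onI) fastforce
  have eq: "V (dist (h p) (h q)) = V (dist p q)" if "p \<in> Z" "q \<in> Z" for p q
    using h(2)[OF that] zero[of "dist p q"] zero[of "dist (h p) (h q)"] tol sqrt2_bounds by auto
  have "energy V (h ` Z) = (\<Sum>i\<in>Z. \<Sum>j\<in>Z - {i}. V (dist (h i) (h j))) / 2" by (rule energy_image[OF inj])
  also have "\<dots> = energy V Z" unfolding energy_def using eq by simp
  finally have E: "energy V (h ` Z) = energy V Z" .
  have c: "card (h ` Z) = card Z" using inj by (rule card_image)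
  show thesis
  proof (rule that)
    show "finite (h ` Z)" "card (h ` Z) = card X" "energy V (h ` Z) \<le> energy V X" using Z c E by auto
    show "h ` Z \<subseteq> cbox 0 (vector [2 * card X, 2 * card X])" using h(1) Z(2) by auto
    show "1 - \<alpha> \<le> dist x y" if "x \<in> h ` Z" "y \<in> h ` Z" "x \<noteq> y" for x y
      using that sep by blast
  qed
qed

text \<open>
  By compression it suffices to minimise over labelled configurations in a fixed box with mutual distances at
  least \<open>1 - \<alpha>\<close>. These form a compact set, on which the energy is continuous.
\<close>

lemma minimizer_exists:
  "\<exists>X. finite X \<and> card X = N \<and> (\<forall>Y. finite Y \<and> card Y = N \<longrightarrow> energy V X \<le> energy V Y)"
proof -
  define B :: "(real^2) set" where "B = cbox 0 (vector [2 * N, 2 * N])"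
  define K where "K = {p :: nat \<Rightarrow> real^2. (\<forall>i. p i \<in> B) \<and> (\<forall>i<N. \<forall>j<N. i \<noteq> j \<longrightarrow> 1 - \<alpha> \<le> dist (p i) (p j))}"
  define EN where "EN p = (\<Sum>i<N. \<Sum>j\<in>{..<N} - {i}. V (dist (p i) (p j))) / 2" for p :: "nat \<Rightarrow> real^2"
  have coord: "continuous_on S (\<lambda>p. p i)" for S and i :: nat and p :: "nat \<Rightarrow> real^2"
    using continuous_on_subset[OF continuous_on_product_coordinates[of i]] by blast
  have "compactin (product_topology (\<lambda>i::nat. euclidean :: (real^2) topology) UNIV) (PiE UNIV (\<lambda>_. B))"
    unfolding compactin_PiE by (simp add: B_def)
  then have cpt: "compact {p :: nat \<Rightarrow> real^2. \<forall>i. p i \<in> B}"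
    unfolding euclidean_product_topology by (simp add: PiE_def Pi_def)
  have "closed {p :: nat \<Rightarrow> real^2. i \<noteq> j \<longrightarrow> 1 - \<alpha> \<le> dist (p i) (p j)}" for i j
  proof (cases "i = j")
    case False
    then show ?thesis by (simp add: closed_Collect_le continuous_on_dist coord continuous_on_const)
  qed simp
  then have "closed (\<Inter>i<N. \<Inter>j<N. {p :: nat \<Rightarrow> real^2. i \<noteq> j \<longrightarrow> 1 - \<alpha> \<le> dist (p i) (p j)})"
    by (intro closed_INT) auto
  then have "compact ({p :: nat \<Rightarrow> real^2. \<forall>i. p i \<in> B} \<inter>
      (\<Inter>i<N. \<Inter>j<N. {p :: nat \<Rightarrow> real^2. i \<noteq> j \<longrightarrow> 1 - \<alpha> \<le> dist (p i) (p j)}))"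
    by (rule compact_Int_closed[OF cpt])
  also have "{p :: nat \<Rightarrow> real^2. \<forall>i. p i \<in> B} \<inter>
      (\<Inter>i<N. \<Inter>j<N. {p :: nat \<Rightarrow> real^2. i \<noteq> j \<longrightarrow> 1 - \<alpha> \<le> dist (p i) (p j)}) = K"
    unfolding K_def by auto
  finally have "compact K" .
  have posK: "1 - \<alpha> \<le> dist (p i) (p j)" if "p \<in> K" "i < N" "j < N" "i \<noteq> j" for p i j
    using that by (auto simp: K_def)
  have injK: "inj_on p {..<N}" if "p \<in> K" for p
    using posK[OF that] tol by (intro inj_onI) fastforce
  have EK: "energy V (p ` {..<N}) = EN p" if "p \<in> K" for p
    unfolding EN_def by (rule energy_image[OF injK[OF that]])
  have "continuous_on K EN"
    unfolding EN_def
  proof (intro continuous_on_divide continuous_on_sum continuous_on_const ballI)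
    fix i j assume ij: "i \<in> {..<N}" "j \<in> {..<N} - {i}"
    show "continuous_on K (\<lambda>p. V (dist (p i) (p j)))"
    proof (rule continuous_on_compose2[OF cont])
      show "continuous_on K (\<lambda>p. dist (p i) (p j))" by (intro continuous_on_dist coord)
      show "(\<lambda>p. dist (p i) (p j)) ` K \<subseteq> {0<..}" using posK ij tol by fastforce
    qed
  qed simp
  have enum: "\<exists>p\<in>K. EN p \<le> energy V Y" if Y: "finite Y" "card Y = N" for Y
  proof -
    obtain Z where Z: "finite Z" "card Z = N" "energy V Z \<le> energy V Y" "Z \<subseteq> B"
      "\<And>x y. x \<in> Z \<Longrightarrow> y \<in> Z \<Longrightarrow> x \<noteq> y \<Longrightarrow> 1 - \<alpha> \<le> dist x y"
      using bounded_separated_competitor[OF Y(1)] Y(2) unfolding B_def by metis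
    obtain q where q: "bij_betw q {0..<N} Z" using ex_bij_betw_nat_finite[OF Z(1)] Z(2) by auto
    \<comment> \<open>Labels from \<open>N\<close> on do not enter the energy; their points are placed at a corner of the box.\<close>
    define p where "p i = (if i < N then q i else 0)" for i
    have pq: "p ` {..<N} = Z" "inj_on p {..<N}"
      using q by (auto simp: bij_betw_def p_def inj_on_def image_def)
    have "0 \<in> B" by (simp add: B_def mem_box_cart forall_2)
    then have "p i \<in> B" for i using pq(1) Z(4) by (cases "i < N") (auto simp: p_def)
    moreover have "1 - \<alpha> \<le> dist (p i) (p j)" if "i < N" "j < N" "i \<noteq> j" for i j
      using Z(5)[of "p i" "p j"] pq that by (auto simp: inj_on_def)
    ultimately have "p \<in> K" by (simp add: K_def)
    then show ?thesis using EK pq Z(3) by (intro bexI[of _ p]) auto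
  qed
  obtain Y0 :: "(real^2) set" where "finite Y0" "card Y0 = N"
    using infinite_arbitrarily_large[of "UNIV :: (real^2) set" N] infinite_UNIV_char_0
    by (metis (no_types) infinite_UNIV_vec)
  then have "K \<noteq> {}" using enum by blast
  then obtain p where p: "p \<in> K" "\<And>q. q \<in> K \<Longrightarrow> EN p \<le> EN q"
    using continuous_attains_inf[OF \<open>compact K\<close> _ \<open>continuous_on K EN\<close>] by blast
  show ?thesis
  proof (intro exI[of _ "p ` {..<N}"] conjI allI impI)
    show "card (p ` {..<N}) = N" using injK p(1) by (simp add: card_image)
    fix Y :: "(real^2) set" assume "finite Y \<and> card Y = N"
    then show "energy V (p ` {..<N}) \<le> energy V Y" using enum p EK by force
  qed simp
qed

lemma min_energy_props:
  shows min_energy_le: "\<And>Y. finite Y \<Longrightarrow> card Y = N \<Longrightarrow> min_energy V N \<le> energy V Y"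
    and min_energy_ge: "real N * square_energy \<le> min_energy V N"
proof -
  obtain X where X: "finite X" "card X = N" "\<forall>Y. finite Y \<and> card Y = N \<longrightarrow> energy V X \<le> energy V Y"
    using minimizer_exists[of N] by blast
  have eq: "min_energy V N = energy V X"
    unfolding min_energy_def
  proof (rule Least_equality)
    show "\<exists>Y. finite Y \<and> card Y = N \<and> energy V X = energy V Y" using X by blast
    show "energy V X \<le> y" if "\<exists>Y. finite Y \<and> card Y = N \<and> y = energy V Y" for y using X(3) that by blast
  qed
  show "min_energy V N \<le> energy V Y" if "finite Y" "card Y = N" for Y unfolding eq using X(3) that by blast
  show "real N * square_energy \<le> min_energy V N" unfolding eq using energy_ge[OF X(1)] X(2) by simp
qed

end

section \<open>Energy of lattice configurations\<close>

abbreviation lattice_disc :: "real \<Rightarrow> (real^2) set" where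
  "lattice_disc \<rho> \<equiv> square_lattice \<inter> ball 0 \<rho>"

definition ivec :: "int \<Rightarrow> int \<Rightarrow> real^2" where
  "ivec a b = vector [of_int a, of_int b]"

lemma ivec_nth [simp]: "ivec a b $ 1 = of_int a" "ivec a b $ 2 = of_int b"
  by (simp_all add: ivec_def)

lemma ivec_eq_iff [simp]: "ivec a b = ivec c d \<longleftrightarrow> a = c \<and> b = d"
  by (simp add: vec_eq_iff forall_2)

lemma ivec_add: "ivec a b + ivec c d = ivec (a + c) (b + d)"
  by (simp add: vec_eq_iff forall_2)

lemma square_lattice_ivec: "z \<in> square_lattice \<longleftrightarrow> (\<exists>a b. z = ivec a b)"
  by (auto simp: square_lattice_def forall_2 vec_eq_iff Ints_def)

lemma lattice_closed:
  assumes "x \<in> square_lattice" "y \<in> square_lattice"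
  shows "x + y \<in> square_lattice" "x - y \<in> square_lattice"
  using assms by (auto simp: square_lattice_def)

lemma abs_nth_less: "z \<in> ball 0 \<rho> \<Longrightarrow> \<bar>z $ i\<bar> < \<rho>" for z :: "real^2"
  using component_le_norm_cart[of z i] by simp

lemma finite_disc: "finite (lattice_disc \<rho>)"
proof (rule finite_subset)
  show "lattice_disc \<rho> \<subseteq> (\<lambda>(a, b). ivec a b) ` ({-\<lceil>\<rho>\<rceil>..\<lceil>\<rho>\<rceil>} \<times> {-\<lceil>\<rho>\<rceil>..\<lceil>\<rho>\<rceil>})"
  proof
    fix z assume z: "z \<in> lattice_disc \<rho>"
    then obtain a b where ab: "z = ivec a b" by (auto simp: square_lattice_ivec)
    have "\<bar>real_of_int a\<bar> < \<rho>" "\<bar>real_of_int b\<bar> < \<rho>"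
      using abs_nth_less[of z \<rho> 1] abs_nth_less[of z \<rho> 2] z ab by simp_all
    then have "\<bar>a\<bar> \<le> \<lceil>\<rho>\<rceil>" "\<bar>b\<bar> \<le> \<lceil>\<rho>\<rceil>" by linarith+
    then show "z \<in> (\<lambda>(a, b). ivec a b) ` ({-\<lceil>\<rho>\<rceil>..\<lceil>\<rho>\<rceil>} \<times> {-\<lceil>\<rho>\<rceil>..\<lceil>\<rho>\<rceil>})"
      unfolding ab by (intro image_eqI[of _ _ "(a, b)"]) auto
  qed
qed simp

lemma norm_in_cell:
  fixes x z :: "real^2"
  assumes "x \<in> cbox z (z + 1)"
  shows "norm (x - z) < 2"
proof -
  have "0 \<le> (x - z) $ i" "(x - z) $ i \<le> 1" for i using assms by (auto simp: mem_box_cart algebra_simps)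
  then have "((x - z) $ 1)\<^sup>2 \<le> 1" "((x - z) $ 2)\<^sup>2 \<le> 1" by (auto simp: power_le_one)
  then have "(norm (x - z))\<^sup>2 < 2\<^sup>2" unfolding norm_sq_2 by simp
  then show ?thesis by (rule power2_less_imp_less) simp
qed

lemma content_cell: "measure lborel (cbox z (z + 1)) = 1" for z :: "real^2"
  by (simp add: content_cbox_cart interval_ne_empty_cart content_cbox_if_cart)

lemma cells_disjoint:
  assumes "y \<in> square_lattice" "z \<in> square_lattice" "y \<noteq> z"
  shows "box y (y + 1) \<inter> box z (z + 1) = {}"
proof -
  obtain a b c d where ab: "y = ivec a b" "z = ivec c d" using assms by (auto simp: square_lattice_ivec)
  have False if x: "x \<in> box y (y + 1)" "x \<in> box z (z + 1)" for x
  proof -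
    have "real_of_int a < x $ 1" "x $ 1 < real_of_int a + 1" "real_of_int c < x $ 1" "x $ 1 < real_of_int c + 1"
      "real_of_int b < x $ 2" "x $ 2 < real_of_int b + 1" "real_of_int d < x $ 2" "x $ 2 < real_of_int d + 1"
      using x by (simp_all add: mem_box_cart forall_2 ab)
    then have "real_of_int a < real_of_int c + 1" "real_of_int c < real_of_int a + 1"
      "real_of_int b < real_of_int d + 1" "real_of_int d < real_of_int b + 1" by linarith+
    then have "a = c" "b = d" by linarith+
    then show False using assms(3) ab by simp
  qed
  then show ?thesis by blast
qed

definition disc_area :: real where "disc_area = unit_ball_vol 2"

lemma content_ball_2: "0 \<le> r \<Longrightarrow> measure lborel (ball c r) = disc_area * r\<^sup>2" for c :: "real^2"
  using content_ball[of r c] by (simp add: disc_area_def)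

lemma disc_area_pos: "0 < disc_area" by (simp add: disc_area_def unit_ball_vol_pos)

text \<open>
  Unit cells at the lattice points of the disc are disjoint and lie in a slightly larger disc.
\<close>

lemma card_disc_upper:
  assumes "0 \<le> \<rho>"
  shows "real (card (lattice_disc \<rho>)) \<le> disc_area * (\<rho> + 2)\<^sup>2"
proof -
  have "real (card (lattice_disc \<rho>)) = (\<Sum>z\<in>lattice_disc \<rho>. measure lborel (box z (z + 1)))"
    using content_cell unfolding measure_lborel_box_eq measure_lborel_cbox_eq by simp
  also have "\<dots> = measure lborel (\<Union>z\<in>lattice_disc \<rho>. box z (z + 1))"
    by (rule measure_UNION'[symmetric])
       (use finite_disc cells_disjoint in \<open>auto simp: pairwise_def disjnt_def\<close>)
  also have "\<dots> \<le> measure lborel (ball (0 :: real^2) (\<rho> + 2))"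
  proof (rule measure_mono_fmeasurable)
    show "(\<Union>z\<in>lattice_disc \<rho>. box z (z + 1)) \<subseteq> ball 0 (\<rho> + 2)"
    proof
      fix x assume "x \<in> (\<Union>z\<in>lattice_disc \<rho>. box z (z + 1))"
      then obtain z where z: "z \<in> lattice_disc \<rho>" "x \<in> box z (z + 1)" by blast
      have "norm (x - z) < 2" using norm_in_cell z(2) box_subset_cbox by blast
      then show "x \<in> ball 0 (\<rho> + 2)" using z(1) norm_triangle_ineq[of "x - z" z] by simp
    qed
    show "ball (0 :: real^2) (\<rho> + 2) \<in> fmeasurable lborel"
      by (rule fmeasurableI) (simp_all add: emeasure_bounded_finite[OF bounded_ball, simplified])
  qed (use finite_disc in auto)
  also have "\<dots> = disc_area * (\<rho> + 2)\<^sup>2" using assms by (intro content_ball_2) auto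
  finally show ?thesis .
qed

text \<open>
  Unit cells at the lattice points of the disc cover a slightly smaller disc.
\<close>

lemma card_disc_lower:
  assumes "2 \<le> \<rho>"
  shows "disc_area * (\<rho> - 2)\<^sup>2 \<le> real (card (lattice_disc \<rho>))"
proof -
  have "disc_area * (\<rho> - 2)\<^sup>2 = measure lborel (ball (0 :: real^2) (\<rho> - 2))" using assms by (simp add: content_ball_2)
  also have "\<dots> \<le> measure lborel (\<Union>z\<in>lattice_disc \<rho>. cbox z (z + 1))"
  proof (rule measure_mono_fmeasurable)
    show "ball 0 (\<rho> - 2) \<subseteq> (\<Union>z\<in>lattice_disc \<rho>. cbox z (z + 1))"
    proof
      fix x :: "real^2" assume x: "x \<in> ball 0 (\<rho> - 2)"
      define z where "z = ivec \<lfloor>x $ 1\<rfloor> \<lfloor>x $ 2\<rfloor>"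
      have xz: "x \<in> cbox z (z + 1)" by (simp add: z_def mem_box_cart forall_2 less_imp_le[OF real_of_int_floor_add_one_gt])
      then have "norm (x - z) < 2" by (rule norm_in_cell)
      then have "norm z < \<rho>" using x norm_triangle_ineq2[of z x] by (simp add: norm_minus_commute)
      moreover have "z \<in> square_lattice" unfolding square_lattice_ivec z_def by blast
      ultimately show "x \<in> (\<Union>z\<in>lattice_disc \<rho>. cbox z (z + 1))" using xz by auto
    qed
    show "(\<Union>z\<in>lattice_disc \<rho>. cbox z (z + 1)) \<in> fmeasurable lborel" using finite_disc by (intro fmeasurable.finite_UN) auto
  qed auto
  also have "\<dots> \<le> (\<Sum>z\<in>lattice_disc \<rho>. measure lborel (cbox z (z + 1)))" by (rule measure_UNION_le) (use finite_disc in auto)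
  also have "\<dots> = real (card (lattice_disc \<rho>))" by (simp add: content_cell)
  finally show ?thesis .
qed

text \<open>
  A translation by \<open>z\<close> only loses lattice points within distance \<open>norm z\<close> of the boundary of the disc.
\<close>

lemma disc_shift_ratio:
  assumes z: "z \<in> square_lattice"
  shows "((\<lambda>\<rho>. real (card {x \<in> lattice_disc \<rho>. x + z \<in> lattice_disc \<rho>}) / real (card (lattice_disc \<rho>))) \<longlongrightarrow> 1) at_top"
proof (rule tendsto_sandwich)
  define c where "c = norm z"
  have c: "0 \<le> c" by (simp add: c_def)
  have "((\<lambda>\<rho>::real. (\<rho> - c - 2)\<^sup>2 / (\<rho> + 2)\<^sup>2) \<longlongrightarrow> 1) at_top" by real_asymp
  then show "((\<lambda>\<rho>. (disc_area * (\<rho> - c - 2)\<^sup>2) / (disc_area * (\<rho> + 2)\<^sup>2)) \<longlongrightarrow> 1) at_top"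
    using disc_area_pos by simp
  show "\<forall>\<^sub>F \<rho> in at_top. (disc_area * (\<rho> - c - 2)\<^sup>2) / (disc_area * (\<rho> + 2)\<^sup>2)
      \<le> real (card {x \<in> lattice_disc \<rho>. x + z \<in> lattice_disc \<rho>}) / real (card (lattice_disc \<rho>))"
    using eventually_ge_at_top[of "c + 3"]
  proof eventually_elim
    case (elim \<rho>)
    have "lattice_disc (\<rho> - c) \<subseteq> {x \<in> lattice_disc \<rho>. x + z \<in> lattice_disc \<rho>}"
    proof
      fix x assume x: "x \<in> lattice_disc (\<rho> - c)"
      then have "x + z \<in> lattice_disc \<rho>" using lattice_closed z norm_triangle_ineq[of x z] by (auto simp: c_def)
      then show "x \<in> {x \<in> lattice_disc \<rho>. x + z \<in> lattice_disc \<rho>}" using x c by auto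
    qed
    moreover have "finite {x \<in> lattice_disc \<rho>. x + z \<in> lattice_disc \<rho>}" by (rule finite_subset[OF _ finite_disc]) auto
    ultimately have "card (lattice_disc (\<rho> - c)) \<le> card {x \<in> lattice_disc \<rho>. x + z \<in> lattice_disc \<rho>}" by (intro card_mono)
    moreover have "disc_area * (\<rho> - c - 2)\<^sup>2 \<le> real (card (lattice_disc (\<rho> - c)))" using elim by (intro card_disc_lower) auto
    ultimately have num: "disc_area * (\<rho> - c - 2)\<^sup>2 \<le> real (card {x \<in> lattice_disc \<rho>. x + z \<in> lattice_disc \<rho>})" by linarith
    have "0 \<in> lattice_disc \<rho>" using elim c by (simp add: square_lattice_def)
    then have "0 < card (lattice_disc \<rho>)" using finite_disc by (auto simp: card_gt_0_iff)
    moreover have "real (card (lattice_disc \<rho>)) \<le> disc_area * (\<rho> + 2)\<^sup>2" using elim c by (intro card_disc_upper) auto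
    ultimately show ?case using num disc_area_pos by (intro frac_le) auto
  qed
  show "\<forall>\<^sub>F \<rho> in at_top. real (card {x \<in> lattice_disc \<rho>. x + z \<in> lattice_disc \<rho>}) / real (card (lattice_disc \<rho>)) \<le> 1"
  proof (intro always_eventually allI)
    fix \<rho>
    have le: "card {x \<in> lattice_disc \<rho>. x + z \<in> lattice_disc \<rho>} \<le> card (lattice_disc \<rho>)" by (rule card_mono[OF finite_disc]) auto
    have "real a / real b \<le> 1" if "a \<le> b" for a b :: nat
      using that by (cases "b = 0") (simp_all add: divide_le_eq_1)
    from this[OF le] show "real (card {x \<in> lattice_disc \<rho>. x + z \<in> lattice_disc \<rho>}) / real (card (lattice_disc \<rho>)) \<le> 1" .
  qed
qed (rule tendsto_const)

text \<open>
  Grouping the pairs by their difference vector turns the energy of a lattice set into a finite sum,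
  in which only the numbers of translation-related pairs depend on the set.
\<close>

lemma lattice_energy_sum:
  assumes t: "0 < t" and V: "\<And>r. 2 \<le> r \<Longrightarrow> V r = 0" and Y: "finite Y" "Y \<subseteq> square_lattice"
  shows "energy V ((*\<^sub>R) t ` Y) = (\<Sum>z\<in>lattice_disc (2 / t) - {0}. V (t * norm z) * real (card {x \<in> Y. x + z \<in> Y})) / 2"
proof -
  let ?W = "lattice_disc (2 / t) - {0}"
  have inj: "inj_on ((*\<^sub>R) t) Y" using t by (auto simp: inj_on_def)
  have row: "(\<Sum>y\<in>Y - {x}. V (dist (t *\<^sub>R x) (t *\<^sub>R y))) = (\<Sum>z | z \<in> ?W \<and> x + z \<in> Y. V (t * norm z))" if x: "x \<in> Y" for x
  proof -
    have "(\<Sum>y\<in>Y - {x}. V (dist (t *\<^sub>R x) (t *\<^sub>R y))) = (\<Sum>y\<in>(Y - {x}) \<inter> {y. y - x \<in> ?W}. V (dist (t *\<^sub>R x) (t *\<^sub>R y)))"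
    proof (rule sum.mono_neutral_right)
      show "\<forall>y\<in>Y - {x} - (Y - {x}) \<inter> {y. y - x \<in> ?W}. V (dist (t *\<^sub>R x) (t *\<^sub>R y)) = 0"
      proof
        fix y assume y: "y \<in> Y - {x} - (Y - {x}) \<inter> {y. y - x \<in> ?W}"
        then have "y - x \<in> square_lattice" using lattice_closed(2)[of y x] Y(2) x by blast
        then have "2 / t \<le> norm (y - x)" using y by auto
        then have "2 \<le> t * norm (x - y)" using t by (simp add: field_simps norm_minus_commute)
        also have "t * norm (x - y) = dist (t *\<^sub>R x) (t *\<^sub>R y)"
          using t by (simp add: dist_norm scaleR_diff_right[symmetric])
        finally show "V (dist (t *\<^sub>R x) (t *\<^sub>R y)) = 0" by (rule V)
      qed
    qed (use Y in auto)
    also have "\<dots> = (\<Sum>z | z \<in> ?W \<and> x + z \<in> Y. V (t * norm z))"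
    proof (rule sum.reindex_bij_witness[of _ "\<lambda>z. x + z" "\<lambda>y. y - x"])
      fix y
      have "dist (t *\<^sub>R x) (t *\<^sub>R y) = t * norm (y - x)"
        using t by (simp add: dist_norm scaleR_diff_right[symmetric] norm_minus_commute)
      then show "V (t * norm (y - x)) = V (dist (t *\<^sub>R x) (t *\<^sub>R y))" by simp
    qed auto
    finally show ?thesis .
  qed
  have "energy V ((*\<^sub>R) t ` Y) = (\<Sum>x\<in>Y. \<Sum>y\<in>Y - {x}. V (dist (t *\<^sub>R x) (t *\<^sub>R y))) / 2"
    by (rule energy_image[OF inj])
  also have "(\<Sum>x\<in>Y. \<Sum>y\<in>Y - {x}. V (dist (t *\<^sub>R x) (t *\<^sub>R y))) =
      (\<Sum>x\<in>Y. \<Sum>z | z \<in> ?W \<and> x + z \<in> Y. V (t * norm z))" using row by simp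
  also have "\<dots> = (\<Sum>z\<in>?W. \<Sum>x | x \<in> Y \<and> x + z \<in> Y. V (t * norm z))"
    by (rule sum.swap_restrict) (use Y finite_disc in auto)
  finally show ?thesis by (simp add: mult.commute)
qed

lemma lattice_energy_tendsto:
  assumes t: "0 < t" and V: "\<And>r. 2 \<le> r \<Longrightarrow> V r = 0"
  shows "((\<lambda>R. energy V ((*\<^sub>R) t ` square_lattice \<inter> ball 0 R) / real (card ((*\<^sub>R) t ` square_lattice \<inter> ball 0 R)))
     \<longlongrightarrow> (\<Sum>z\<in>lattice_disc (2 / t) - {0}. V (t * norm z)) / 2) at_top"
proof -
  have inj: "inj_on ((*\<^sub>R) t) Y" for Y :: "(real^2) set" using t by (auto simp: inj_on_def)
  have eq: "(*\<^sub>R) t ` square_lattice \<inter> ball 0 R = (*\<^sub>R) t ` lattice_disc (R / t)" for R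
    using t by (auto simp: field_simps)
  define G where "G \<rho> = (\<Sum>z\<in>lattice_disc (2 / t) - {0}. V (t * norm z) * (real (card {x \<in> lattice_disc \<rho>. x + z \<in> lattice_disc \<rho>}) / real (card (lattice_disc \<rho>)))) / 2" for \<rho>
  have "(G \<longlongrightarrow> (\<Sum>z\<in>lattice_disc (2 / t) - {0}. V (t * norm z) * 1) / 2) at_top"
    unfolding G_def by (intro tendsto_divide tendsto_sum tendsto_mult tendsto_const disc_shift_ratio) auto
  moreover have "filterlim (\<lambda>R. R / t) at_top at_top" using t by real_asymp
  ultimately have "((\<lambda>R. G (R / t)) \<longlongrightarrow> (\<Sum>z\<in>lattice_disc (2 / t) - {0}. V (t * norm z) * 1) / 2) at_top"
    by (rule filterlim_compose)
  moreover have "G (R / t) = energy V ((*\<^sub>R) t ` square_lattice \<inter> ball 0 R) / real (card ((*\<^sub>R) t ` square_lattice \<inter> ball 0 R))" for R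
  proof -
    have "energy V ((*\<^sub>R) t ` lattice_disc (R / t)) =
        (\<Sum>z\<in>lattice_disc (2 / t) - {0}. V (t * norm z) * real (card {x \<in> lattice_disc (R / t). x + z \<in> lattice_disc (R / t)})) / 2"
      by (rule lattice_energy_sum[OF t V finite_disc]) auto
    then show ?thesis unfolding eq card_image[OF inj] G_def by (simp add: sum_divide_distrib mult.commute)
  qed
  ultimately show ?thesis by simp
qed

lemma nearest_lattice_vectors:
  assumes V: "\<And>r. 3/2 \<le> r \<Longrightarrow> V r = 0"
  shows "(\<Sum>z\<in>lattice_disc 2 - {0}. V (norm z) * f z) =
    (\<Sum>z\<in>{ivec 1 0, ivec (-1) 0, ivec 0 1, ivec 0 (-1)}. V 1 * f z) +
    (\<Sum>z\<in>{ivec 1 1, ivec 1 (-1), ivec (-1) 1, ivec (-1) (-1)}. V (sqrt 2) * f z)"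
proof -
  define A B where "A = {ivec 1 0, ivec (-1) 0, ivec 0 1, ivec 0 (-1)}"
    and "B = {ivec 1 1, ivec 1 (-1), ivec (-1) 1, ivec (-1) (-1)}"
  have n: "norm (ivec a b) = sqrt ((of_int a)\<^sup>2 + (of_int b)\<^sup>2)" for a b
    by (metis norm_sq_2 ivec_nth real_sqrt_unique norm_ge_zero)
  have nA: "norm z = 1" if "z \<in> A" for z using that by (auto simp: A_def n)
  have nB: "norm z = sqrt 2" if "z \<in> B" for z using that by (auto simp: B_def n)
  have "(\<Sum>z\<in>lattice_disc 2 - {0}. V (norm z) * f z) = (\<Sum>z\<in>A \<union> B. V (norm z) * f z)"
  proof (rule sum.mono_neutral_right)
    show "A \<union> B \<subseteq> lattice_disc 2 - {0}"
    proof
      fix z assume z: "z \<in> A \<union> B"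
      then have "norm z = 1 \<or> norm z = sqrt 2" using nA nB by blast
      then have "norm z < 2" "z \<noteq> 0" using sqrt2_bounds by auto
      moreover have "z \<in> square_lattice" using z unfolding A_def B_def square_lattice_ivec by blast
      ultimately show "z \<in> lattice_disc 2 - {0}" by simp
    qed
    show "\<forall>z\<in>lattice_disc 2 - {0} - (A \<union> B). V (norm z) * f z = 0"
    proof
      fix z assume z: "z \<in> lattice_disc 2 - {0} - (A \<union> B)"
      then obtain a b where ab: "z = ivec a b" by (auto simp: square_lattice_ivec)
      have "\<bar>real_of_int a\<bar> < 2" "\<bar>real_of_int b\<bar> < 2"
        using abs_nth_less[of z 2 1] abs_nth_less[of z 2 2] z ab by simp_all
      then have "a \<in> {-1, 0, 1}" "b \<in> {-1, 0, 1}" by auto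
      moreover have "ivec 0 0 = 0" by (simp add: vec_eq_iff forall_2)
      ultimately have False using z ab unfolding A_def B_def by auto
      then show "V (norm z) * f z = 0" ..
    qed
  qed (use finite_disc in auto)
  also have "\<dots> = (\<Sum>z\<in>A. V (norm z) * f z) + (\<Sum>z\<in>B. V (norm z) * f z)"
    by (rule sum.union_disjoint) (auto simp: A_def B_def)
  also have "\<dots> = (\<Sum>z\<in>A. V 1 * f z) + (\<Sum>z\<in>B. V (sqrt 2) * f z)" using nA nB by simp
  finally show ?thesis unfolding A_def B_def .
qed

context square_potential begin

lemma V_zero: "\<And>r. 3/2 \<le> r \<Longrightarrow> V r = 0"
  using tol sqrt2_bounds by (intro zero) simp

lemma lattice_energy_ge:
  assumes t: "0 < t"
  shows "square_energy \<le> lattice_energy V t"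
proof -
  define A where "A R = (*\<^sub>R) t ` square_lattice \<inter> ball 0 R" for R
  have lim: "((\<lambda>R. energy V (A R) / real (card (A R))) \<longlongrightarrow> (\<Sum>z\<in>lattice_disc (2 / t) - {0}. V (t * norm z)) / 2) at_top"
    unfolding A_def using V_zero by (intro lattice_energy_tendsto t) auto
  have "square_energy \<le> (\<Sum>z\<in>lattice_disc (2 / t) - {0}. V (t * norm z)) / 2"
  proof (rule tendsto_lowerbound[OF lim])
    show "\<forall>\<^sub>F R in at_top. square_energy \<le> energy V (A R) / real (card (A R))"
      using eventually_gt_at_top[of 0]
    proof eventually_elim
      case (elim R)
      have "A R = (*\<^sub>R) t ` lattice_disc (R / t)" using t by (auto simp: A_def field_simps)
      then have fin: "finite (A R)" using finite_disc by simp
      have "0 \<in> A R" using elim by (auto simp: A_def square_lattice_def intro!: image_eqI[of _ _ 0])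
      then have "0 < card (A R)" using fin by (auto simp: card_gt_0_iff)
      then show ?case using energy_ge[OF fin] by (simp add: field_simps)
    qed
  qed simp
  moreover have "lattice_energy V t = (\<Sum>z\<in>lattice_disc (2 / t) - {0}. V (t * norm z)) / 2"
    unfolding lattice_energy_def using lim unfolding A_def by (intro tendsto_Lim) auto
  ultimately show ?thesis by simp
qed

lemma lattice_energy_1: "lattice_energy V 1 = square_energy"
proof -
  have "lattice_energy V 1 = (\<Sum>z\<in>lattice_disc (2 / 1) - {0}. V (1 * norm z)) / 2"
    unfolding lattice_energy_def by (intro tendsto_Lim lattice_energy_tendsto) (use V_zero in auto)
  also have "\<dots> = square_energy" using nearest_lattice_vectors[where V = V, OF V_zero, of "\<lambda>_. 1"] by (simp add: square_energy_def)
  finally show ?thesis .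
qed

lemma E_sq_eq: "E_sq V = square_energy"
  unfolding E_sq_def
proof (rule Least_equality)
  show "\<exists>t>0. square_energy = lattice_energy V t" using lattice_energy_1 by (intro exI[of _ 1]) auto
qed (use lattice_energy_ge in auto)

definition block :: "nat \<Rightarrow> (real^2) set" where
  "block m = (\<lambda>(a, b). ivec (int a) (int b)) ` ({..<m} \<times> {..<m})"

lemma block_props: "finite (block m)" "card (block m) = m * m" "block m \<subseteq> square_lattice" "block m \<subseteq> block (Suc m)"
proof -
  have "inj_on (\<lambda>(a, b). ivec (int a) (int b)) ({..<m} \<times> {..<m})" by (auto simp: inj_on_def)
  then show "card (block m) = m * m" unfolding block_def by (simp add: card_image card_cartesian_product)
  show "finite (block m)" "block m \<subseteq> square_lattice" "block m \<subseteq> block (Suc m)"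
    by (auto simp: block_def square_lattice_ivec intro!: imageI)
qed

text \<open>
  The \<open>(m - 2)\<^sup>2\<close> interior points of the block have all eight neighbours in \<open>Y\<close>, and other pairs at distance
  \<open>1\<close> or \<open>\<surd>2\<close> only lower the energy.
\<close>

lemma energy_lattice_patch:
  assumes Y: "finite Y" "block m \<subseteq> Y" "Y \<subseteq> square_lattice"
  shows "energy V Y \<le> square_energy * ((m - 2) * (m - 2))"
proof -
  define f where "f z = real (card {x \<in> Y. x + z \<in> Y})" for z
  have f: "real ((m - 2) * (m - 2)) \<le> f (ivec a b)" if ab: "a \<in> {-1, 0, 1}" "b \<in> {-1, 0, 1}" for a b
  proof -
    define g where "g = (\<lambda>(c, d). ivec (int c + 1) (int d + 1))"
    have "inj_on g ({..<m - 2} \<times> {..<m - 2})" by (auto simp: inj_on_def g_def)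
    then have cg: "card (g ` ({..<m - 2} \<times> {..<m - 2})) = (m - 2) * (m - 2)" by (simp add: card_image card_cartesian_product)
    have sub: "g ` ({..<m - 2} \<times> {..<m - 2}) \<subseteq> {x \<in> Y. x + ivec a b \<in> Y}"
    proof
      fix x assume "x \<in> g ` ({..<m - 2} \<times> {..<m - 2})"
      then obtain c d where cd: "x = ivec (int c + 1) (int d + 1)" "c < m - 2" "d < m - 2" by (auto simp: g_def)
      have bl: "ivec p q \<in> block m" if "0 \<le> p" "p < int m" "0 \<le> q" "q < int m" for p q
        unfolding block_def using that by (intro image_eqI[of _ _ "(nat p, nat q)"]) auto
      have "x \<in> block m" unfolding cd using cd by (intro bl) auto
      moreover have "x + ivec a b \<in> block m" unfolding cd ivec_add using cd ab by (intro bl) auto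
      ultimately show "x \<in> {x \<in> Y. x + ivec a b \<in> Y}" using Y by blast
    qed
    have "finite {x \<in> Y. x + ivec a b \<in> Y}" using Y(1) by simp
    from card_mono[OF this sub] have "(m - 2) * (m - 2) \<le> card {x \<in> Y. x + ivec a b \<in> Y}" unfolding cg .
    then show ?thesis unfolding f_def by (simp only: of_nat_le_iff)
  qed
  have "energy V Y = energy V ((*\<^sub>R) 1 ` Y)" by simp
  also have "\<dots> = (\<Sum>z\<in>lattice_disc (2 / 1) - {0}. V (1 * norm z) * f z) / 2"
    unfolding f_def by (rule lattice_energy_sum) (use Y V_zero in auto)
  also have "\<dots> = ((\<Sum>z\<in>{ivec 1 0, ivec (-1) 0, ivec 0 1, ivec 0 (-1)}. V 1 * f z) +
    (\<Sum>z\<in>{ivec 1 1, ivec 1 (-1), ivec (-1) 1, ivec (-1) (-1)}. V (sqrt 2) * f z)) / 2"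
    using nearest_lattice_vectors[where V = V, OF V_zero, of f] by simp
  also have "\<dots> \<le> ((\<Sum>z\<in>{ivec 1 0, ivec (-1) 0, ivec 0 1, ivec 0 (-1)}. V 1 * ((m - 2) * (m - 2))) +
    (\<Sum>z\<in>{ivec 1 1, ivec 1 (-1), ivec (-1) 1, ivec (-1) (-1)}. V (sqrt 2) * ((m - 2) * (m - 2)))) / 2"
    using well by (intro divide_right_mono add_mono sum_mono mult_left_mono_neg) (auto intro!: f[unfolded of_nat_mult])
  also have "\<dots> = square_energy * ((m - 2) * (m - 2))" by (simp add: square_energy_def algebra_simps)
  finally show ?thesis .
qed

text \<open>
  With \<open>m = \<lfloor>\<surd>N\<rfloor>\<close>, a set of \<open>N\<close> lattice points between the blocks of sides \<open>m\<close> and \<open>m + 1\<close> has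
  \<open>(m - 2)\<^sup>2\<close> interior points and at most \<open>6 m + 1\<close> others, and an interior point contributes at least \<open>-4\<close>.
\<close>

lemma lattice_competitor:
  "\<exists>Y. finite Y \<and> card Y = N \<and> energy V Y \<le> real N * square_energy + 24 * sqrt (real N) + 4"
proof -
  define m where "m = nat \<lfloor>sqrt (real N)\<rfloor>"
  have m: "real m \<le> sqrt (real N)" "sqrt (real N) < real m + 1" by (simp_all add: m_def)
  have "(real m)\<^sup>2 \<le> (sqrt (real N))\<^sup>2" using m by (intro power_mono) auto
  then have "real (m * m) \<le> real N" by (simp add: power2_eq_square)
  then have m1: "m * m \<le> N" by (simp only: of_nat_le_iff)
  have "(sqrt (real N))\<^sup>2 \<le> (real m + 1)\<^sup>2" using m by (intro power_mono) auto
  then have "real N \<le> real (Suc m * Suc m)" by (simp add: power2_eq_square algebra_simps)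
  then have m2: "N \<le> Suc m * Suc m" by (simp only: of_nat_le_iff)
  obtain Y where Y: "block m \<subseteq> Y" "Y \<subseteq> block (Suc m)" "card Y = N"
    using exists_subset_between[of "block m" N "block (Suc m)"] block_props m1 m2 by metis
  have fin: "finite Y" using Y(2) block_props(1) finite_subset by blast
  have "Y \<subseteq> square_lattice" using Y(2) block_props(3) by blast
  then have E: "energy V Y \<le> square_energy * ((m - 2) * (m - 2))" using energy_lattice_patch fin Y(1) by blast
  have "N \<le> (m - 2) * (m - 2) + 6 * m + 1"
  proof (cases "m < 2")
    case True
    then have "m = 0 \<or> m = 1" by auto
    then show ?thesis using m2 by auto
  next
    case False
    then obtain k where "m = k + 2" using le_Suc_ex[of 2 m] by (auto simp: add.commute)
    then show ?thesis using m2 by simp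
  qed
  then have "real N \<le> real ((m - 2) * (m - 2)) + 6 * real m + 1" by linarith
  then have gap: "real N - real ((m - 2) * (m - 2)) \<le> 6 * sqrt (real N) + 1" using m by linarith
  have "- 4 \<le> square_energy" using lb[of 1] lb[of "sqrt 2"] by (simp add: square_energy_def)
  moreover have "(m - 2) * (m - 2) \<le> N"
  proof -
    have "(m - 2) * (m - 2) \<le> m * m" by (intro mult_le_mono) auto
    then show ?thesis using m1 by linarith
  qed
  then have "0 \<le> real N - real ((m - 2) * (m - 2))" by (simp only: of_nat_le_iff diff_ge_0_iff_ge)
  ultimately have "- square_energy * (real N - real ((m - 2) * (m - 2))) \<le> 4 * (6 * sqrt (real N) + 1)"
    using gap square_energy_le by (intro mult_mono) auto
  then have "square_energy * ((m - 2) * (m - 2)) \<le> real N * square_energy + 24 * sqrt (real N) + 4" by (simp add: algebra_simps)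
  then show ?thesis using E fin Y(3) by (intro exI[of _ Y]) auto
qed

end

section \<open>Optimality of the square lattice\<close>

lemma square_potentialI:
  assumes C2: "C2_pw V" and uniq: "unique_min_square V \<beta>"
    and lb: "\<And>r. 0 < r \<Longrightarrow> - 1 \<le> V r"
    and well: "\<And>r. 0 < r \<Longrightarrow> r \<in> E_set (\<beta> / 40) \<Longrightarrow> V r \<le> - 1 + \<epsilon>"
    and far: "\<And>r. 0 < r \<Longrightarrow> r \<notin> {1 - \<beta> / 20<..<sqrt 2 + \<beta> / 20} \<Longrightarrow> - 1/2 < V r"
    and core: "\<And>r. 0 < r \<Longrightarrow> r \<le> 1 - \<beta> / 20 \<Longrightarrow> 100 \<le> V r"
    and zero: "\<And>r. 0 < r \<Longrightarrow> sqrt 2 + \<beta> \<le> r \<Longrightarrow> V r = 0"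
    and \<beta>: "0 < \<beta>" "\<beta> \<le> 1/1000" and \<epsilon>: "\<epsilon> \<le> 1/16"
  shows "square_potential V (\<beta> / 20) \<beta>"
proof
  show "continuous_on {0<..} V"
  proof (rule differentiable_imp_continuous_on)
    show "V differentiable_on {0<..}"
      using C2 unfolding C2_pw_def differentiable_on_def
      by (auto intro: differentiable_at_withinI)
  qed
  show "V 1 \<le> - 15/16" using well[of 1] \<beta> \<epsilon> by (simp add: E_set_def)
  show "V (sqrt 2) \<le> - 15/16" using well[of "sqrt 2"] \<beta> \<epsilon> by (simp add: E_set_def)
  show "V r = 0" if "sqrt 2 + \<beta> \<le> r" for r
    using that \<beta> sqrt2_bounds by (intro zero) auto
qed (use assms in auto)

lemma (in square_potential) crystallization:
  "(\<forall>N. real N * E_sq V \<le> min_energy V N) \<and>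
   (\<exists>g \<in> O(\<lambda>N. real N powr (1/2)). \<forall>N. min_energy V N \<le> real N * E_sq V + g N) \<and>
   E_sq V = min_E4 V"
proof -
  define g where "g N = 24 * sqrt (real N) + 4" for N
  have "min_energy V N \<le> real N * square_energy + g N" for N
  proof -
    obtain Y where Y: "finite Y" "card Y = N" "energy V Y \<le> real N * square_energy + 24 * sqrt (real N) + 4"
      using lattice_competitor[of N] by blast
    show ?thesis using min_energy_le[OF Y(1,2)] Y(3) by (simp add: g_def)
  qed
  moreover have "g \<in> O(\<lambda>N. real N powr (1/2))" unfolding g_def by real_asymp
  ultimately show ?thesis using min_energy_ge by (auto simp: E_sq_eq min_E4_eq)
qed

theorem theorem1p2:
  "\<exists>\<alpha>bar>0. \<exists>\<epsilon>bar>0. \<exists>K :: real \<Rightarrow> real \<Rightarrow> real.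
     \<forall>\<alpha>''\<in>{0<..\<alpha>bar}. \<forall>\<epsilon>'\<in>{0<..\<epsilon>bar}.
       \<exists>\<alpha>' \<alpha>. 0 < \<alpha>' \<and> \<alpha>' < \<alpha> \<and> \<alpha> < \<alpha>'' \<and> K \<alpha> \<epsilon>' > 0 \<and>
         (\<forall>V :: real \<Rightarrow> real.
            C2_pw V \<longrightarrow>
            strict_min_at_square V \<and> unique_min_square V \<alpha>'' \<longrightarrow>
            (\<exists>r>0. V r = -1) \<and> (\<forall>r>0. -1 \<le> V r) \<and>
              (\<forall>r>0. r \<in> E_set \<alpha>' \<longrightarrow> V r \<le> -1 + \<epsilon>') \<longrightarrow>
            (\<forall>r>0. r \<notin> {1 - \<alpha><..<sqrt 2 + \<alpha>} \<longrightarrow> V r > -1/2) \<longrightarrow>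
            (\<forall>r>0. r \<le> 1 - \<alpha> \<longrightarrow> V r \<ge> K \<alpha> \<epsilon>') \<longrightarrow>
            (\<forall>r>0. r \<ge> sqrt 2 + \<alpha>'' \<longrightarrow> V r = 0) \<longrightarrow>
            (\<forall>N. real N * E_sq V \<le> min_energy V N) \<and>
            (\<exists>g \<in> O(\<lambda>N. real N powr (1/2)).
               \<forall>N. min_energy V N \<le> real N * E_sq V + g N) \<and>
            E_sq V = min_E4 V)"
proof (rule exI[of _ "1/1000"], intro conjI, simp, rule exI[of _ "1/16"], intro conjI, simp,
    rule exI[of _ "\<lambda>_ _. 100"], intro ballI)
  fix \<alpha>'' \<epsilon>' :: real
  assume a: "\<alpha>'' \<in> {0<..1/1000}" and \<epsilon>: "\<epsilon>' \<in> {0<..1/16}"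
  \<comment> \<open>A crossing with tolerance \<open>\<alpha>\<close> has sides and diagonals within \<open>10 \<alpha>\<close> of \<open>1\<close> and \<open>\<surd>2\<close>,
      so \<open>\<alpha> = \<alpha>''/20\<close> brings all six distances into \<open>E_set \<alpha>''\<close>.\<close>
  have main: "\<forall>V :: real \<Rightarrow> real.
            C2_pw V \<longrightarrow>
            strict_min_at_square V \<and> unique_min_square V \<alpha>'' \<longrightarrow>
            (\<exists>r>0. V r = -1) \<and> (\<forall>r>0. -1 \<le> V r) \<and>
              (\<forall>r>0. r \<in> E_set (\<alpha>'' / 40) \<longrightarrow> V r \<le> -1 + \<epsilon>') \<longrightarrow>
            (\<forall>r>0. r \<notin> {1 - \<alpha>'' / 20<..<sqrt 2 + \<alpha>'' / 20} \<longrightarrow> V r > -1/2) \<longrightarrow>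
            (\<forall>r>0. r \<le> 1 - \<alpha>'' / 20 \<longrightarrow> V r \<ge> 100) \<longrightarrow>
            (\<forall>r>0. r \<ge> sqrt 2 + \<alpha>'' \<longrightarrow> V r = 0) \<longrightarrow>
            (\<forall>N. real N * E_sq V \<le> min_energy V N) \<and>
            (\<exists>g \<in> O(\<lambda>N. real N powr (1/2)).
               \<forall>N. min_energy V N \<le> real N * E_sq V + g N) \<and>
            E_sq V = min_E4 V"
  proof (intro allI impI)
    fix V :: "real \<Rightarrow> real"
    assume "C2_pw V" "strict_min_at_square V \<and> unique_min_square V \<alpha>''"
      "(\<exists>r>0. V r = -1) \<and> (\<forall>r>0. -1 \<le> V r) \<and> (\<forall>r>0. r \<in> E_set (\<alpha>'' / 40) \<longrightarrow> V r \<le> -1 + \<epsilon>')"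
      "\<forall>r>0. r \<notin> {1 - \<alpha>'' / 20<..<sqrt 2 + \<alpha>'' / 20} \<longrightarrow> V r > -1/2"
      "\<forall>r>0. r \<le> 1 - \<alpha>'' / 20 \<longrightarrow> V r \<ge> 100" "\<forall>r>0. r \<ge> sqrt 2 + \<alpha>'' \<longrightarrow> V r = 0"
    then have "square_potential V (\<alpha>'' / 20) \<alpha>''"
      using a \<epsilon> by (intro square_potentialI[where \<epsilon> = \<epsilon>']) auto
    then show "(\<forall>N. real N * E_sq V \<le> min_energy V N) \<and>
            (\<exists>g \<in> O(\<lambda>N. real N powr (1/2)).
               \<forall>N. min_energy V N \<le> real N * E_sq V + g N) \<and>
            E_sq V = min_E4 V"
      by (rule square_potential.crystallization)
  qed
  have "0 < \<alpha>'' / 40" "\<alpha>'' / 40 < \<alpha>'' / 20" "\<alpha>'' / 20 < \<alpha>''" "(0 :: real) < 100" using a by auto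
  with main show "\<exists>\<alpha>' \<alpha>. 0 < \<alpha>' \<and> \<alpha>' < \<alpha> \<and> \<alpha> < \<alpha>'' \<and> (100 :: real) > 0 \<and>
         (\<forall>V :: real \<Rightarrow> real.
            C2_pw V \<longrightarrow>
            strict_min_at_square V \<and> unique_min_square V \<alpha>'' \<longrightarrow>
            (\<exists>r>0. V r = -1) \<and> (\<forall>r>0. -1 \<le> V r) \<and>
              (\<forall>r>0. r \<in> E_set \<alpha>' \<longrightarrow> V r \<le> -1 + \<epsilon>') \<longrightarrow>
            (\<forall>r>0. r \<notin> {1 - \<alpha><..<sqrt 2 + \<alpha>} \<longrightarrow> V r > -1/2) \<longrightarrow>
            (\<forall>r>0. r \<le> 1 - \<alpha> \<longrightarrow> V r \<ge> 100) \<longrightarrow>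
            (\<forall>r>0. r \<ge> sqrt 2 + \<alpha>'' \<longrightarrow> V r = 0) \<longrightarrow>
            (\<forall>N. real N * E_sq V \<le> min_energy V N) \<and>
            (\<exists>g \<in> O(\<lambda>N. real N powr (1/2)).
               \<forall>N. min_energy V N \<le> real N * E_sq V + g N) \<and>
            E_sq V = min_E4 V)"
    by (intro exI[of _ "\<alpha>'' / 40"] exI[of _ "\<alpha>'' / 20"] conjI)
qed

end
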